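(* Let $(X_i)_{i\ge1}$ be a reversible Markov chain on a measurable space $(E,\Sigma)$ which is uniformly ergodic and satisfies the reverse Doeblin condition (see context), with constants $m,\tau,\rho$ as in the context. Let $\mathcal H$ be a set of functions $E\times E\to\mathbb R$, let $f:E\to\mathbb R$ and let $\ell(h,x_1,x_2)=\varphi(f(x_1)-f(x_2),h(x_1,x_2))$, where $\varphi:\mathbb R\times\mathbb R\to[0,1]$ is Lipschitz in its second variable with finite Lipschitz constant $\mathrm{Lip}(\varphi)$. Let $h_0,\dots,h_n\in\mathcal H$ be the hypotheses generated by an arbitrary online algorithm working with the loss $\ell$. Let $\xi>0$, $q=\frac{\xi+1}{\log(1/\rho)}$, $b_n=\lfloor q\log n\rfloor$, $c\in(0,1)$, $c_n=\lceil cn\rceil$, and $C(m,\tau)^{-1}=7\times10^3\times m^2\tau^2$. Let $\epsilon=\epsilon_n>0$ with $\epsilon_n=o(n^\xi)$ as $n\to\infty$, and let $\widehat h$ be the hypothesis selected by the penalized empirical risk rule described in the context with confidence parameter $$\gamma=64(n-c_n+1)\exp\big(-(n-c_n)\epsilon^2C(m,\tau)/128\big).$$ Then, for all sufficiently large $n$, $$\mathbb P\big(\mathcal R(\widehat h)\ge\mathcal M^n+\epsilon\big)\le32\Big[\mathcal N\Big(\mathcal H,\frac{\epsilon}{16\,\mathrm{Lip}(\varphi)}\Big)+1\Big]\exp\Big(-\frac{(c_n-b_n)\,C(m,\tau)\,\epsilon^2}{(16\,b_n)^2}+2\log n\Big).$$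
   Context: Online algorithm: for each $t$, $h_t\in\mathcal H$ is selected on the basis of the observations $(X_i,f(X_i))_{1\le i\le t}$, i.e. $h_t$ is $\sigma(X_1,\dots,X_t)$-measurable. Risk: $\mathcal R(h)=\mathbb E_{(X,X')\sim\pi\otimes\pi}[\ell(h,X,X')]$, where $\pi$ is the stationary distribution. Average paired empirical risk: $\mathcal M^n=\frac1{n-c_n}\sum_{t=c_n}^{n-1}M_t$ with $M_t=\frac1{t-b_n}\sum_{i=1}^{t-b_n}\ell(h_{t-b_n},X_t,X_i)$; $n$ is assumed large enough that $c_n-b_n\ge1$. Selection rule: let $\widehat{\mathcal R}(h_{t-b_n},t+1)=\binom{n-t}{2}^{-1}\sum_{t+1\le i<k\le n}\ell(h_{t-b_n},X_i,X_k)$ and, for $\gamma\in(0,1)$, $c_\gamma(x)=\sqrt{\frac{C(m,\tau)^{-1}}{x}\log\frac{64(n-c_n)(n-c_n+1)}{\gamma}}$. Then $\widehat h=h_{\widehat t-b_n}$ with $\widehat t\in\arg\min_{c_n\le t\le n-2}\big(\widehat{\mathcal R}(h_{t-b_n},t+1)+c_\gamma(n-t)\big)$. Covering number: $\mathcal N(\mathcal H,\eta)$ is the smallest cardinality of a set $\{g_1,\dots,g_N\}\subset\mathcal H$ such that every $h\in\mathcal H$ satisfies $\|g_i-h\|_\infty\le\eta$ for some $i$ ($+\infty$ if there is no finite one). Uniform ergodicity: with transition kernel $P$, the chain is $\psi$-irreducible for some maximal irreducibility measure $\psi$, and there exist an integer $m\ge1$, $\delta_m>0$ and a probability measure $\mu$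 with $\delta_m\mu(A)\le P^m(x,A)$ for all $x\in E$, $A\in\Sigma$. Then there is a unique stationary distribution $\pi$ and there are constants $0<\rho<1$, $L>0$ with $\sup_{A\in\Sigma}|P^n(x,A)-\pi(A)|\le L\rho^n$ for all $n\ge0$ and $\pi$-a.e. $x$; such a $\rho$ is fixed. Reverse Doeblin condition: there exist $\delta_M>0$ and a probability measure $\nu$ such that $P(x,A)\le\delta_M\nu(A)$ for all $x\in E$, $A\in\Sigma$. Constant $\tau$: consider the (Nummelin) split chain. On a possibly enlarged probability space, split time into consecutive blocks of $m$ steps and attach to the $k$-th block a variable $R_k\in\{0,1\}$ such that, given the past and the state $x$ at the beginning of the block, $R_k=1$ with probability $\delta_m$; if $R_k=1$ the state $m$ steps later is drawn from $\mu$, otherwise from $(P^m(x,\cdot)-\delta_m\mu)/(1-\delta_m)$, intermediate states being drawn from their conditional law, so that the marginal process is distributed as $(X_i)$. The regeneration times are $T_1=\inf\{k>0:R_k=1\}$ and $T_{i+1}=\inf\{k>0:R_{T_1+\dots+T_i+k}=1\}$. With $\|Y\|_{\psi_1}=\inf\{c>0:\mathbb E[\exp(|Y|/c)-1]\le1\}$, $\tau>0$ is a finite constant with $\|T_1\|_{\psi_1}\vee\|T_2\|_{\psi_1}\le\tau$. *)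

theory Defs
  imports "HOL-Probability.Probability"
begin

section \<open>Markov kernels on a measurable space\<close>

text \<open>A measure \<open>S\<close> is used only as the measurable space \<open>(space S, sets S)\<close>; a Markov kernel on it
  is a function \<open>P \<in> S \<rightarrow>\<^sub>M prob_algebra S\<close>.\<close>

primrec kernel_pow :: "'e measure \<Rightarrow> ('e \<Rightarrow> 'e measure) \<Rightarrow> nat \<Rightarrow> 'e \<Rightarrow> 'e measure" where
  "kernel_pow S P 0 = return S"
| "kernel_pow S P (Suc n) = (\<lambda>x. P x \<bind> kernel_pow S P n)"

definition stationary :: "'e measure \<Rightarrow> ('e \<Rightarrow> 'e measure) \<Rightarrow> 'e measure \<Rightarrow> bool" where
  "stationary S P \<pi> \<longleftrightarrow> prob_space \<pi> \<and> sets \<pi> = sets S \<and> \<pi> \<bind> P = \<pi>"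

definition reversible :: "'e measure \<Rightarrow> ('e \<Rightarrow> 'e measure) \<Rightarrow> 'e measure \<Rightarrow> bool" where
  "reversible S P \<pi> \<longleftrightarrow>
     (\<forall>A\<in>sets S. \<forall>B\<in>sets S. (\<integral>\<^sup>+x\<in>A. emeasure (P x) B \<partial>\<pi>) = (\<integral>\<^sup>+x\<in>B. emeasure (P x) A \<partial>\<pi>))"

definition irreducibility_measure :: "'e measure \<Rightarrow> ('e \<Rightarrow> 'e measure) \<Rightarrow> 'e measure \<Rightarrow> bool" where
  "irreducibility_measure S P \<psi> \<longleftrightarrow>
     sigma_finite_measure \<psi> \<and> sets \<psi> = sets S \<and> emeasure \<psi> (space S) > 0 \<and>
     (\<forall>A\<in>sets S. emeasure \<psi> A > 0 \<longrightarrow>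
        (\<forall>x\<in>space S. \<exists>n\<ge>1. emeasure (kernel_pow S P n x) A > 0))"

definition maximal_irreducibility_measure ::
    "'e measure \<Rightarrow> ('e \<Rightarrow> 'e measure) \<Rightarrow> 'e measure \<Rightarrow> bool" where
  "maximal_irreducibility_measure S P \<psi> \<longleftrightarrow>
     irreducibility_measure S P \<psi> \<and>
     (\<forall>\<psi>'. irreducibility_measure S P \<psi>' \<longrightarrow> absolutely_continuous \<psi> \<psi>')"

definition uniformly_ergodic ::
    "'e measure \<Rightarrow> ('e \<Rightarrow> 'e measure) \<Rightarrow> nat \<Rightarrow> real \<Rightarrow> 'e measure \<Rightarrow> bool" where
  "uniformly_ergodic S P m \<delta> \<mu> \<longleftrightarrow>
     (\<exists>\<psi>. maximal_irreducibility_measure S P \<psi>) \<and>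
     m \<ge> 1 \<and> \<delta> > 0 \<and> prob_space \<mu> \<and> sets \<mu> = sets S \<and>
     (\<forall>x\<in>space S. \<forall>A\<in>sets S. \<delta> * measure \<mu> A \<le> measure (kernel_pow S P m x) A)"

definition ergodicity_rate ::
    "'e measure \<Rightarrow> ('e \<Rightarrow> 'e measure) \<Rightarrow> 'e measure \<Rightarrow> real \<Rightarrow> bool" where
  "ergodicity_rate S P \<pi> \<rho> \<longleftrightarrow> 0 < \<rho> \<and> \<rho> < 1 \<and>
     (\<exists>L>0. AE x in \<pi>. \<forall>n. \<forall>A\<in>sets S.
        \<bar>measure (kernel_pow S P n x) A - measure \<pi> A\<bar> \<le> L * \<rho> ^ n)"

definition reverse_Doeblin :: "'e measure \<Rightarrow> ('e \<Rightarrow> 'e measure) \<Rightarrow> bool" where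
  "reverse_Doeblin S P \<longleftrightarrow>
     (\<exists>\<delta>>0. \<exists>\<nu>. prob_space \<nu> \<and> sets \<nu> = sets S \<and>
        (\<forall>x\<in>space S. \<forall>A\<in>sets S. measure (P x) A \<le> \<delta> * measure \<nu> A))"


section \<open>Markov chains and the split chain\<close>

text \<open>The \<open>\<sigma>\<close>-algebra generated by \<open>X\<^sub>i\<close> for \<open>i \<in> I\<close>.\<close>

definition process_sigma ::
    "'w measure \<Rightarrow> 'e measure \<Rightarrow> (nat \<Rightarrow> 'w \<Rightarrow> 'e) \<Rightarrow> nat set \<Rightarrow> 'w measure" where
  "process_sigma M S X I =
     vimage_algebra (space M) (\<lambda>\<omega>. \<lambda>i\<in>I. X i \<omega>) (\<Pi>\<^sub>M i\<in>I. S)"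

text \<open>Chains are indexed by \<open>i \<ge> 1\<close> (\<open>X 0\<close> is ignored); the initial distribution is arbitrary.\<close>

definition markov_chain ::
    "'w measure \<Rightarrow> 'e measure \<Rightarrow> ('e \<Rightarrow> 'e measure) \<Rightarrow> (nat \<Rightarrow> 'w \<Rightarrow> 'e) \<Rightarrow> bool" where
  "markov_chain M S P X \<longleftrightarrow>
     prob_space M \<and> P \<in> S \<rightarrow>\<^sub>M prob_algebra S \<and> (\<forall>i\<ge>1. X i \<in> M \<rightarrow>\<^sub>M S) \<and>
     (\<forall>i\<ge>1. \<forall>A\<in>sets S. AE \<omega> in M.
        real_cond_exp M (process_sigma M S X {1..i}) (indicator (X (Suc i) -` A \<inter> space M)) \<omega>
          = measure (P (X i \<omega>)) A)"

text \<open>The \<open>\<sigma>\<close>-algebra generated by \<open>Y\<^sub>i\<close> for \<open>i \<in> I\<close> and \<open>R\<^sub>j\<close> for \<open>j \<in> J\<close>.\<close>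

definition split_sigma ::
    "'v measure \<Rightarrow> 'e measure \<Rightarrow> (nat \<Rightarrow> 'v \<Rightarrow> 'e) \<Rightarrow> (nat \<Rightarrow> 'v \<Rightarrow> bool) \<Rightarrow> nat set \<Rightarrow> nat set \<Rightarrow> 'v measure"
  where
  "split_sigma N S Y R I J =
     vimage_algebra (space N) (\<lambda>\<omega>. (\<lambda>i\<in>I. Y i \<omega>, \<lambda>j\<in>J. R j \<omega>))
       ((\<Pi>\<^sub>M i\<in>I. S) \<Otimes>\<^sub>M (\<Pi>\<^sub>M j\<in>J. count_space UNIV))"

text \<open>The \<open>k\<close>-th block (\<open>k \<ge> 1\<close>) starts at time \<open>s = (k - 1) m + 1\<close> and leads to time \<open>s + m\<close>, the start
  of block \<open>k + 1\<close>. The three conditions on a block give the conditional laws of \<open>R\<^sub>k\<close>, of the state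
  at time \<open>s + m\<close>, and of the intermediate states. The last condition says that the intermediate states
  follow their conditional law given the two endpoints of the block, whatever the past and \<open>R\<^sub>k\<close> are;
  since \<open>Y\<close> is distributed as the chain, this is the conditional law under the chain. When \<open>\<delta> = 1\<close>
  the residual kernel is never used, because then \<open>R\<^sub>k\<close> holds almost surely.\<close>

definition split_chain ::
    "'w measure \<Rightarrow> 'e measure \<Rightarrow> ('e \<Rightarrow> 'e measure) \<Rightarrow> (nat \<Rightarrow> 'w \<Rightarrow> 'e) \<Rightarrow> nat \<Rightarrow> real \<Rightarrow> 'e measure \<Rightarrow>
     'v measure \<Rightarrow> (nat \<Rightarrow> 'v \<Rightarrow> 'e) \<Rightarrow> (nat \<Rightarrow> 'v \<Rightarrow> bool) \<Rightarrow> bool" where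
  "split_chain M S P X m \<delta> \<mu> N Y R \<longleftrightarrow>
     prob_space N \<and> (\<forall>i\<ge>1. Y i \<in> N \<rightarrow>\<^sub>M S) \<and> (\<forall>k\<ge>1. R k \<in> N \<rightarrow>\<^sub>M count_space UNIV) \<and>
     distr N (\<Pi>\<^sub>M i\<in>{1..}. S) (\<lambda>\<omega>. \<lambda>i\<in>{1..}. Y i \<omega>)
       = distr M (\<Pi>\<^sub>M i\<in>{1..}. S) (\<lambda>\<omega>. \<lambda>i\<in>{1..}. X i \<omega>) \<and>
     (\<forall>k\<ge>1. let s = (k - 1) * m + 1 in
        (AE \<omega> in N. real_cond_exp N (split_sigma N S Y R {1..s} {1..<k})
            (indicator {\<omega>' \<in> space N. R k \<omega>'}) \<omega> = \<delta>) \<and>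
        (\<forall>A\<in>sets S. AE \<omega> in N. real_cond_exp N (split_sigma N S Y R {1..s} {1..k})
            (indicator (Y (s + m) -` A \<inter> space N)) \<omega>
              = (if R k \<omega> then measure \<mu> A
                 else (measure (kernel_pow S P m (Y s \<omega>)) A - \<delta> * measure \<mu> A) / (1 - \<delta>))) \<and>
        (\<forall>D\<in>sets (split_sigma N S Y R {s<..<s + m} {}). AE \<omega> in N.
            real_cond_exp N (split_sigma N S Y R (insert (s + m) {1..s}) {1..k}) (indicator D) \<omega>
              = real_cond_exp N (split_sigma N S Y R {s, s + m} {}) (indicator D) \<omega>))"

text \<open>\<open>regen_time R i\<close> is \<open>T\<^sub>i\<close> for \<open>i \<ge> 1\<close>. The infimum over the empty set, which only
  occurs with probability zero, is \<open>0\<close> in type \<^typ>\<open>nat\<close>.\<close>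

fun regen_time :: "(nat \<Rightarrow> bool) \<Rightarrow> nat \<Rightarrow> nat" where
  "regen_time R i = Inf {k. k > 0 \<and> R ((\<Sum>j\<in>{1..<i}. regen_time R j) + k)}"

declare regen_time.simps [simp del]

definition psi1_norm :: "'v measure \<Rightarrow> ('v \<Rightarrow> real) \<Rightarrow> ennreal" where
  "psi1_norm N Y =
     (INF c\<in>{c. c > 0 \<and> (\<integral>\<^sup>+\<omega>. ennreal (exp (\<bar>Y \<omega>\<bar> / c) - 1) \<partial>N) \<le> 1}. ennreal c)"


section \<open>Hypotheses, losses and risks\<close>

definition sup_dist :: "'e measure \<Rightarrow> ('e \<Rightarrow> 'e \<Rightarrow> real) \<Rightarrow> ('e \<Rightarrow> 'e \<Rightarrow> real) \<Rightarrow> ennreal" where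
  "sup_dist S g h = (SUP (x, y)\<in>space S \<times> space S. ennreal \<bar>g x y - h x y\<bar>)"

text \<open>The infimum over the empty family is \<open>\<infinity>\<close>, and it is attained if the family is nonempty.\<close>

definition covering_number :: "'e measure \<Rightarrow> ('e \<Rightarrow> 'e \<Rightarrow> real) set \<Rightarrow> ennreal \<Rightarrow> ennreal" where
  "covering_number S H \<eta> =
     (INF G\<in>{G. finite G \<and> G \<subseteq> H \<and> (\<forall>h\<in>H. \<exists>g\<in>G. sup_dist S g h \<le> \<eta>)}. of_nat (card G))"

text \<open>The least Lipschitz constant in the second variable. When it is \<open>0\<close>, the radius
  \<open>\<epsilon> / (16 Lip \<phi>)\<close>, computed in \<^typ>\<open>ennreal\<close>, is \<open>\<infinity>\<close>.\<close>

definition Lip :: "(real \<Rightarrow> real \<Rightarrow> real) \<Rightarrow> real" where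
  "Lip \<phi> = Inf {L. \<forall>u. L-lipschitz_on UNIV (\<phi> u)}"

definition loss :: "(real \<Rightarrow> real \<Rightarrow> real) \<Rightarrow> ('e \<Rightarrow> real) \<Rightarrow> ('e \<Rightarrow> 'e \<Rightarrow> real) \<Rightarrow> 'e \<Rightarrow> 'e \<Rightarrow> real" where
  "loss \<phi> f h x1 x2 = \<phi> (f x1 - f x2) (h x1 x2)"

text \<open>In the risks below \<open>l\<close> is a loss, \<open>x\<close> a realised trajectory and \<open>hs\<close> the realised sequence of
  hypotheses. The natural-number subtractions are exact when \<open>b < cn \<le> t < n\<close>.\<close>

definition risk :: "(('e \<Rightarrow> 'e \<Rightarrow> real) \<Rightarrow> 'e \<Rightarrow> 'e \<Rightarrow> real) \<Rightarrow> 'e measure \<Rightarrow> ('e \<Rightarrow> 'e \<Rightarrow> real) \<Rightarrow> real" where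
  "risk l \<pi> h = (\<integral>(x, x'). l h x x' \<partial>(\<pi> \<Otimes>\<^sub>M \<pi>))"

definition paired_risk :: "(('e \<Rightarrow> 'e \<Rightarrow> real) \<Rightarrow> 'e \<Rightarrow> 'e \<Rightarrow> real) \<Rightarrow> nat \<Rightarrow>
    (nat \<Rightarrow> 'e) \<Rightarrow> (nat \<Rightarrow> 'e \<Rightarrow> 'e \<Rightarrow> real) \<Rightarrow> nat \<Rightarrow> real" where
  "paired_risk l b x hs t = (\<Sum>i=1..t - b. l (hs (t - b)) (x t) (x i)) / real (t - b)"

definition avg_paired_risk :: "(('e \<Rightarrow> 'e \<Rightarrow> real) \<Rightarrow> 'e \<Rightarrow> 'e \<Rightarrow> real) \<Rightarrow> nat \<Rightarrow> nat \<Rightarrow>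
    (nat \<Rightarrow> 'e) \<Rightarrow> (nat \<Rightarrow> 'e \<Rightarrow> 'e \<Rightarrow> real) \<Rightarrow> nat \<Rightarrow> real" where
  "avg_paired_risk l b cn x hs n = (\<Sum>t=cn..<n. paired_risk l b x hs t) / real (n - cn)"

text \<open>\<open>emp_risk l x n h s\<close> averages over the pairs \<open>s \<le> i < k \<le> n\<close>.\<close>

definition emp_risk :: "(('e \<Rightarrow> 'e \<Rightarrow> real) \<Rightarrow> 'e \<Rightarrow> 'e \<Rightarrow> real) \<Rightarrow> (nat \<Rightarrow> 'e) \<Rightarrow> nat \<Rightarrow>
    ('e \<Rightarrow> 'e \<Rightarrow> real) \<Rightarrow> nat \<Rightarrow> real" where
  "emp_risk l x n h s =
     (\<Sum>i=s..n. \<Sum>k=i+1..n. l h (x i) (x k)) / real ((n + 1 - s) choose 2)"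

definition conc_const :: "nat \<Rightarrow> real \<Rightarrow> real" where
  "conc_const m \<tau> = 1 / (7 * 10 ^ 3 * (real m)\<^sup>2 * \<tau>\<^sup>2)"

definition penalty :: "real \<Rightarrow> nat \<Rightarrow> nat \<Rightarrow> real \<Rightarrow> real \<Rightarrow> real" where
  "penalty C n cn \<gamma> x =
     sqrt (inverse C / x * ln (64 * real (n - cn) * real (n - cn + 1) / \<gamma>))"

definition selects :: "(('e \<Rightarrow> 'e \<Rightarrow> real) \<Rightarrow> 'e \<Rightarrow> 'e \<Rightarrow> real) \<Rightarrow> real \<Rightarrow> real \<Rightarrow> nat \<Rightarrow> nat \<Rightarrow>
    (nat \<Rightarrow> 'e) \<Rightarrow> (nat \<Rightarrow> 'e \<Rightarrow> 'e \<Rightarrow> real) \<Rightarrow> nat \<Rightarrow> nat \<Rightarrow> bool" where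
  "selects l C \<gamma> b cn x hs n t0 \<longleftrightarrow>
     is_arg_min (\<lambda>t. emp_risk l x n (hs (t - b)) (t + 1) + penalty C n cn \<gamma> (real (n - t)))
       (\<lambda>t. cn \<le> t \<and> t + 2 \<le> n) t0"

text \<open>The hypotheses \<open>h\<^sub>0, \<dots>, h\<^sub>n\<close> of an online algorithm: measurability of \<open>h\<^sub>t\<close> with respect to
  \<open>\<sigma>(X\<^sub>1, \<dots>, X\<^sub>t)\<close> is joint measurability of \<open>(\<omega>, x, y) \<mapsto> h\<^sub>t(\<omega>)(x, y)\<close>.\<close>

definition online_algorithm :: "'w measure \<Rightarrow> 'e measure \<Rightarrow> (nat \<Rightarrow> 'w \<Rightarrow> 'e) \<Rightarrow>
    ('e \<Rightarrow> 'e \<Rightarrow> real) set \<Rightarrow> nat \<Rightarrow> (nat \<Rightarrow> 'w \<Rightarrow> 'e \<Rightarrow> 'e \<Rightarrow> real) \<Rightarrow> bool" where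
  "online_algorithm M S X H n h \<longleftrightarrow>
     (\<forall>t\<le>n. (\<forall>\<omega>\<in>space M. h t \<omega> \<in> H) \<and>
        (\<lambda>(\<omega>, x, y). h t \<omega> x y)
          \<in> borel_measurable (process_sigma M S X {1..t} \<Otimes>\<^sub>M (S \<Otimes>\<^sub>M S)))"

end

theory Submission
  imports Defs "HOL-Real_Asymp.Real_Asymp"
begin

text \<open>
  Only the order of the exponent matters: because \<open>b\<^sub>n\<^sup>2 \<rightarrow> \<infinity>\<close>, a tail bound
  \<open>exp (- \<kappa> n \<epsilon>\<^sup>2 / b\<^sub>n)\<close> with any constant \<open>\<kappa> > 0\<close> depending on the chain beats the
  claimed one for large \<open>n\<close>. One may also assume \<open>\<epsilon> \<le> 1\<close> (otherwise the event is empty) and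
  that the claimed exponent is negative (otherwise the bound exceeds \<open>1\<close>); then \<open>n \<epsilon>\<^sup>2\<close> is at
  least of order \<open>b\<^sub>n\<^sup>2 log n\<close>, which absorbs all bias terms.

  The minorization makes \<open>P\<^sup>j g\<close> converge geometrically to \<open>\<pi> g\<close>, so solutions of the Poisson
  equation \<open>u - P u = g - \<pi> g\<close> are bounded, and both empirical means and U-statistics of the
  chain are martingales with bounded increments up to bounded corrections; Azuma's inequality
  applies directly.

  The difference between the average risk of the hypotheses and \<open>\<M>\<^sup>n\<close> splits into a uniform
  deviation of empirical means over an \<open>\<epsilon>\<close>-net of hypotheses, the bias
  \<open>\<bar>P\<^sup>b \<psi>\<^sub>t - \<pi> \<psi>\<^sub>t\<bar> \<le> L \<rho>\<^sup>b = O(1/n)\<close>, and the sum of \<open>P\<^sup>b \<psi>\<^sub>t (X\<^bsub>t-b\<^esub>) - \<psi>\<^sub>t (X\<^sub>t)\<close>, which is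
  a martingale along each residue class modulo \<open>b\<close>. The selected hypothesis has risk at most
  \<open>\<R>(h\<^bsub>t-b\<^esub>) + 2 c\<^sub>\<gamma>(n - t)\<close> for every \<open>t\<close>, and the average over \<open>t\<close> of the penalties
  \<open>2 c\<^sub>\<gamma>(n - t)\<close> is below \<open>\<epsilon> / 2\<close>.
\<close>

text \<open>Two rates of convergence are in play. Minorization yields \<open>\<theta>\<close>, valid
  from every starting point and responsible for the constants of the martingale bounds, but (1 -
  \<delta>)^(b/m) need not be O(1/n), since q is calibrated by \<rho>. The bias therefore uses
  \<rho>, whose bound may fail on a \<pi>-null set; with an arbitrary initial law the chain can
  visit that set, and the probability of this is again controlled by \<open>\<theta>\<close>.

  The hypothesis h_(t-b) depends on the very points X_i, i \<le> t - b, over which the paired risk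
  averages; this forces a bound uniform in the hypothesis, hence the net. The U-statistic at t uses
  only points after t, when the hypothesis is already frozen, so no net enters there.

  The choice of \<gamma> makes the penalty equal to sqrt (V / (n - t)) with V = ln (n - c_n) / C +
  (n - c_n) \<epsilon>^2 / 128. For V large, the U-statistic on n - t points deviates by that much
  with probability at most 2 exp (- V / (128 K^2)), a bound free of t, so that penalty and deviation
  match and a union bound over t is cheap.\<close>

section \<open>Conditional laws and Azuma's inequality\<close>

lemma measurable_ident_subalgebra:
  "subalgebra M F \<Longrightarrow> (\<lambda>\<omega>. \<omega>) \<in> M \<rightarrow>\<^sub>M F"
  by (rule measurable_from_subalg) auto

text \<open>A regular conditional law of \<open>Z\<close> given \<open>F\<close>, stated as a
  disintegration. The test function may depend on \<omega> as well, so it can carry random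
  F-measurable coefficients, and nonnegative integrands spare every integrability check.\<close>

definition cond_law ::
    "'w measure \<Rightarrow> 'w measure \<Rightarrow> 'e measure \<Rightarrow> ('w \<Rightarrow> 'e) \<Rightarrow> ('w \<Rightarrow> 'e measure) \<Rightarrow> bool" where
  "cond_law M F S Z \<kappa> \<longleftrightarrow>
     subalgebra M F \<and> Z \<in> M \<rightarrow>\<^sub>M S \<and> \<kappa> \<in> F \<rightarrow>\<^sub>M prob_algebra S \<and>
     (\<forall>g\<in>borel_measurable (F \<Otimes>\<^sub>M S).
        (\<integral>\<^sup>+\<omega>. g (\<omega>, Z \<omega>) \<partial>M) = (\<integral>\<^sup>+\<omega>. \<integral>\<^sup>+y. g (\<omega>, y) \<partial>\<kappa> \<omega> \<partial>M :: ennreal))"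

lemma cond_lawD:
  assumes "cond_law M F S Z \<kappa>"
  shows "subalgebra M F" "Z \<in> M \<rightarrow>\<^sub>M S" "\<kappa> \<in> F \<rightarrow>\<^sub>M prob_algebra S"
    "\<kappa> \<in> F \<rightarrow>\<^sub>M subprob_algebra S"
    "space F = space M" "sets F \<subseteq> sets M"
  using assms by (auto simp: cond_law_def subalgebra_def dest: measurable_prob_algebraD)

lemma cond_law_nn_integral:
  assumes "cond_law M F S Z \<kappa>" "g \<in> borel_measurable (F \<Otimes>\<^sub>M S)"
  shows "(\<integral>\<^sup>+\<omega>. g (\<omega>, Z \<omega>) \<partial>M) = (\<integral>\<^sup>+\<omega>. \<integral>\<^sup>+y. g (\<omega>, y) \<partial>\<kappa> \<omega> \<partial>M)"
  using assms by (auto simp: cond_law_def)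

text \<open>Pushing \<open>L x\<close> forward along y \<mapsto> (x, y) moves the dependence on x
  from the integrand into the kernel; the integral of a fixed function against a kernel is
  measurable.\<close>

lemma integral_measurable_kernel:
  fixes f :: "'a \<Rightarrow> 'b \<Rightarrow> real"
  assumes f[measurable]: "(\<lambda>(x, y). f x y) \<in> borel_measurable (M \<Otimes>\<^sub>M N)"
  assumes L[measurable]: "L \<in> measurable M (subprob_algebra N)"
  shows "(\<lambda>x. \<integral>y. f x y \<partial>L x) \<in> borel_measurable M"
proof -
  note measurable_distr2[measurable]
  have "(\<lambda>x. integral\<^sup>L (distr (L x) (M \<Otimes>\<^sub>M N) (\<lambda>y. (x, y))) (\<lambda>(x, y). f x y)) \<in> borel_measurable M"
    by measurable
  then show ?thesis
  proof (rule measurable_cong[THEN iffD1, rotated])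
    fix x assume "x \<in> space M"
    then have "(\<lambda>y. (x, y)) \<in> L x \<rightarrow>\<^sub>M M \<Otimes>\<^sub>M N"
      using sets_kernel[OF L] by (subst measurable_cong_sets[OF _ refl, of _ N]) auto
    then show "integral\<^sup>L (distr (L x) (M \<Otimes>\<^sub>M N) (\<lambda>y. (x, y))) (\<lambda>(x, y). f x y) = (\<integral>y. f x y \<partial>L x)"
      by (subst integral_distr[OF _ f]) simp_all
  qed
qed

text \<open>Both sides of the disintegration are integrals of \<open>g\<close> against finite
  measures on the product, and rectangles are an intersection-stable generator, so indicators of
  rectangles suffice.\<close>

lemma cond_lawI:
  fixes Z :: "'w \<Rightarrow> 'e"
  assumes M: "prob_space M" and sub: "subalgebra M F" and Z: "Z \<in> M \<rightarrow>\<^sub>M S"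
    and \<kappa>: "\<kappa> \<in> F \<rightarrow>\<^sub>M prob_algebra S"
    and rect: "\<And>A B. A \<in> sets F \<Longrightarrow> B \<in> sets S \<Longrightarrow>
      emeasure M (A \<inter> (Z -` B \<inter> space M)) = (\<integral>\<^sup>+\<omega>\<in>A. emeasure (\<kappa> \<omega>) B \<partial>M)"
  shows "cond_law M F S Z \<kappa>"
proof -
  interpret prob_space M by fact
  have sp: "space F = space M" and se: "sets F \<subseteq> sets M" using sub by (auto simp: subalgebra_def)
  have \<kappa>s[measurable]: "\<kappa> \<in> F \<rightarrow>\<^sub>M subprob_algebra S" by (rule measurable_prob_algebraD[OF \<kappa>])
  note id[measurable] = measurable_ident_subalgebra[OF sub]
  note Z[measurable]
  let ?K = "\<lambda>\<omega>. distr (\<kappa> \<omega>) (F \<Otimes>\<^sub>M S) (Pair \<omega>)"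
  have K[measurable]: "?K \<in> F \<rightarrow>\<^sub>M subprob_algebra (F \<Otimes>\<^sub>M S)"
    by (rule measurable_distr2[where M=S]) auto
  have setsK: "sets (\<kappa> \<omega>) = sets S" if "\<omega> \<in> space M" for \<omega>
    using sets_kernel[OF \<kappa>s] that sp by simp
  \<comment> \<open>\<open>\<mu>1\<close> is the joint law of \<omega> and
    \<open>Z \<omega>\<close>, whereas \<open>\<mu>2\<close> draws \<omega> first and then the
    second coordinate from \<open>\<kappa> \<omega>\<close>.\<close>
  define \<mu>1 where "\<mu>1 = distr M (F \<Otimes>\<^sub>M S) (\<lambda>\<omega>. (\<omega>, Z \<omega>))"
  define \<mu>2 where "\<mu>2 = distr M F (\<lambda>\<omega>. \<omega>) \<bind> ?K"
  have ne: "space (distr M F (\<lambda>\<omega>. \<omega>)) \<noteq> {}" using sp not_empty by simp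
  have nn2: "(\<integral>\<^sup>+z. g z \<partial>\<mu>2) = (\<integral>\<^sup>+\<omega>. \<integral>\<^sup>+y. g (\<omega>, y) \<partial>\<kappa> \<omega> \<partial>M)"
    if [measurable]: "g \<in> borel_measurable (F \<Otimes>\<^sub>M S)" for g :: "'w \<times> 'e \<Rightarrow> ennreal"
  proof -
    have "(\<integral>\<^sup>+z. g z \<partial>\<mu>2) = (\<integral>\<^sup>+\<omega>. \<integral>\<^sup>+z. g z \<partial>?K \<omega> \<partial>distr M F (\<lambda>\<omega>. \<omega>))"
      unfolding \<mu>2_def by (rule nn_integral_bind[where B="F \<Otimes>\<^sub>M S"]) (auto simp: measurable_distr_eq1)
    also have "\<dots> = (\<integral>\<^sup>+\<omega>. \<integral>\<^sup>+z. g z \<partial>?K \<omega> \<partial>M)"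
      by (rule nn_integral_distr) auto
    also have "\<dots> = (\<integral>\<^sup>+\<omega>. \<integral>\<^sup>+y. g (\<omega>, y) \<partial>\<kappa> \<omega> \<partial>M)"
    proof (rule nn_integral_cong)
      fix \<omega> assume "\<omega> \<in> space M"
      then have "Pair \<omega> \<in> \<kappa> \<omega> \<rightarrow>\<^sub>M F \<Otimes>\<^sub>M S"
        using sp by (subst measurable_cong_sets[OF setsK refl]) auto
      then show "(\<integral>\<^sup>+z. g z \<partial>?K \<omega>) = (\<integral>\<^sup>+y. g (\<omega>, y) \<partial>\<kappa> \<omega>)"
        by (subst nn_integral_distr) auto
    qed
    finally show ?thesis .
  qed
  have "\<mu>1 = \<mu>2"
  proof (rule measure_eqI_generator_eq[OF Int_stable_pair_measure_generator[of F S], where A="\<lambda>_. space F \<times> space S"])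
    show "{a \<times> b |a b. a \<in> sets F \<and> b \<in> sets S} \<subseteq> Pow (space F \<times> space S)"
      by (rule pair_measure_closed)
    show "sets \<mu>1 = sigma_sets (space F \<times> space S) {a \<times> b |a b. a \<in> sets F \<and> b \<in> sets S}"
      unfolding \<mu>1_def by (simp add: sets_pair_measure)
    show "sets \<mu>2 = sigma_sets (space F \<times> space S) {a \<times> b |a b. a \<in> sets F \<and> b \<in> sets S}"
      unfolding \<mu>2_def using ne K by (subst sets_bind[where N="F \<Otimes>\<^sub>M S"]) (auto simp: sets_pair_measure)
    show "emeasure \<mu>1 (space F \<times> space S) \<noteq> \<infinity>" for i :: nat
      unfolding \<mu>1_def by (subst emeasure_distr) auto
    fix X assume "X \<in> {a \<times> b |a b. a \<in> sets F \<and> b \<in> sets S}"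
    then obtain A B where X: "X = A \<times> B" and A: "A \<in> sets F" and B: "B \<in> sets S" by auto
    have XS: "X \<in> sets (F \<Otimes>\<^sub>M S)" using A B X by auto
    have "emeasure \<mu>1 X = emeasure M (A \<inter> (Z -` B \<inter> space M))"
      unfolding \<mu>1_def using XS X A se sets.sets_into_space
      by (subst emeasure_distr) (auto intro!: arg_cong[where f="emeasure M"])
    also have "\<dots> = (\<integral>\<^sup>+\<omega>\<in>A. emeasure (\<kappa> \<omega>) B \<partial>M)" by (rule rect[OF A B])
    also have "\<dots> = (\<integral>\<^sup>+\<omega>. \<integral>\<^sup>+y. indicator X (\<omega>, y) \<partial>\<kappa> \<omega> \<partial>M)"
    proof (rule nn_integral_cong)
      fix \<omega> assume "\<omega> \<in> space M"
      then have "B \<in> sets (\<kappa> \<omega>)" using B setsK by simp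
      then have "(\<integral>\<^sup>+y. indicator A \<omega> * indicator B y \<partial>\<kappa> \<omega>) = indicator A \<omega> * emeasure (\<kappa> \<omega>) B"
        by (simp add: nn_integral_cmult)
      then show "emeasure (\<kappa> \<omega>) B * indicator A \<omega> = (\<integral>\<^sup>+y. indicator X (\<omega>, y) \<partial>\<kappa> \<omega>)"
        by (simp add: X indicator_times mult.commute)
    qed
    also have "\<dots> = (\<integral>\<^sup>+z. indicator X z \<partial>\<mu>2)"
      using nn2[of "indicator X"] XS by simp
    also have "\<dots> = emeasure \<mu>2 X"
      using XS unfolding \<mu>2_def using ne K by (subst nn_integral_indicator) (auto simp: sets_bind[where N="F \<Otimes>\<^sub>M S"])
    finally show "emeasure \<mu>1 X = emeasure \<mu>2 X" .
  qed (auto)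
  then have "(\<integral>\<^sup>+\<omega>. g (\<omega>, Z \<omega>) \<partial>M) = (\<integral>\<^sup>+\<omega>. \<integral>\<^sup>+y. g (\<omega>, y) \<partial>\<kappa> \<omega> \<partial>M)"
    if [measurable]: "g \<in> borel_measurable (F \<Otimes>\<^sub>M S)" for g :: "'w \<times> 'e \<Rightarrow> ennreal"
  proof -
    have "(\<integral>\<^sup>+z. g z \<partial>\<mu>1) = (\<integral>\<^sup>+\<omega>. g (\<omega>, Z \<omega>) \<partial>M)"
      unfolding \<mu>1_def by (rule nn_integral_distr) auto
    then show ?thesis using nn2[OF that] \<open>\<mu>1 = \<mu>2\<close> by simp
  qed
  then show ?thesis using sub Z \<kappa> by (auto simp: cond_law_def)
qed

text \<open>Hoeffding's lemma under \<open>\<kappa> \<omega>\<close> for each fixed \<omega>. The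
  known factor \<open>exp (V \<omega>)\<close> is carried along so that the estimate can be
  iterated.\<close>

lemma cond_law_hoeffding:
  fixes G :: "'w \<Rightarrow> 'e \<Rightarrow> real"
  assumes c: "cond_law M F S Z \<kappa>"
    and G: "(\<lambda>(\<omega>, y). G \<omega> y) \<in> borel_measurable (F \<Otimes>\<^sub>M S)"
    and bd: "\<And>\<omega> y. \<omega> \<in> space M \<Longrightarrow> y \<in> space S \<Longrightarrow> \<bar>G \<omega> y\<bar> \<le> d"
    and V: "V \<in> borel_measurable F" and l: "l > 0"
  shows "(\<integral>\<^sup>+\<omega>. ennreal (exp (V \<omega> + l * (G \<omega> (Z \<omega>) - (\<integral>y. G \<omega> y \<partial>\<kappa> \<omega>)))) \<partial>M)
     \<le> ennreal (exp (l\<^sup>2 * d\<^sup>2 / 2)) * (\<integral>\<^sup>+\<omega>. ennreal (exp (V \<omega>)) \<partial>M)"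
proof -
  note [measurable] = cond_lawD(3,4)[OF c] G V
  note sp = cond_lawD(5)[OF c]
  let ?g = "\<lambda>(\<omega>, y). ennreal (exp (V \<omega> + l * (G \<omega> y - (\<integral>y. G \<omega> y \<partial>\<kappa> \<omega>))))"
  have I[measurable]: "(\<lambda>\<omega>. \<integral>y. G \<omega> y \<partial>\<kappa> \<omega>) \<in> borel_measurable F"
    by (rule integral_measurable_kernel[where N=S]) auto
  have gm: "?g \<in> borel_measurable (F \<Otimes>\<^sub>M S)" by measurable
  have Ve: "(\<lambda>\<omega>. ennreal (exp (V \<omega>))) \<in> borel_measurable M"
    by (rule measurable_from_subalg[OF cond_lawD(1)[OF c]]) measurable
  have "(\<integral>\<^sup>+\<omega>. ennreal (exp (V \<omega> + l * (G \<omega> (Z \<omega>) - (\<integral>y. G \<omega> y \<partial>\<kappa> \<omega>)))) \<partial>M)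
      = (\<integral>\<^sup>+\<omega>. \<integral>\<^sup>+y. ?g (\<omega>, y) \<partial>\<kappa> \<omega> \<partial>M)"
    using cond_law_nn_integral[OF c gm] by simp
  also have "\<dots> \<le> (\<integral>\<^sup>+\<omega>. ennreal (exp (l\<^sup>2 * d\<^sup>2 / 2)) * ennreal (exp (V \<omega>)) \<partial>M)"
  proof (rule nn_integral_mono)
    fix \<omega> assume w: "\<omega> \<in> space M"
    have ps: "prob_space (\<kappa> \<omega>)" and se: "sets (\<kappa> \<omega>) = sets S"
      using measurable_space[OF cond_lawD(3)[OF c], of \<omega>] w sp by (auto simp: space_prob_algebra)
    have spk: "space (\<kappa> \<omega>) = space S" using se by (rule sets_eq_imp_space_eq)
    have Gm: "(\<lambda>y. G \<omega> y) \<in> borel_measurable (\<kappa> \<omega>)"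
      using w sp by (subst measurable_cong_sets[OF se refl]) simp
    interpret prob_space "\<kappa> \<omega>" by fact
    interpret interval_bounded_random_variable "\<kappa> \<omega>" "G \<omega>" "-d" d
      using Gm by unfold_locales (use bd[OF w] spk in \<open>auto simp: abs_le_iff minus_le_iff\<close>)
    have "(\<integral>\<^sup>+y. ?g (\<omega>, y) \<partial>\<kappa> \<omega>) =
        (\<integral>\<^sup>+y. ennreal (exp (V \<omega>)) * ennreal (exp (l * (G \<omega> y - (\<integral>y. G \<omega> y \<partial>\<kappa> \<omega>)))) \<partial>\<kappa> \<omega>)"
      by (simp add: exp_add ennreal_mult)
    also have "\<dots> = ennreal (exp (V \<omega>)) * (\<integral>\<^sup>+y. ennreal (exp (l * (G \<omega> y - (\<integral>y. G \<omega> y \<partial>\<kappa> \<omega>)))) \<partial>\<kappa> \<omega>)"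
      using Gm by (intro nn_integral_cmult) auto
    \<comment> \<open>The range [-d, d] has width 2d, and (2d)^2 / 8 = d^2 / 2.\<close>
    also have "\<dots> \<le> ennreal (exp (V \<omega>)) * ennreal (exp (l\<^sup>2 * (2*d)\<^sup>2 / 8))"
      using Hoeffdings_lemma_nn_integral[OF l] by (intro mult_left_mono) (auto simp: algebra_simps)
    finally show "(\<integral>\<^sup>+y. ?g (\<omega>, y) \<partial>\<kappa> \<omega>) \<le> ennreal (exp (l\<^sup>2 * d\<^sup>2 / 2)) * ennreal (exp (V \<omega>))"
      by (simp add: power_mult_distrib mult.commute)
  qed
  also have "\<dots> = ennreal (exp (l\<^sup>2 * d\<^sup>2 / 2)) * (\<integral>\<^sup>+\<omega>. ennreal (exp (V \<omega>)) \<partial>M)"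
    by (rule nn_integral_cmult) (rule Ve)
  finally show ?thesis .
qed

text \<open>The last increment is integrated out first; the sum of the earlier ones is known under
  \<open>F n\<close>, because every earlier \<open>Z j\<close> is, and takes the role of
  \<open>V\<close>.\<close>

lemma azuma_mgf:
  fixes F :: "nat \<Rightarrow> 'w measure" and G :: "nat \<Rightarrow> 'w \<Rightarrow> 'e \<Rightarrow> real"
  assumes M: "prob_space M"
    and c: "\<And>k. k < n \<Longrightarrow> cond_law M (F k) S (Z k) (\<kappa> k)"
    and F: "\<And>j k. j \<le> k \<Longrightarrow> k < n \<Longrightarrow> subalgebra (F k) (F j)"
    and G: "\<And>k. k < n \<Longrightarrow> (\<lambda>(\<omega>, y). G k \<omega> y) \<in> borel_measurable (F k \<Otimes>\<^sub>M S)"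
    and bd: "\<And>k \<omega> y. k < n \<Longrightarrow> \<omega> \<in> space M \<Longrightarrow> y \<in> space S \<Longrightarrow> \<bar>G k \<omega> y\<bar> \<le> d"
    and ad: "\<And>j k. j < k \<Longrightarrow> k < n \<Longrightarrow> Z j \<in> F k \<rightarrow>\<^sub>M S"
    and l: "l > 0"
  shows "(\<integral>\<^sup>+\<omega>. ennreal (exp (l * (\<Sum>k<n. G k \<omega> (Z k \<omega>) - (\<integral>y. G k \<omega> y \<partial>\<kappa> k \<omega>)))) \<partial>M)
     \<le> ennreal (exp (l\<^sup>2 * d\<^sup>2 * real n / 2))"
  using c F G bd ad
proof (induction n)
  case 0
  then show ?case using prob_space.emeasure_space_1[OF M] by simp
next
  case (Suc n)
  let ?D = "\<lambda>k \<omega>. G k \<omega> (Z k \<omega>) - (\<integral>y. G k \<omega> y \<partial>\<kappa> k \<omega>)"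
  have cn: "cond_law M (F n) S (Z n) (\<kappa> n)" using Suc.prems(1) by simp
  have D: "?D k \<in> borel_measurable (F n)" if "k < n" for k
  proof -
    note [measurable] = cond_lawD(4)[OF Suc.prems(1)[of k]] Suc.prems(3)[of k] Suc.prems(5)[of k n]
    have "(\<lambda>\<omega>. \<integral>y. G k \<omega> y \<partial>\<kappa> k \<omega>) \<in> borel_measurable (F k)"
      using that by (intro integral_measurable_kernel[where N=S]) auto
    from measurable_from_subalg[OF Suc.prems(2)[of k n] this] that
    have [measurable]: "(\<lambda>\<omega>. \<integral>y. G k \<omega> y \<partial>\<kappa> k \<omega>) \<in> borel_measurable (F n)"
      by simp
    have i: "(\<lambda>\<omega>. \<omega>) \<in> F n \<rightarrow>\<^sub>M F k"
      using Suc.prems(2)[of k n] that by (intro measurable_ident_subalgebra) auto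
    have "(\<lambda>\<omega>. (\<lambda>(\<omega>, y). G k \<omega> y) (\<omega>, Z k \<omega>)) \<in> borel_measurable (F n)"
      by (rule measurable_compose[OF measurable_Pair[OF i] Suc.prems(3)]) (use Suc.prems(5) that in auto)
    then show ?thesis by simp
  qed
  have "(\<integral>\<^sup>+\<omega>. ennreal (exp (l * (\<Sum>k<Suc n. ?D k \<omega>))) \<partial>M)
    = (\<integral>\<^sup>+\<omega>. ennreal (exp (l * (\<Sum>k<n. ?D k \<omega>) + l * ?D n \<omega>)) \<partial>M)"
    by (simp add: algebra_simps)
  also have "\<dots> \<le> ennreal (exp (l\<^sup>2 * d\<^sup>2 / 2)) * (\<integral>\<^sup>+\<omega>. ennreal (exp (l * (\<Sum>k<n. ?D k \<omega>))) \<partial>M)"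
    by (rule cond_law_hoeffding[OF cn]) (use Suc.prems(3,4) D l in auto)
  also have "\<dots> \<le> ennreal (exp (l\<^sup>2 * d\<^sup>2 / 2)) * ennreal (exp (l\<^sup>2 * d\<^sup>2 * real n / 2))"
    using Suc.prems by (intro mult_left_mono Suc.IH) auto
  also have "\<dots> = ennreal (exp (l\<^sup>2 * d\<^sup>2 * real (Suc n) / 2))"
    by (simp add: ennreal_mult[symmetric] exp_add[symmetric] field_simps)
  finally show ?case .
qed

lemma azuma:
  fixes F :: "nat \<Rightarrow> 'w measure" and G :: "nat \<Rightarrow> 'w \<Rightarrow> 'e \<Rightarrow> real"
  assumes M: "prob_space M"
    and c: "\<And>k. k < n \<Longrightarrow> cond_law M (F k) S (Z k) (\<kappa> k)"
    and F: "\<And>j k. j \<le> k \<Longrightarrow> k < n \<Longrightarrow> subalgebra (F k) (F j)"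
    and G: "\<And>k. k < n \<Longrightarrow> (\<lambda>(\<omega>, y). G k \<omega> y) \<in> borel_measurable (F k \<Otimes>\<^sub>M S)"
    and bd: "\<And>k \<omega> y. k < n \<Longrightarrow> \<omega> \<in> space M \<Longrightarrow> y \<in> space S \<Longrightarrow> \<bar>G k \<omega> y\<bar> \<le> d"
    and ad: "\<And>j k. j < k \<Longrightarrow> k < n \<Longrightarrow> Z j \<in> F k \<rightarrow>\<^sub>M S"
    and n: "n > 0" and d: "d > 0" and x: "x > 0"
  shows "\<exists>A\<in>sets M. measure M A \<le> exp (- x\<^sup>2 / (2 * real n * d\<^sup>2)) \<and>
     (\<forall>\<omega>\<in>space M - A. (\<Sum>k<n. G k \<omega> (Z k \<omega>) - (\<integral>y. G k \<omega> y \<partial>\<kappa> k \<omega>)) < x)"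
proof -
  interpret prob_space M by fact
  let ?D = "\<lambda>k \<omega>. G k \<omega> (Z k \<omega>) - (\<integral>y. G k \<omega> y \<partial>\<kappa> k \<omega>)"
  let ?S = "\<lambda>\<omega>. \<Sum>k<n. ?D k \<omega>"
  \<comment> \<open>The minimiser of - l x + l^2 d^2 n / 2 in Chernoff's bound.\<close>
  define l where "l = x / (real n * d\<^sup>2)"
  have l: "l > 0" using n d x by (simp add: l_def)
  have D: "?D k \<in> borel_measurable M" if "k < n" for k
  proof -
    note [measurable] = cond_lawD(2,4)[OF c[OF that]] G[OF that]
    have "(\<lambda>\<omega>. \<integral>y. G k \<omega> y \<partial>\<kappa> k \<omega>) \<in> borel_measurable (F k)"
      by (intro integral_measurable_kernel[where N=S]) auto
    then have [measurable]: "(\<lambda>\<omega>. \<integral>y. G k \<omega> y \<partial>\<kappa> k \<omega>) \<in> borel_measurable M"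
      by (intro measurable_from_subalg[OF cond_lawD(1)[OF c[OF that]]])
    have [measurable]: "(\<lambda>\<omega>. \<omega>) \<in> M \<rightarrow>\<^sub>M F k"
      by (rule measurable_ident_subalgebra[OF cond_lawD(1)[OF c[OF that]]])
    have "(\<lambda>\<omega>. (\<lambda>(\<omega>, y). G k \<omega> y) (\<omega>, Z k \<omega>)) \<in> borel_measurable M"
      by measurable
    then show ?thesis by simp
  qed
  then have Sm[measurable]: "?S \<in> borel_measurable M" by measurable
  let ?A = "{\<omega>\<in>space M. ?S \<omega> \<ge> x}"
  have ind: "(\<integral>\<^sup>+\<omega>. ennreal (exp (l * ?S \<omega>)) * indicator (space M) \<omega> \<partial>M) = (\<integral>\<^sup>+\<omega>. ennreal (exp (l * ?S \<omega>)) \<partial>M)"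
    by (rule nn_integral_cong) simp
  have "emeasure M ?A \<le> emeasure M {\<omega>\<in>space M. 1 \<le> ennreal (exp (-l*x)) * ennreal (exp (l * ?S \<omega>))}"
    using l by (intro emeasure_mono) (auto simp: ennreal_mult[symmetric] exp_add[symmetric])
  also have "\<dots> \<le> ennreal (exp (-l*x)) * (\<integral>\<^sup>+\<omega>. ennreal (exp (l * ?S \<omega>)) * indicator (space M) \<omega> \<partial>M)"
    by (rule nn_integral_Markov_inequality) auto
  also have "\<dots> \<le> ennreal (exp (-l*x)) * ennreal (exp (l\<^sup>2 * d\<^sup>2 * real n / 2))"
    unfolding ind by (intro mult_left_mono azuma_mgf[OF M c F G bd ad l]) auto
  also have "\<dots> = ennreal (exp (-l*x + l\<^sup>2 * d\<^sup>2 * real n / 2))"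
    by (simp add: ennreal_mult[symmetric] exp_add[symmetric])
  also have "-l*x + l\<^sup>2 * d\<^sup>2 * real n / 2 = - x\<^sup>2 / (2 * real n * d\<^sup>2)"
  proof -
    have "l * (real n * d\<^sup>2) = x" using n d by (simp add: l_def)
    then have "l\<^sup>2 * d\<^sup>2 * real n = l * x" by (simp add: power2_eq_square ac_simps)
    moreover have "x\<^sup>2 / (2 * real n * d\<^sup>2) = l * x / 2" by (simp add: l_def power2_eq_square)
    ultimately show ?thesis by simp
  qed
  finally have "measure M ?A \<le> exp (- x\<^sup>2 / (2 * real n * d\<^sup>2))"
    by (simp add: emeasure_eq_measure)
  moreover have "?A \<in> sets M" by measurable
  ultimately show ?thesis by (intro bexI[of _ ?A]) (auto simp: not_le)
qed

section \<open>Markov chains\<close>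

lemma process_map_measurable:
  assumes "\<And>i. i \<in> I \<Longrightarrow> X i \<in> M \<rightarrow>\<^sub>M S"
  shows "(\<lambda>\<omega>. \<lambda>i\<in>I. X i \<omega>) \<in> M \<rightarrow>\<^sub>M (\<Pi>\<^sub>M i\<in>I. S)"
  using assms by (intro measurable_restrict)

lemma subalgebra_process_sigma:
  assumes "\<And>i. i \<in> I \<Longrightarrow> X i \<in> M \<rightarrow>\<^sub>M S"
  shows "subalgebra M (process_sigma M S X I)"
  unfolding process_sigma_def subalgebra_def
  by (intro conjI sets_image_in_sets process_map_measurable assms) simp_all

lemma measurable_process_sigma:
  assumes "\<And>i. i \<in> I \<Longrightarrow> X i \<in> M \<rightarrow>\<^sub>M S" "i \<in> I"
  shows "X i \<in> process_sigma M S X I \<rightarrow>\<^sub>M S"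
proof -
  have m: "(\<lambda>\<omega>. \<lambda>i\<in>I. X i \<omega>) \<in> M \<rightarrow>\<^sub>M (\<Pi>\<^sub>M i\<in>I. S)"
    by (rule process_map_measurable) (rule assms)
  have "(\<lambda>\<omega>. \<lambda>i\<in>I. X i \<omega>) \<in> process_sigma M S X I \<rightarrow>\<^sub>M (\<Pi>\<^sub>M i\<in>I. S)"
    unfolding process_sigma_def
    by (rule measurable_vimage_algebra1, rule Pi_I, rule measurable_space[OF m])
  from measurable_compose[OF this measurable_component_singleton[OF \<open>i \<in> I\<close>]]
  show ?thesis using \<open>i \<in> I\<close> by simp
qed

lemma subalgebra_process_sigma_mono:
  assumes "\<And>i. i \<in> J \<Longrightarrow> X i \<in> M \<rightarrow>\<^sub>M S" "I \<subseteq> J"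
  shows "subalgebra (process_sigma M S X J) (process_sigma M S X I)"
proof -
  have "(\<lambda>\<omega>. \<lambda>i\<in>I. X i \<omega>) \<in> process_sigma M S X J \<rightarrow>\<^sub>M (\<Pi>\<^sub>M i\<in>I. S)"
    using assms by (intro process_map_measurable measurable_process_sigma) auto
  then show ?thesis
    unfolding subalgebra_def process_sigma_def[of M S X I]
    by (intro conjI sets_image_in_sets) (simp_all add: process_sigma_def)
qed

lemma markov_chain_subalgebra:
  "markov_chain M S P X \<Longrightarrow> subalgebra M (process_sigma M S X {1..s})"
  by (rule subalgebra_process_sigma) (auto simp: markov_chain_def)

lemma markov_chain_subalgebra_mono:
  "markov_chain M S P X \<Longrightarrow> s \<le> t \<Longrightarrow>
     subalgebra (process_sigma M S X {1..t}) (process_sigma M S X {1..s})"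
  by (rule subalgebra_process_sigma_mono) (auto simp: markov_chain_def)

lemma markov_chain_measurable:
  "markov_chain M S P X \<Longrightarrow> 1 \<le> i \<Longrightarrow> i \<le> s \<Longrightarrow> X i \<in> process_sigma M S X {1..s} \<rightarrow>\<^sub>M S"
  by (rule measurable_process_sigma) (auto simp: markov_chain_def)

text \<open>The definition of the chain gives, for each target set, an almost sure identity with its
  own null set. One such identity per rectangle is all that \<open>cond_lawI\<close> asks
  for.\<close>

lemma cond_law_step:
  assumes mc: "markov_chain M S P X" and s: "s \<ge> 1"
  shows "cond_law M (process_sigma M S X {1..s}) S (X (Suc s)) (\<lambda>\<omega>. P (X s \<omega>))"
proof (rule cond_lawI)
  let ?F = "process_sigma M S X {1..s}"
  show "prob_space M" and [measurable]: "X (Suc s) \<in> M \<rightarrow>\<^sub>M S" using mc by (auto simp: markov_chain_def)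
  then interpret prob_space M by simp
  show sub: "subalgebra M ?F" by (rule markov_chain_subalgebra[OF mc])
  have P: "P \<in> S \<rightarrow>\<^sub>M prob_algebra S" using mc by (simp add: markov_chain_def)
  show \<kappa>: "(\<lambda>\<omega>. P (X s \<omega>)) \<in> ?F \<rightarrow>\<^sub>M prob_algebra S"
    using markov_chain_measurable[OF mc s order.refl] P by (rule measurable_compose)
  fix A B assume A: "A \<in> sets ?F" and B[measurable]: "B \<in> sets S"
  interpret finite_measure_subalgebra M ?F by unfold_locales (rule sub)
  have AM[measurable]: "A \<in> sets M" using A sub by (auto simp: subalgebra_def)
  let ?B = "X (Suc s) -` B \<inter> space M"
  let ?I = "indicator ?B :: _ \<Rightarrow> real"
  have BM[measurable]: "?B \<in> sets M" by measurable
  have ae: "AE \<omega> in M. real_cond_exp M ?F ?I \<omega> = measure (P (X s \<omega>)) B"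
    using mc s B by (auto simp: markov_chain_def)
  have ps: "prob_space (P (X s \<omega>))" if "\<omega> \<in> space M" for \<omega>
    using measurable_space[OF \<kappa>, of \<omega>] that sub by (auto simp: space_prob_algebra subalgebra_def)
  have mm[measurable]: "(\<lambda>\<omega>. measure (P (X s \<omega>)) B) \<in> borel_measurable M"
    by (rule measurable_from_subalg[OF sub measurable_compose[OF \<kappa> measurable_measure_prob_algebra[OF B]]])
  have "emeasure M (A \<inter> ?B) = ennreal (\<integral>\<omega>. indicator A \<omega> * ?I \<omega> \<partial>M)"
    by (simp add: emeasure_eq_measure indicator_inter_arith[symmetric])
  also have "(\<integral>\<omega>. indicator A \<omega> * ?I \<omega> \<partial>M) = (\<integral>\<omega>. indicator A \<omega> * real_cond_exp M ?F ?I \<omega> \<partial>M)"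
  proof (rule real_cond_exp_intg(2)[symmetric])
    show "integrable M (\<lambda>\<omega>. indicator A \<omega> * ?I \<omega>)"
      by (rule integrable_const_bound[where B=1]) (auto simp: indicator_def)
  qed (use A in auto)
  also have "\<dots> = (\<integral>\<omega>. indicator A \<omega> * measure (P (X s \<omega>)) B \<partial>M)"
  proof (rule integral_cong_AE)
    show "(\<lambda>\<omega>. indicator A \<omega> * real_cond_exp M ?F ?I \<omega>) \<in> borel_measurable M"
      by (intro borel_measurable_times borel_measurable_cond_exp2) simp
    show "(\<lambda>\<omega>. indicator A \<omega> * measure (P (X s \<omega>)) B) \<in> borel_measurable M"
      by measurable
  qed (use ae in auto)
  also have "ennreal \<dots> = (\<integral>\<^sup>+\<omega>. ennreal (indicator A \<omega> * measure (P (X s \<omega>)) B) \<partial>M)"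
    by (subst nn_integral_eq_integral)
       (auto intro!: integrable_const_bound[where B=1] AE_I2 simp: indicator_def ps prob_space.prob_le_1)
  also have "\<dots> = (\<integral>\<^sup>+\<omega>\<in>A. emeasure (P (X s \<omega>)) B \<partial>M)"
    by (rule nn_integral_cong)
       (auto simp: indicator_def finite_measure.emeasure_eq_measure[OF prob_space.finite_measure[OF ps]])
  finally show "emeasure M (A \<inter> ?B) = (\<integral>\<^sup>+\<omega>\<in>A. emeasure (P (X s \<omega>)) B \<partial>M)" .
qed

text \<open>Tower property: \<open>Z'\<close> is integrated out under the finer \<open>F'\<close>,
  where its law depends only on \<open>Z\<close>, and then \<open>Z\<close> under
  \<open>F\<close>.\<close>

lemma cond_law_compose:
  assumes c: "cond_law M F S Z \<kappa>" and c': "cond_law M F' S Z' (\<lambda>\<omega>. \<kappa>' (Z \<omega>))"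
    and sub: "subalgebra F' F" and \<kappa>': "\<kappa>' \<in> S \<rightarrow>\<^sub>M prob_algebra S"
  shows "cond_law M F S Z' (\<lambda>\<omega>. \<kappa> \<omega> \<bind> \<kappa>')"
  unfolding cond_law_def
proof (intro conjI ballI)
  show "subalgebra M F" "Z' \<in> M \<rightarrow>\<^sub>M S" using c c' by (auto simp: cond_law_def)
  show "(\<lambda>\<omega>. \<kappa> \<omega> \<bind> \<kappa>') \<in> F \<rightarrow>\<^sub>M prob_algebra S"
    using cond_lawD(3)[OF c] \<kappa>' by (rule measurable_bind_prob_space)
  fix g :: "'a \<times> 'b \<Rightarrow> ennreal" assume g[measurable]: "g \<in> borel_measurable (F \<Otimes>\<^sub>M S)"
  note [measurable] = measurable_prob_algebraD[OF \<kappa>'] measurable_ident_subalgebra[OF sub]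
  have g': "g \<in> borel_measurable (F' \<Otimes>\<^sub>M S)"
    using measurable_compose[OF measurable_Pair[OF measurable_compose[OF measurable_fst
      measurable_ident_subalgebra[OF sub]] measurable_snd] g] by simp
  have G: "(\<lambda>(\<omega>, y). \<integral>\<^sup>+z. g (\<omega>, z) \<partial>\<kappa>' y) \<in> borel_measurable (F \<Otimes>\<^sub>M S)"
    unfolding split_beta'
    by (rule nn_integral_measurable_subprob_algebra2[where N=S]) auto
  have "(\<integral>\<^sup>+\<omega>. g (\<omega>, Z' \<omega>) \<partial>M) = (\<integral>\<^sup>+\<omega>. \<integral>\<^sup>+z. g (\<omega>, z) \<partial>\<kappa>' (Z \<omega>) \<partial>M)"
    by (rule cond_law_nn_integral[OF c' g'])
  also have "\<dots> = (\<integral>\<^sup>+\<omega>. \<integral>\<^sup>+y. \<integral>\<^sup>+z. g (\<omega>, z) \<partial>\<kappa>' y \<partial>\<kappa> \<omega> \<partial>M)"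
    using cond_law_nn_integral[OF c G] by simp
  also have "\<dots> = (\<integral>\<^sup>+\<omega>. \<integral>\<^sup>+z. g (\<omega>, z) \<partial>(\<kappa> \<omega> \<bind> \<kappa>') \<partial>M)"
  proof (rule nn_integral_cong)
    fix \<omega> assume w: "\<omega> \<in> space M"
    have se: "sets (\<kappa> \<omega>) = sets S"
      using sets_kernel[OF cond_lawD(4)[OF c]] w cond_lawD(5)[OF c] by simp
    show "(\<integral>\<^sup>+y. \<integral>\<^sup>+z. g (\<omega>, z) \<partial>\<kappa>' y \<partial>\<kappa> \<omega>) = (\<integral>\<^sup>+z. g (\<omega>, z) \<partial>(\<kappa> \<omega> \<bind> \<kappa>'))"
      by (rule nn_integral_bind[where B=S, symmetric])
         (use w cond_lawD(5)[OF c] in \<open>auto simp: measurable_cong_sets[OF se refl]\<close>)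
  qed
  finally show "(\<integral>\<^sup>+\<omega>. g (\<omega>, Z' \<omega>) \<partial>M) = (\<integral>\<^sup>+\<omega>. \<integral>\<^sup>+z. g (\<omega>, z) \<partial>(\<kappa> \<omega> \<bind> \<kappa>') \<partial>M)" .
qed

lemma cond_law_return:
  assumes sub: "subalgebra M F" and Z: "Z \<in> F \<rightarrow>\<^sub>M S"
  shows "cond_law M F S Z (\<lambda>\<omega>. return S (Z \<omega>))"
  unfolding cond_law_def
proof (intro conjI ballI sub)
  have sp: "space F = space M" using sub by (simp add: subalgebra_def)
  show "Z \<in> M \<rightarrow>\<^sub>M S" by (rule measurable_from_subalg[OF sub Z])
  show "(\<lambda>\<omega>. return S (Z \<omega>)) \<in> F \<rightarrow>\<^sub>M prob_algebra S" using Z by measurable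
  fix g :: "'a \<times> 'b \<Rightarrow> ennreal" assume [measurable]: "g \<in> borel_measurable (F \<Otimes>\<^sub>M S)"
  show "(\<integral>\<^sup>+\<omega>. g (\<omega>, Z \<omega>) \<partial>M) = (\<integral>\<^sup>+\<omega>. \<integral>\<^sup>+y. g (\<omega>, y) \<partial>return S (Z \<omega>) \<partial>M)"
    using measurable_space[OF Z] sp
    by (intro nn_integral_cong nn_integral_return[symmetric]) auto
qed

lemma measurable_kernel_pow:
  assumes P: "P \<in> S \<rightarrow>\<^sub>M prob_algebra S"
  shows "kernel_pow S P n \<in> S \<rightarrow>\<^sub>M prob_algebra S"
  by (induction n) (auto intro!: measurable_bind_prob_space P)

text \<open>\<open>kernel_pow\<close> unfolds at its first step, so the base time is generalised in
  the induction: one step from s, then j steps from s + 1.\<close>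

lemma cond_law_chain:
  assumes mc: "markov_chain M S P X" and s: "s \<ge> 1"
  shows "cond_law M (process_sigma M S X {1..s}) S (X (s + j)) (\<lambda>\<omega>. kernel_pow S P j (X s \<omega>))"
  using s
proof (induction j arbitrary: s)
  case 0
  then show ?case
    using cond_law_return[OF markov_chain_subalgebra[OF mc] markov_chain_measurable[OF mc 0 order.refl]] by simp
next
  case (Suc j)
  have P: "P \<in> S \<rightarrow>\<^sub>M prob_algebra S" using mc by (simp add: markov_chain_def)
  from cond_law_compose[OF cond_law_step[OF mc Suc.prems] Suc.IH[of "Suc s"]
      markov_chain_subalgebra_mono[OF mc] measurable_kernel_pow[OF P]]
  show ?case by simp
qed

section \<open>Uniformly ergodic kernels\<close>

lemma prob_integral_bounds:
  fixes g :: "'a \<Rightarrow> real"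
  assumes N: "prob_space N" and g: "g \<in> borel_measurable N"
    and b: "\<And>y. y \<in> space N \<Longrightarrow> a \<le> g y \<and> g y \<le> b"
  shows "integrable N g" "a \<le> (\<integral>y. g y \<partial>N)" "(\<integral>y. g y \<partial>N) \<le> b"
proof -
  interpret prob_space N by fact
  show i: "integrable N g"
    using g by (rule integrable_const_bound[where B="max \<bar>a\<bar> \<bar>b\<bar>", rotated]) (use b in \<open>fastforce intro!: AE_I2\<close>)
  show "a \<le> (\<integral>y. g y \<partial>N)" using integral_ge_const[OF i] b by auto
  show "(\<integral>y. g y \<partial>N) \<le> b" using integral_le_const[OF i] b by auto
qed

locale markov_kernel =
  fixes S :: "'e measure" and P :: "'e \<Rightarrow> 'e measure"
  assumes P: "P \<in> S \<rightarrow>\<^sub>M prob_algebra S"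
begin

text \<open>In operator notation, P^n g.\<close>

definition Q :: "nat \<Rightarrow> ('e \<Rightarrow> real) \<Rightarrow> 'e \<Rightarrow> real" where
  "Q n g x = (\<integral>y. g y \<partial>kernel_pow S P n x)"

lemma kernel_pow_prob:
  assumes "x \<in> space S"
  shows "prob_space (kernel_pow S P n x)" "sets (kernel_pow S P n x) = sets S"
    "space (kernel_pow S P n x) = space S"
proof -
  show "prob_space (kernel_pow S P n x)" and s: "sets (kernel_pow S P n x) = sets S"
    using measurable_space[OF measurable_kernel_pow[OF P] assms] by (auto simp: space_prob_algebra)
  show "space (kernel_pow S P n x) = space S" using s by (rule sets_eq_imp_space_eq)
qed

lemma kernel_pow_subprob: "kernel_pow S P n \<in> S \<rightarrow>\<^sub>M subprob_algebra S"
  by (rule measurable_prob_algebraD[OF measurable_kernel_pow[OF P]])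

lemma kernel_pow_measurable_iff:
  "x \<in> space S \<Longrightarrow> g \<in> kernel_pow S P n x \<rightarrow>\<^sub>M L \<longleftrightarrow> g \<in> S \<rightarrow>\<^sub>M L"
  by (rule arg_cong[where f="\<lambda>A. g \<in> A"], rule measurable_cong_sets) (simp_all add: kernel_pow_prob)

lemma kernel_pow_add:
  assumes x: "x \<in> space S"
  shows "kernel_pow S P (n + k) x = kernel_pow S P n x \<bind> kernel_pow S P k"
  using x
proof (induction n arbitrary: x)
  case 0
  then show ?case by (simp add: bind_return[OF kernel_pow_subprob])
next
  case (Suc n)
  have m: "P x \<in> space (prob_algebra S)" using measurable_space[OF P Suc.prems] .
  then have se: "sets (P x) = sets S" by (simp add: space_prob_algebra)
  then have sp: "space (P x) = space S" by (rule sets_eq_imp_space_eq)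
  have "kernel_pow S P (Suc n + k) x = P x \<bind> (\<lambda>y. kernel_pow S P n y \<bind> kernel_pow S P k)"
    using Suc.IH sp by (auto intro!: bind_cong)
  also have "\<dots> = (P x \<bind> kernel_pow S P n) \<bind> kernel_pow S P k"
    by (rule bind_assoc[where N=S and R=S, symmetric])
       (use kernel_pow_subprob in \<open>auto simp: measurable_cong_sets[OF se refl]\<close>)
  finally show ?case by simp
qed

lemma Q_measurable:
  assumes "g \<in> borel_measurable S"
  shows "Q n g \<in> borel_measurable S"
  unfolding Q_def
  using measurable_compose[OF kernel_pow_subprob integral_measurable_subprob_algebra[OF assms]] .

lemma Q_measurable_param:
  assumes [measurable]: "(\<lambda>(w, y). g w y) \<in> borel_measurable (F \<Otimes>\<^sub>M S)"
  shows "(\<lambda>(w, y). Q n (g w) y) \<in> borel_measurable (F \<Otimes>\<^sub>M S)"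
proof -
  note [measurable] = kernel_pow_subprob[of n]
  show ?thesis
    unfolding split_beta' Q_def by (rule integral_measurable_kernel[where N=S]) auto
qed

lemma Q_bounds:
  assumes x: "x \<in> space S" and g: "g \<in> borel_measurable S"
    and b: "\<And>y. y \<in> space S \<Longrightarrow> a \<le> g y \<and> g y \<le> b"
  shows "a \<le> Q n g x" "Q n g x \<le> b" "integrable (kernel_pow S P n x) g"
  using prob_integral_bounds[OF kernel_pow_prob(1)[OF x, of n], where g=g and a=a and b=b] g b kernel_pow_prob(3)[OF x]
  unfolding Q_def by (auto simp: kernel_pow_measurable_iff[OF x])

lemma Q_0: "x \<in> space S \<Longrightarrow> g \<in> borel_measurable S \<Longrightarrow> Q 0 g x = g x"
  by (simp add: Q_def integral_return)

lemma Q_add: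
  assumes x: "x \<in> space S" and g: "g \<in> borel_measurable S"
    and b: "\<And>y. y \<in> space S \<Longrightarrow> \<bar>g y\<bar> \<le> B"
  shows "Q (n + k) g x = Q n (Q k g) x"
proof -
  interpret prob_space "kernel_pow S P n x" by (rule kernel_pow_prob(1)[OF x])
  have "emeasure (kernel_pow S P k y) (space (kernel_pow S P k y)) \<le> ennreal 1" if "y \<in> space S" for y
    using prob_space.emeasure_space_1[OF kernel_pow_prob(1)[OF that]] by simp
  then have ae: "AE y in kernel_pow S P n x. emeasure (kernel_pow S P k y) (space (kernel_pow S P k y)) \<le> ennreal 1"
    using kernel_pow_prob(3)[OF x] by (intro AE_I2) simp
  have "Q (n + k) g x = (\<integral>y. g y \<partial>(kernel_pow S P n x \<bind> kernel_pow S P k))"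
    unfolding Q_def kernel_pow_add[OF x] ..
  also have "\<dots> = (\<integral>y. Q k g y \<partial>kernel_pow S P n x)"
    unfolding Q_def
    by (rule integral_bind[OF g b _ _ ae])
       (use kernel_pow_subprob[of k] finite_measure_axioms in \<open>auto simp: kernel_pow_measurable_iff[OF x]\<close>)
  finally show ?thesis unfolding Q_def[of n] .
qed

end

locale doeblin_kernel = markov_kernel S P
  for S :: "'e measure" and P :: "'e \<Rightarrow> 'e measure" +
  fixes \<pi> \<mu> :: "'e measure" and m :: nat and \<delta> :: real
  assumes stationary: "stationary S P \<pi>"
    and m_pos: "m \<ge> 1" and \<delta>_pos: "\<delta> > 0"
    and mu: "prob_space \<mu>" "sets \<mu> = sets S"
    and minorization: "\<And>x A. x \<in> space S \<Longrightarrow> A \<in> sets S \<Longrightarrow>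
      \<delta> * measure \<mu> A \<le> measure (kernel_pow S P m x) A"
begin

text \<open>The contraction factor after n steps: the minorization concerns m steps at once, so only
  complete blocks count. In contrast to \<rho>^n, it is valid from every starting point.\<close>

definition \<theta> :: "nat \<Rightarrow> real" where
  "\<theta> n = (1 - \<delta>) ^ (n div m)"

lemma pi_prob: "prob_space \<pi>" and sets_pi: "sets \<pi> = sets S" and bind_pi: "\<pi> \<bind> P = \<pi>"
  using stationary by (auto simp: stationary_def)

lemma space_pi: "space \<pi> = space S"
  using sets_pi by (rule sets_eq_imp_space_eq)

lemma pi_measurable_iff: "g \<in> \<pi> \<rightarrow>\<^sub>M L \<longleftrightarrow> g \<in> S \<rightarrow>\<^sub>M L"
  by (rule arg_cong[where f="\<lambda>A. g \<in> A"], rule measurable_cong_sets) (simp_all add: sets_pi)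

lemma pi_bounds:
  fixes g :: "'e \<Rightarrow> real"
  assumes "g \<in> borel_measurable S" "\<And>y. y \<in> space S \<Longrightarrow> a \<le> g y \<and> g y \<le> b"
  shows "integrable \<pi> g" "a \<le> (\<integral>y. g y \<partial>\<pi>)" "(\<integral>y. g y \<partial>\<pi>) \<le> b"
  using prob_integral_bounds[OF pi_prob, of g a b] assms by (auto simp: pi_measurable_iff space_pi)

lemma space_nonempty: "space S \<noteq> {}"
  using prob_space.not_empty[OF pi_prob] space_pi by simp

lemma delta_le_1: "\<delta> \<le> 1"
proof -
  obtain x where x: "x \<in> space S" using space_nonempty by auto
  have "measure \<mu> (space S) = 1"
    using prob_space.prob_space[OF mu(1)] sets_eq_imp_space_eq[OF mu(2)] by simp
  with minorization[OF x sets.top] prob_space.prob_le_1[OF kernel_pow_prob(1)[OF x, of m], of "space S"]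
  show ?thesis by simp
qed

text \<open>On sets, the minorization orders the measure \<delta>\<mu> below P^m(x, .); integrals of
  nonnegative functions inherit the order.\<close>

lemma minorization_integral:
  fixes g :: "'e \<Rightarrow> real"
  assumes x: "x \<in> space S" and g: "g \<in> borel_measurable S"
    and b: "\<And>y. y \<in> space S \<Longrightarrow> 0 \<le> g y \<and> g y \<le> b"
  shows "\<delta> * (\<integral>y. g y \<partial>\<mu>) \<le> Q m g x"
proof -
  note kp = kernel_pow_prob[OF x, of m]
  interpret K: prob_space "kernel_pow S P m x" by (rule kp(1))
  interpret U: prob_space \<mu> by (rule mu(1))
  have spm: "space \<mu> = space S" using mu(2) by (rule sets_eq_imp_space_eq)
  have gm: "g \<in> borel_measurable \<mu>" using g by (simp add: measurable_cong_sets[OF mu(2) refl])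
  have i1: "integrable \<mu> g" using prob_integral_bounds(1)[OF mu(1) gm, of 0 b] b spm by simp
  have i2: "integrable (kernel_pow S P m x) g" using Q_bounds(3)[OF x g, of 0 b] b by blast
  have "scale_measure (ennreal \<delta>) \<mu> \<le> kernel_pow S P m x"
  proof (subst le_measure)
    show "sets (scale_measure (ennreal \<delta>) \<mu>) = sets (kernel_pow S P m x)" using mu(2) kp(2) by simp
    show "\<forall>A\<in>sets (scale_measure (ennreal \<delta>) \<mu>).
        emeasure (scale_measure (ennreal \<delta>) \<mu>) A \<le> emeasure (kernel_pow S P m x) A"
      using minorization[OF x] \<delta>_pos mu(2)
      by (auto simp: K.emeasure_eq_measure U.emeasure_eq_measure ennreal_mult'[symmetric])
  qed
  from nn_integral_mono_measure[OF _ this, of "\<lambda>y. ennreal (g y)"]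
  have "ennreal \<delta> * (\<integral>\<^sup>+y. ennreal (g y) \<partial>\<mu>) \<le> (\<integral>\<^sup>+y. ennreal (g y) \<partial>kernel_pow S P m x)"
    using mu(2) kp(2) gm by (simp add: nn_integral_scale_measure)
  also have "(\<integral>\<^sup>+y. ennreal (g y) \<partial>\<mu>) = ennreal (\<integral>y. g y \<partial>\<mu>)"
    by (rule nn_integral_eq_integral[OF i1]) (use b spm in \<open>auto intro!: AE_I2\<close>)
  also have "(\<integral>\<^sup>+y. ennreal (g y) \<partial>kernel_pow S P m x) = ennreal (Q m g x)"
    unfolding Q_def by (rule nn_integral_eq_integral[OF i2]) (use b kp(3) in \<open>auto intro!: AE_I2\<close>)
  finally have "ennreal (\<delta> * (\<integral>y. g y \<partial>\<mu>)) \<le> ennreal (Q m g x)"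
    using \<delta>_pos by (simp add: ennreal_mult')
  moreover have "0 \<le> Q m g x" using Q_bounds(1)[OF x g, of 0 b] b by blast
  ultimately show ?thesis by (simp add: ennreal_le_iff)
qed

text \<open>The measure P^m(x, .) - \<delta>\<mu> is nonnegative with mass 1 - \<delta>, so it
  integrates g to a value between (1 - \<delta>) a and (1 - \<delta>) b. This is obtained from the
  minorization for the nonnegative functions g - a and b - g.\<close>

lemma contraction:
  fixes g :: "'e \<Rightarrow> real"
  assumes x: "x \<in> space S" and g: "g \<in> borel_measurable S"
    and b: "\<And>y. y \<in> space S \<Longrightarrow> a \<le> g y \<and> g y \<le> b"
  shows "(1 - \<delta>) * a + \<delta> * (\<integral>y. g y \<partial>\<mu>) \<le> Q m g x"
    "Q m g x \<le> (1 - \<delta>) * b + \<delta> * (\<integral>y. g y \<partial>\<mu>)"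
proof -
  interpret K: prob_space "kernel_pow S P m x" by (rule kernel_pow_prob[OF x])
  interpret U: prob_space \<mu> by (rule mu(1))
  have spm: "space \<mu> = space S" using mu(2) by (rule sets_eq_imp_space_eq)
  have gm: "g \<in> borel_measurable \<mu>" using g by (simp add: measurable_cong_sets[OF mu(2) refl])
  have i1: "integrable \<mu> g" using prob_integral_bounds(1)[OF mu(1) gm, of a b] b spm by simp
  have i2: "integrable (kernel_pow S P m x) g" using Q_bounds(3)[OF x g, of a b] b by blast
  have "\<delta> * (\<integral>y. g y - a \<partial>\<mu>) \<le> Q m (\<lambda>y. g y - a) x"
    by (rule minorization_integral[OF x, where b="b - a"]) (use g b in auto)
  also have "(\<integral>y. g y - a \<partial>\<mu>) = (\<integral>y. g y \<partial>\<mu>) - a" using i1 U.prob_space by simp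
  also have "Q m (\<lambda>y. g y - a) x = Q m g x - a" unfolding Q_def using i2 K.prob_space by simp
  finally show "(1 - \<delta>) * a + \<delta> * (\<integral>y. g y \<partial>\<mu>) \<le> Q m g x" by (simp add: algebra_simps)
  have "\<delta> * (\<integral>y. b - g y \<partial>\<mu>) \<le> Q m (\<lambda>y. b - g y) x"
    by (rule minorization_integral[OF x, where b="b - a"]) (use g b in auto)
  also have "(\<integral>y. b - g y \<partial>\<mu>) = b - (\<integral>y. g y \<partial>\<mu>)" using i1 U.prob_space by simp
  also have "Q m (\<lambda>y. b - g y) x = b - Q m g x" unfolding Q_def using i2 K.prob_space by simp
  finally show "Q m g x \<le> (1 - \<delta>) * b + \<delta> * (\<integral>y. g y \<partial>\<mu>)" by (simp add: algebra_simps)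
qed

text \<open>The enclosing interval is common to all starting points, and each further block of m
  steps shrinks it by the factor 1 - \<delta>. The r leftover steps sit in the base case, where
  averaging merely preserves the range.\<close>

lemma Q_range:
  fixes g :: "'e \<Rightarrow> real"
  assumes g: "g \<in> borel_measurable S"
    and b: "\<And>y. y \<in> space S \<Longrightarrow> a \<le> g y \<and> g y \<le> b"
  shows "\<exists>a' b'. a \<le> a' \<and> b' \<le> b \<and> b' - a' = (1 - \<delta>) ^ k * (b - a) \<and>
    (\<forall>y\<in>space S. a' \<le> Q (k * m + r) g y \<and> Q (k * m + r) g y \<le> b')"
proof (induction k)
  case 0
  then show ?case using Q_bounds(1,2)[OF _ g, of _ a b] b by (intro exI[of _ a] exI[of _ b]) auto
next
  case (Suc k)
  then obtain a' b' where a: "a \<le> a'" "b' \<le> b" and d: "b' - a' = (1 - \<delta>) ^ k * (b - a)"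
    and h: "\<And>y. y\<in>space S \<Longrightarrow> a' \<le> Q (k * m + r) g y \<and> Q (k * m + r) g y \<le> b'" by blast
  let ?h = "Q (k * m + r) g"
  let ?I = "\<integral>y. ?h y \<partial>\<mu>"
  have hm: "?h \<in> borel_measurable S" by (rule Q_measurable[OF g])
  have hmu: "?h \<in> borel_measurable \<mu>" using hm by (simp add: measurable_cong_sets[OF mu(2) refl])
  have I: "a' \<le> ?I" "?I \<le> b'"
    using prob_integral_bounds(2,3)[OF mu(1) hmu, of a' b'] h sets_eq_imp_space_eq[OF mu(2)] by auto
  have B: "\<bar>g y\<bar> \<le> max \<bar>a\<bar> \<bar>b\<bar>" if "y \<in> space S" for y using b[OF that] by linarith
  have eq: "Q (Suc k * m + r) g y = Q m ?h y" if "y \<in> space S" for y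
    using Q_add[OF that g B, of m "k * m + r"] by (simp add: add.assoc)
  show ?case
  proof (rule exI[of _ "(1 - \<delta>) * a' + \<delta> * ?I"], rule exI[of _ "(1 - \<delta>) * b' + \<delta> * ?I"], intro conjI ballI)
    have "\<delta> * a' \<le> \<delta> * ?I" "\<delta> * ?I \<le> \<delta> * b'" using I \<delta>_pos by (auto intro: mult_left_mono)
    then show "a \<le> (1 - \<delta>) * a' + \<delta> * ?I" "(1 - \<delta>) * b' + \<delta> * ?I \<le> b"
      using a by (auto simp: algebra_simps)
    show "(1 - \<delta>) * b' + \<delta> * ?I - ((1 - \<delta>) * a' + \<delta> * ?I) = (1 - \<delta>) ^ Suc k * (b - a)"
    proof -
      have "(1 - \<delta>) * b' + \<delta> * ?I - ((1 - \<delta>) * a' + \<delta> * ?I) = (1 - \<delta>) * (b' - a')"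
        by (simp add: algebra_simps)
      then show ?thesis by (simp add: d)
    qed
    fix y assume y: "y \<in> space S"
    show "(1 - \<delta>) * a' + \<delta> * ?I \<le> Q (Suc k * m + r) g y" "Q (Suc k * m + r) g y \<le> (1 - \<delta>) * b' + \<delta> * ?I"
      unfolding eq[OF y] using contraction[OF y hm h] by auto
  qed
qed

lemma bind_pi_kernel_pow: "\<pi> \<bind> kernel_pow S P n = \<pi>"
proof (induction n)
  case 0
  then show ?case using sets_pi by (simp add: bind_return'')
next
  case (Suc n)
  have "\<pi> \<bind> kernel_pow S P (Suc n) = (\<pi> \<bind> P) \<bind> kernel_pow S P n"
    using kernel_pow_subprob measurable_prob_algebraD[OF P]
    by (subst bind_assoc[where N=S and R=S]) (auto simp: pi_measurable_iff)
  then show ?case using Suc bind_pi by simp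
qed

lemma pi_Q:
  fixes g :: "'e \<Rightarrow> real"
  assumes g: "g \<in> borel_measurable S" and b: "\<And>y. y \<in> space S \<Longrightarrow> \<bar>g y\<bar> \<le> B"
  shows "(\<integral>y. Q n g y \<partial>\<pi>) = (\<integral>y. g y \<partial>\<pi>)"
proof -
  interpret prob_space \<pi> by (rule pi_prob)
  have "emeasure (kernel_pow S P n y) (space (kernel_pow S P n y)) \<le> ennreal 1" if "y \<in> space S" for y
    using prob_space.emeasure_space_1[OF kernel_pow_prob(1)[OF that]] by simp
  then have ae: "AE y in \<pi>. emeasure (kernel_pow S P n y) (space (kernel_pow S P n y)) \<le> ennreal 1"
    using space_pi by (intro AE_I2) simp
  have "(\<integral>y. g y \<partial>(\<pi> \<bind> kernel_pow S P n)) = (\<integral>y. Q n g y \<partial>\<pi>)"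
    unfolding Q_def
    by (rule integral_bind[OF g b _ _ ae])
       (use kernel_pow_subprob[of n] finite_measure_axioms in \<open>auto simp: pi_measurable_iff\<close>)
  then show ?thesis by (simp add: bind_pi_kernel_pow)
qed

text \<open>By stationarity \<pi> g is the \<pi>-mean of P^n g, hence it lies in the same short
  interval as all values of P^n g.\<close>

lemma Q_converges:
  fixes g :: "'e \<Rightarrow> real"
  assumes x: "x \<in> space S" and g: "g \<in> borel_measurable S"
    and b: "\<And>y. y \<in> space S \<Longrightarrow> a \<le> g y \<and> g y \<le> b"
  shows "\<bar>Q n g x - (\<integral>y. g y \<partial>\<pi>)\<bar> \<le> (b - a) * \<theta> n"
proof -
  from Q_range[OF g b, of "n div m" "n mod m"] obtain a' b'
    where d: "b' - a' = (1 - \<delta>) ^ (n div m) * (b - a)"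
    and h: "\<And>y. y\<in>space S \<Longrightarrow> a' \<le> Q n g y \<and> Q n g y \<le> b'" by auto
  have B: "\<bar>g y\<bar> \<le> max \<bar>a\<bar> \<bar>b\<bar>" if "y \<in> space S" for y using b[OF that] by linarith
  have "a' \<le> (\<integral>y. g y \<partial>\<pi>)" "(\<integral>y. g y \<partial>\<pi>) \<le> b'"
    using pi_bounds(2,3)[OF Q_measurable[OF g] h] pi_Q[OF g B] by auto
  then have "\<bar>Q n g x - (\<integral>y. g y \<partial>\<pi>)\<bar> \<le> b' - a'" using h[OF x] by linarith
  then show ?thesis using d by (simp add: \<theta>_def mult.commute)
qed

lemma theta_nonneg: "0 \<le> \<theta> n"
  using delta_le_1 by (simp add: \<theta>_def)

lemma theta_antimono: "j \<le> k \<Longrightarrow> \<theta> k \<le> \<theta> j"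
  using delta_le_1 \<delta>_pos m_pos by (auto simp: \<theta>_def intro!: power_decreasing div_le_mono)

text \<open>\<open>\<theta>\<close> is constant on blocks of length m, which leaves m times a
  geometric series. The bound is free of J, and so is the resulting bound on truncated Poisson
  solutions.\<close>

lemma sum_theta_le: "(\<Sum>j<J. \<theta> j) \<le> real m / \<delta>"
proof -
  have "(\<Sum>j<J. \<theta> j) \<le> (\<Sum>j<J * m. \<theta> j)"
    using m_pos theta_nonneg by (intro sum_mono2) auto
  also have "\<dots> = (\<Sum>k<J. \<Sum>j\<in>{k * m..<k * m + m}. \<theta> j)"
    by (simp add: sum.nat_group)
  also have "\<dots> = (\<Sum>k<J. real m * (1 - \<delta>) ^ k)"
  proof (intro sum.cong refl)
    fix k
    have "\<theta> j = (1 - \<delta>) ^ k" if "j \<in> {k * m..<k * m + m}" for j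
      unfolding \<theta>_def using that m_pos
      by (intro arg_cong[where f="\<lambda>e. (1 - \<delta>) ^ e"] div_nat_eqI) (auto simp: mult.commute)
    then show "(\<Sum>j\<in>{k * m..<k * m + m}. \<theta> j) = real m * (1 - \<delta>) ^ k" by simp
  qed
  also have "\<dots> = real m * (1 - (1 - \<delta>) ^ J) / \<delta>"
    using \<delta>_pos by (simp add: sum_distrib_left[symmetric] sum_gp_strict)
  also have "\<dots> \<le> real m * 1 / \<delta>"
    using \<delta>_pos delta_le_1 by (intro divide_right_mono mult_left_mono) auto
  finally show ?thesis by simp
qed

text \<open>If the Poisson equation is truncated at the number J of summands, each summand has an
  error of order \<open>\<theta> J\<close>; this estimate keeps the total bounded. It holds because
  \<open>\<theta>\<close> is decreasing and summable.\<close>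

lemma theta_le: "real J * \<theta> J \<le> real m / \<delta>"
proof -
  have "real J * \<theta> J = (\<Sum>j<J. \<theta> J)" by simp
  also have "\<dots> \<le> (\<Sum>j<J. \<theta> j)" by (intro sum_mono theta_antimono) auto
  finally show ?thesis using sum_theta_le[of J] by linarith
qed

text \<open>Truncated solution of the Poisson equation \<open>u - P u = g - \<pi> g\<close>, with error \<open>P\<^sup>J g - \<pi> g\<close>.\<close>

definition poisson :: "nat \<Rightarrow> ('e \<Rightarrow> real) \<Rightarrow> 'e \<Rightarrow> real" where
  "poisson J g x = (\<Sum>j<J. Q j g x - (\<integral>y. g y \<partial>\<pi>))"

text \<open>Bound on the Poisson solution of a function with values in [-1, 1]: the oscillation 2
  times the bound on the sum of \<open>\<theta>\<close>.\<close>

definition K :: real where "K = 2 * real m / \<delta>"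

lemma K_pos: "K > 0"
  using m_pos \<delta>_pos by (simp add: K_def)

lemma integral_pi_measurable_param:
  fixes g :: "'w \<Rightarrow> 'e \<Rightarrow> real"
  assumes g: "(\<lambda>(w, y). g w y) \<in> borel_measurable (F \<Otimes>\<^sub>M S)"
  shows "(\<lambda>w. \<integral>y. g w y \<partial>\<pi>) \<in> borel_measurable F"
proof -
  interpret prob_space \<pi> by (rule pi_prob)
  have "sets (F \<Otimes>\<^sub>M \<pi>) = sets (F \<Otimes>\<^sub>M S)" by (rule sets_pair_measure_cong[OF refl sets_pi])
  then have "(\<lambda>(w, y). g w y) \<in> borel_measurable (F \<Otimes>\<^sub>M \<pi>)"
    by (subst measurable_cong_sets[OF _ refl]) (use g in auto)
  from borel_measurable_lebesgue_integral[OF this] show ?thesis .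
qed

lemma poisson_measurable_param:
  fixes g :: "'w \<Rightarrow> 'e \<Rightarrow> real"
  assumes g: "(\<lambda>(w, y). g w y) \<in> borel_measurable (F \<Otimes>\<^sub>M S)"
  shows "(\<lambda>(w, y). poisson J (g w) y) \<in> borel_measurable (F \<Otimes>\<^sub>M S)"
proof -
  note [measurable] = Q_measurable_param[OF g] integral_pi_measurable_param[OF g]
  show ?thesis unfolding poisson_def by measurable
qed

context
  fixes g :: "'e \<Rightarrow> real"
  assumes g: "g \<in> borel_measurable S" and b: "\<And>y. y \<in> space S \<Longrightarrow> \<bar>g y\<bar> \<le> 1"
begin

lemma Q_converges_1: "x \<in> space S \<Longrightarrow> \<bar>Q n g x - (\<integral>y. g y \<partial>\<pi>)\<bar> \<le> 2 * \<theta> n"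
  using Q_converges[OF _ g, of x "-1" 1 n] b by (auto simp: abs_le_iff minus_le_iff)

lemma poisson_measurable: "poisson J g \<in> borel_measurable S"
  unfolding poisson_def using Q_measurable[OF g] by measurable

lemma abs_poisson_le:
  assumes x: "x \<in> space S"
  shows "\<bar>poisson J g x\<bar> \<le> K"
proof -
  have "\<bar>poisson J g x\<bar> \<le> (\<Sum>j<J. \<bar>Q j g x - (\<integral>y. g y \<partial>\<pi>)\<bar>)"
    unfolding poisson_def by (rule sum_abs)
  also have "\<dots> \<le> (\<Sum>j<J. 2 * \<theta> j)" by (intro sum_mono Q_converges_1[OF x])
  also have "\<dots> \<le> K" using sum_theta_le[of J] by (simp add: sum_distrib_left[symmetric] K_def)
  finally show ?thesis .
qed

lemma Q_1_poisson:
  assumes x: "x \<in> space S"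
  shows "poisson J g x - Q 1 (poisson J g) x = g x - Q J g x"
proof -
  define N where "N = kernel_pow S P 1 x"
  interpret prob_space N unfolding N_def by (rule kernel_pow_prob(1)[OF x])
  have i: "integrable N (Q j g)" for j
    unfolding N_def
  proof (rule Q_bounds(3)[OF x Q_measurable[OF g], where a="-1" and b=1])
    fix y assume y: "y \<in> space S"
    show "- 1 \<le> Q j g y \<and> Q j g y \<le> 1"
      using Q_bounds(1,2)[OF y g, of "-1" 1 j] b by (auto simp: abs_le_iff minus_le_iff)
  qed
  have "Q 1 (poisson J g) x = (\<Sum>j<J. Q 1 (Q j g) x - (\<integral>y. g y \<partial>\<pi>))"
    unfolding Q_def[of 1] poisson_def N_def[symmetric] using i prob_space by simp
  also have "\<dots> = (\<Sum>j<J. Q (Suc j) g x - (\<integral>y. g y \<partial>\<pi>))"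
    using Q_add[OF x g b, of 1] by simp
  finally have "poisson J g x - Q 1 (poisson J g) x = (\<Sum>j<J. Q j g x - Q (Suc j) g x)"
    by (simp add: poisson_def sum_subtractf)
  also have "\<dots> = Q 0 g x - Q J g x" by (rule sum_lessThan_telescope')
  finally show ?thesis by (simp add: Q_0[OF x g])
qed

lemma poisson_equation:
  assumes x: "x \<in> space S"
  shows "\<bar>(g x - (\<integral>y. g y \<partial>\<pi>)) - (poisson J g x - Q 1 (poisson J g) x)\<bar> \<le> 2 * \<theta> J"
  unfolding Q_1_poisson[OF x] using Q_converges_1[OF x, of J] by simp

end

end

section \<open>Events up to an exceptional set\<close>

text \<open>Statements uniform over all of H describe events that need not be measurable. A
  measurable exceptional set outside which the claim holds avoids the question and still permits
  union bounds.\<close>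

definition holds_except :: "'w measure \<Rightarrow> real \<Rightarrow> ('w \<Rightarrow> bool) \<Rightarrow> bool" where
  "holds_except M p R \<longleftrightarrow> (\<exists>A\<in>sets M. measure M A \<le> p \<and> (\<forall>\<omega>\<in>space M - A. R \<omega>))"

lemma holds_except_mono:
  assumes "holds_except M p R" "p \<le> p'" "\<And>\<omega>. \<omega> \<in> space M \<Longrightarrow> R \<omega> \<Longrightarrow> R' \<omega>"
  shows "holds_except M p' R'"
  using assms unfolding holds_except_def by (meson DiffD1 order_trans)

lemma holds_except_ball:
  assumes M: "finite_measure M" and I: "finite I" and H: "\<And>i. i \<in> I \<Longrightarrow> holds_except M (p i) (R i)"
  shows "holds_except M (\<Sum>i\<in>I. p i) (\<lambda>\<omega>. \<forall>i\<in>I. R i \<omega>)"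
proof -
  interpret finite_measure M by fact
  have "\<forall>i\<in>I. \<exists>A\<in>sets M. measure M A \<le> p i \<and> (\<forall>\<omega>\<in>space M - A. R i \<omega>)"
    using H by (simp add: holds_except_def)
  then obtain A where A: "\<And>i. i \<in> I \<Longrightarrow> A i \<in> sets M" "\<And>i. i \<in> I \<Longrightarrow> measure M (A i) \<le> p i"
    "\<And>i \<omega>. i \<in> I \<Longrightarrow> \<omega> \<in> space M - A i \<Longrightarrow> R i \<omega>" by metis
  have "measure M (\<Union>i\<in>I. A i) \<le> (\<Sum>i\<in>I. measure M (A i))"
    using A(1) I by (intro finite_measure_subadditive_finite) auto
  also have "\<dots> \<le> (\<Sum>i\<in>I. p i)" by (intro sum_mono A(2))
  finally show ?thesis
    unfolding holds_except_def using A(1,3) I by (intro bexI[of _ "\<Union>i\<in>I. A i"]) auto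
qed

lemma holds_except_conj:
  assumes M: "finite_measure M" and "holds_except M p R" "holds_except M p' R'"
  shows "holds_except M (p + p') (\<lambda>\<omega>. R \<omega> \<and> R' \<omega>)"
proof -
  have "holds_except M (\<Sum>i\<in>{0, 1::nat}. if i = 0 then p else p')
      (\<lambda>\<omega>. \<forall>i\<in>{0, 1::nat}. if i = 0 then R \<omega> else R' \<omega>)"
    by (rule holds_except_ball[OF M]) (use assms in auto)
  then show ?thesis by simp
qed

text \<open>\<open>B\<close> itself may fail to be measurable: monotonicity asks for measurability
  of the larger set only.\<close>

lemma holds_except_emeasure:
  assumes M: "finite_measure M" and H: "holds_except M p R" and B: "\<And>\<omega>. \<omega> \<in> B \<Longrightarrow> \<omega> \<in> space M \<and> \<not> R \<omega>"
  shows "emeasure M B \<le> ennreal p"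
proof -
  interpret finite_measure M by fact
  obtain A where A: "A \<in> sets M" "measure M A \<le> p" "\<And>\<omega>. \<omega> \<in> space M - A \<Longrightarrow> R \<omega>"
    using H by (auto simp: holds_except_def)
  have "emeasure M B \<le> emeasure M A" using A(1,3) B by (intro emeasure_mono) auto
  also have "\<dots> \<le> ennreal p" using A(2) by (simp add: emeasure_eq_measure ennreal_leI)
  finally show ?thesis .
qed

section \<open>Concentration for uniformly ergodic chains\<close>

text \<open>A discrete layer-cake formula: up to 1/n, g is the average of the indicators of n level
  sets, so a bound k valid for sets passes to functions with values in [0, 1] with the same
  constant.\<close>

lemma integral_diff_le_of_measure_diff_le:
  fixes g :: "'a \<Rightarrow> real"
  assumes N1: "prob_space N1" and N2: "prob_space N2" and s: "sets N1 = sets N2"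
    and d: "\<And>A. A \<in> sets N1 \<Longrightarrow> measure N1 A \<le> measure N2 A + k"
    and g: "g \<in> borel_measurable N1" and b: "\<And>y. y \<in> space N1 \<Longrightarrow> 0 \<le> g y \<and> g y \<le> 1"
  shows "(\<integral>y. g y \<partial>N1) \<le> (\<integral>y. g y \<partial>N2) + k"
proof (rule field_le_epsilon)
  fix e :: real assume "e > 0"
  then obtain n :: nat where n: "n > 0" "1 / real n < e"
    using nat_approx_posE by (metis of_nat_Suc zero_less_Suc)
  interpret N1: prob_space N1 by fact
  interpret N2: prob_space N2 by fact
  have sp: "space N2 = space N1" using s by (rule sets_eq_imp_space_eq[symmetric])
  have g2: "g \<in> borel_measurable N2" using g by (simp add: measurable_cong_sets[OF s refl])
  note i1 = prob_integral_bounds(1)[OF N1 g b]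
  have i2: "integrable N2 g" using prob_integral_bounds(1)[OF N2 g2, of 0 1] b sp by auto
  let ?A = "\<lambda>i. {y\<in>space N1. real i / real n \<le> g y}"
  \<comment> \<open>The level i/n is reached for exactly floor (n g(y)) of the indices i \<ge> 1, so
    \<open>?s\<close> rounds g down to a multiple of 1/n.\<close>
  let ?s = "\<lambda>y. (\<Sum>i\<in>{1..n}. indicator (?A i) y) / real n"
  have A1: "?A i \<in> sets N1" for i using g by measurable
  have A2: "?A i \<in> sets N2" for i using A1 s by simp
  have bounds: "?s y \<le> g y" "g y \<le> ?s y + 1 / real n" if y: "y \<in> space N1" for y
  proof -
    let ?f = "nat \<lfloor>g y * real n\<rfloor>"
    have "g y * real n \<le> real n" using mult_right_mono[of "g y" 1 "real n"] b[OF y] by simp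
    then have le: "?f \<le> n" by (simp add: nat_le_iff floor_le_iff)
    have "(\<Sum>i\<in>{1..n}. indicator (?A i) y :: real) = (\<Sum>i\<in>{1..n}. if i \<in> {1..?f} then 1 else 0)"
    proof (rule sum.cong[OF refl])
      fix i assume "i \<in> {1..n}"
      have "real i / real n \<le> g y \<longleftrightarrow> real i \<le> g y * real n" using n by (simp add: field_simps)
      also have "\<dots> \<longleftrightarrow> i \<le> ?f" using b[OF y] by (simp add: le_nat_iff le_floor_iff)
      finally show "indicator (?A i) y = (if i \<in> {1..?f} then 1 else 0 :: real)"
        using y \<open>i \<in> {1..n}\<close> by (auto simp: indicator_def)
    qed
    also have "\<dots> = real ?f"
      using le by (subst sum.inter_restrict[symmetric]) (auto simp: Int_absorb1)
    finally have eq: "?s y = real ?f / real n" by simp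
    have "real ?f \<le> g y * real n" "g y * real n \<le> real ?f + 1"
      using b[OF y] by (auto simp: of_nat_nat)
    then show "?s y \<le> g y" "g y \<le> ?s y + 1 / real n"
      unfolding eq using n by (auto simp: field_simps)
  qed
  have is1: "integrable N1 ?s" using A1 by (intro integrable_divide integrable_sum) (auto simp: N1.emeasure_eq_measure)
  have is2: "integrable N2 ?s" using A2 by (intro integrable_divide integrable_sum) (auto simp: N2.emeasure_eq_measure)
  have I1: "(\<integral>y. ?s y \<partial>N1) = (\<Sum>i\<in>{1..n}. measure N1 (?A i)) / real n"
    using A1 by (subst integral_divide_zero, subst Bochner_Integration.integral_sum) (auto simp: N1.emeasure_eq_measure)
  have I2: "(\<integral>y. ?s y \<partial>N2) = (\<Sum>i\<in>{1..n}. measure N2 (?A i)) / real n"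
    using A2 by (subst integral_divide_zero, subst Bochner_Integration.integral_sum) (auto simp: N2.emeasure_eq_measure)
  have "(\<integral>y. g y \<partial>N1) \<le> (\<integral>y. ?s y + 1 / real n \<partial>N1)"
    using i1 is1 bounds by (intro integral_mono) auto
  also have "\<dots> = (\<integral>y. ?s y \<partial>N1) + 1 / real n"
    using is1 N1.prob_space by simp
  also have "(\<integral>y. ?s y \<partial>N1) \<le> (\<Sum>i\<in>{1..n}. measure N2 (?A i) + k) / real n"
    unfolding I1 by (intro divide_right_mono sum_mono d A1) auto
  also have "\<dots> = (\<integral>y. ?s y \<partial>N2) + k"
    unfolding I2 using n by (simp add: sum.distrib add_divide_distrib)
  also have "(\<integral>y. ?s y \<partial>N2) \<le> (\<integral>y. g y \<partial>N2)"
    using i2 is2 bounds sp by (intro integral_mono) auto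
  finally show "(\<integral>y. g y \<partial>N1) \<le> (\<integral>y. g y \<partial>N2) + k + e" using n by simp
qed

locale doeblin_chain = doeblin_kernel S P \<pi> \<mu> m \<delta>
  for S :: "'e measure" and P :: "'e \<Rightarrow> 'e measure" and \<pi> \<mu> :: "'e measure" and m :: nat and \<delta> :: real +
  fixes M :: "'w measure" and X :: "nat \<Rightarrow> 'w \<Rightarrow> 'e"
  assumes chain: "markov_chain M S P X"
begin

abbreviation F :: "nat \<Rightarrow> 'w measure" where
  "F s \<equiv> process_sigma M S X {1..s}"

lemma M_prob: "prob_space M"
  using chain by (simp add: markov_chain_def)

lemma M_finite: "finite_measure M"
  using M_prob by (rule prob_space.finite_measure)

lemma X_in: "i \<ge> 1 \<Longrightarrow> \<omega> \<in> space M \<Longrightarrow> X i \<omega> \<in> space S"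
  using chain by (auto simp: markov_chain_def dest: measurable_space)

lemmas F_mono = markov_chain_subalgebra_mono[OF chain]
lemmas X_F = markov_chain_measurable[OF chain]

lemma measurable_F_mono:
  assumes "f \<in> F s \<Otimes>\<^sub>M L \<rightarrow>\<^sub>M L'" "s \<le> t"
  shows "f \<in> F t \<Otimes>\<^sub>M L \<rightarrow>\<^sub>M L'"
  using measurable_compose[OF measurable_Pair[OF measurable_compose[OF measurable_fst
      measurable_ident_subalgebra[OF F_mono[OF assms(2)]]] measurable_snd] assms(1)] by simp

text \<open>Azuma along the times s, s + b, s + 2b, ...: \<open>G k\<close> may depend on the
  trajectory up to s + k b, and the state b steps later has conditional law P^b. The case b = 1
  serves the Poisson martingales, b = b_n the gap between X_(t-b) and X_t.\<close>

lemma azuma_chain: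
  fixes G :: "nat \<Rightarrow> 'w \<Rightarrow> 'e \<Rightarrow> real"
  assumes s: "s \<ge> 1" and b: "b \<ge> 1" and N: "N > 0" and d: "d > 0" and x: "x > 0"
    and G: "\<And>k. k < N \<Longrightarrow> (\<lambda>(\<omega>, y). G k \<omega> y) \<in> borel_measurable (F (s + k * b) \<Otimes>\<^sub>M S)"
    and bd: "\<And>k \<omega> y. k < N \<Longrightarrow> \<omega> \<in> space M \<Longrightarrow> y \<in> space S \<Longrightarrow> \<bar>G k \<omega> y\<bar> \<le> d"
  shows "holds_except M (exp (- x\<^sup>2 / (2 * real N * d\<^sup>2)))
    (\<lambda>\<omega>. (\<Sum>k<N. G k \<omega> (X (s + k * b + b) \<omega>) - Q b (G k \<omega>) (X (s + k * b) \<omega>)) < x)"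
  unfolding holds_except_def Q_def
proof (rule azuma[where Z="\<lambda>k. X (s + k * b + b)" and F="\<lambda>k. F (s + k * b)"
      and \<kappa>="\<lambda>k \<omega>. kernel_pow S P b (X (s + k * b) \<omega>)", OF M_prob _ _ G bd _ N d x])
  show "cond_law M (F (s + k * b)) S (X (s + k * b + b)) (\<lambda>\<omega>. kernel_pow S P b (X (s + k * b) \<omega>))" for k
    using s by (intro cond_law_chain[OF chain]) simp
  show "subalgebra (F (s + k * b)) (F (s + j * b))" if "j \<le> k" for j k
    using that by (intro F_mono) simp
  show "X (s + j * b + b) \<in> F (s + k * b) \<rightarrow>\<^sub>M S" if "j < k" for j k
  proof (rule X_F)
    have "(j + 1) * b \<le> k * b" using that by (intro mult_right_mono) auto
    then show "s + j * b + b \<le> s + k * b" by simp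
  qed (use s in simp)
qed

text \<open>Of the correction 3K, the boundary term of the telescoping Poisson solution takes 2K,
  and K bounds the accumulated truncation error, the truncation level being T itself.\<close>

lemma ergodic_mean:
  fixes g :: "'e \<Rightarrow> real"
  assumes g: "g \<in> borel_measurable S" and b: "\<And>y. y \<in> space S \<Longrightarrow> \<bar>g y\<bar> \<le> 1"
    and T: "T > 0" and x: "x > 0"
  shows "holds_except M (exp (- x\<^sup>2 / (2 * real T * K\<^sup>2)))
    (\<lambda>\<omega>. (\<Sum>i=1..T. g (X i \<omega>) - (\<integral>y. g y \<partial>\<pi>)) < x + 3 * K)"
proof (rule holds_except_mono[OF azuma_chain[where s=1 and b=1 and G="\<lambda>k \<omega>. poisson T g", OF _ _ T K_pos x]])
  fix k
  show "(\<lambda>(\<omega>, y). poisson T g y) \<in> borel_measurable (F (1 + k * 1) \<Otimes>\<^sub>M S)"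
    using poisson_measurable[OF g b] by measurable
  show "y \<in> space S \<Longrightarrow> \<bar>poisson T g y\<bar> \<le> K" for y by (rule abs_poisson_le[OF g b])
next
  let ?u = "poisson T g" and ?I = "\<integral>y. g y \<partial>\<pi>"
  fix \<omega> assume w: "\<omega> \<in> space M"
    and *: "(\<Sum>k<T. ?u (X (1 + k * 1 + 1) \<omega>) - Q 1 ?u (X (1 + k * 1) \<omega>)) < x"
  have "(\<Sum>i=1..T. g (X i \<omega>) - ?I) = (\<Sum>k<T. g (X (Suc k) \<omega>) - ?I)"
    by (simp only: One_nat_def sum.atLeast1_atMost_eq)
  also have "\<dots> \<le> (\<Sum>k<T. ?u (X (Suc k) \<omega>) - Q 1 ?u (X (Suc k) \<omega>) + 2 * \<theta> T)"
    using poisson_equation[OF g b X_in[OF _ w], of _ T]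
    by (intro sum_mono) (smt (verit) Suc_le_mono One_nat_def le0)
  \<comment> \<open>A martingale increment needs u one step later than P u, so u(X_(k+1)) is
    exchanged for u(X_(k+2)); the difference telescopes.\<close>
  also have "\<dots> = (\<Sum>k<T. (?u (X (Suc (Suc k)) \<omega>) - Q 1 ?u (X (Suc k) \<omega>))
      - (?u (X (Suc (Suc k)) \<omega>) - ?u (X (Suc k) \<omega>)) + 2 * \<theta> T)"
    by (intro sum.cong) auto
  also have "\<dots> = (\<Sum>k<T. ?u (X (Suc (Suc k)) \<omega>) - Q 1 ?u (X (Suc k) \<omega>))
      - (?u (X (Suc T) \<omega>) - ?u (X (Suc 0) \<omega>)) + real T * (2 * \<theta> T)"
    by (simp only: sum.distrib sum_subtractf sum_lessThan_telescope[of "\<lambda>k. ?u (X (Suc k) \<omega>)"] sum_constant card_lessThan)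
       (simp add: sum_lessThan_telescope[of "\<lambda>k. ?u (X (Suc k) \<omega>)"] sum_subtractf[symmetric])
  also have "\<dots> < x + 3 * K"
  proof -
    have "\<bar>?u (X (Suc i) \<omega>)\<bar> \<le> K" for i by (intro abs_poisson_le[OF g b] X_in w) auto
    from this[of T] this[of 0] have "- (?u (X (Suc T) \<omega>) - ?u (X (Suc 0) \<omega>)) \<le> 2 * K" by linarith
    moreover have "real T * (2 * \<theta> T) \<le> K" using theta_le[of T] by (simp add: K_def)
    ultimately show ?thesis using * by simp
  qed
  finally show "(\<Sum>i=1..T. g (X i \<omega>) - ?I) < x + 3 * K" .
qed auto

text \<open>The initial law is arbitrary, so X_t may charge a \<pi>-null set. Since P^(t-1) of its
  indicator is within \<open>\<theta> (t - 1)\<close> of the \<pi>-mean 0, the mass is small for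
  late t.\<close>

lemma avoids_null_set:
  assumes B: "B \<in> sets S" and null: "measure \<pi> B = 0" and I: "finite I" "\<And>t. t \<in> I \<Longrightarrow> t \<ge> 1"
  shows "holds_except M (\<Sum>t\<in>I. \<theta> (t - 1)) (\<lambda>\<omega>. \<forall>t\<in>I. X t \<omega> \<notin> B)"
proof (rule holds_except_ball[OF M_finite I(1)])
  interpret prob_space M by (rule M_prob)
  fix t assume "t \<in> I"
  then have t: "t \<ge> 1" by (rule I(2))
  have c: "cond_law M (F 1) S (X t) (\<lambda>\<omega>. kernel_pow S P (t - 1) (X 1 \<omega>))"
    using cond_law_chain[OF chain order.refl, of "t - 1"] t by simp
  have Xt: "X t \<in> M \<rightarrow>\<^sub>M S" by (rule cond_lawD(2)[OF c])
  have le: "emeasure (kernel_pow S P (t - 1) x) B \<le> ennreal (\<theta> (t - 1))" if x: "x \<in> space S" for x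
  proof -
    interpret K: prob_space "kernel_pow S P (t - 1) x" by (rule kernel_pow_prob(1)[OF x])
    have sb: "B \<inter> space S = B" using sets.sets_into_space[OF B] by auto
    have "\<bar>Q (t - 1) (indicator B) x - (\<integral>y. indicator B y \<partial>\<pi>)\<bar> \<le> (1 - 0) * \<theta> (t - 1)"
      using B by (intro Q_converges[OF x]) (auto simp: indicator_def)
    then have "measure (kernel_pow S P (t - 1) x) B \<le> \<theta> (t - 1)"
      using null by (simp add: Q_def kernel_pow_prob(3)[OF x] space_pi sb)
    then show ?thesis unfolding K.emeasure_eq_measure by (rule ennreal_leI)
  qed
  have g: "(\<lambda>(\<omega>, y). indicator B y :: ennreal) \<in> borel_measurable (F 1 \<Otimes>\<^sub>M S)" using B by measurable
  have "emeasure M (X t -` B \<inter> space M) = (\<integral>\<^sup>+\<omega>. indicator (X t -` B \<inter> space M) \<omega> \<partial>M)"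
    by (rule nn_integral_indicator[OF measurable_sets[OF Xt B], symmetric])
  also have "\<dots> = (\<integral>\<^sup>+\<omega>. indicator B (X t \<omega>) \<partial>M)"
    by (intro nn_integral_cong) (simp add: indicator_def)
  also have "\<dots> = (\<integral>\<^sup>+\<omega>. \<integral>\<^sup>+y. indicator B y \<partial>kernel_pow S P (t - 1) (X 1 \<omega>) \<partial>M)"
    using cond_law_nn_integral[OF c g] by simp
  also have "\<dots> \<le> (\<integral>\<^sup>+\<omega>. ennreal (\<theta> (t - 1)) \<partial>M)"
    using le X_in[of 1] B kernel_pow_prob(2) by (intro nn_integral_mono) (simp add: nn_integral_indicator)
  also have "\<dots> = ennreal (\<theta> (t - 1))" by (simp add: emeasure_space_1)
  finally have "measure M (X t -` B \<inter> space M) \<le> \<theta> (t - 1)"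
    using theta_nonneg by (simp add: emeasure_eq_measure)
  then show "holds_except M (\<theta> (t - 1)) (\<lambda>\<omega>. X t \<omega> \<notin> B)"
    unfolding holds_except_def using measurable_sets[OF Xt B] by (intro bexI[of _ "X t -` B \<inter> space M"]) auto
qed

text \<open>Within one residue class modulo b the summands are martingale increments, since \<psi>_t
  is known at time t - b. Each class gets the share N x / b of the threshold, and the union bound
  over the classes produces the prefactor b.\<close>

lemma gap_martingale:
  fixes \<psi> :: "nat \<Rightarrow> 'w \<Rightarrow> 'e \<Rightarrow> real"
  assumes b: "1 \<le> b" "b < c" and N: "b \<le> N" and x: "x > 0"
    and \<psi>: "\<And>t. c \<le> t \<Longrightarrow> t < c + N \<Longrightarrow> (\<lambda>(\<omega>, y). \<psi> t \<omega> y) \<in> borel_measurable (F (t - b) \<Otimes>\<^sub>M S)"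
    and bd: "\<And>t \<omega> y. c \<le> t \<Longrightarrow> t < c + N \<Longrightarrow> \<omega> \<in> space M \<Longrightarrow> y \<in> space S \<Longrightarrow> \<bar>\<psi> t \<omega> y\<bar> \<le> 1"
  shows "holds_except M (real b * exp (- (real N * x\<^sup>2 / (4 * real b))))
    (\<lambda>\<omega>. (\<Sum>t=c..<c + N. \<psi> t \<omega> (X t \<omega>) - Q b (\<psi> t \<omega>) (X (t - b) \<omega>)) < real N * x)"
proof -
  \<comment> \<open>Padding with zero beyond the range gives every class the same number L of terms,
    with L b \<ge> N.\<close>
  define G where "G = (\<lambda>t \<omega> y. if t < c + N then \<psi> t \<omega> y else 0)"
  define L where "L = N div b + 1"
  define y where "y = real N * x / real b"
  have b0: "real b > 0" using b by simp
  have N0: "real N > 0" using N b by simp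
  have y: "y > 0" using b0 N0 x by (simp add: y_def)
  \<comment> \<open>As b \<le> N, the extra term in L costs at most a factor 2, and y^2 / (2 L) is
    still at least N x^2 / (4 b).\<close>
  have Lle: "real L \<le> 2 * real N / real b"
  proof -
    have "real (N div b) \<le> real N / real b" by (rule of_nat_div_le_of_nat)
    moreover have "1 \<le> real N / real b" using N b by simp
    ultimately show ?thesis by (simp add: L_def)
  qed
  have step: "holds_except M (exp (- (real N * x\<^sup>2 / (4 * real b))))
    (\<lambda>\<omega>. (\<Sum>k<L. G (c + r + k * b) \<omega> (X (c + r + k * b) \<omega>)
        - Q b (G (c + r + k * b) \<omega>) (X (c + r + k * b - b) \<omega>)) < y)" if r: "r < b" for r
  proof (rule holds_except_mono[OF azuma_chain[where s="c - b + r" and b=b and G="\<lambda>k. G (c + r + k * b)" and N=L and d=1]])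
    show "c - b + r \<ge> 1" "b \<ge> 1" "L > 0" "(1::real) > 0" "y > 0" using b y by (auto simp: L_def)
    fix k
    have e: "c + r + k * b - b = c - b + r + k * b" using b by simp
    show "(\<lambda>(\<omega>, y). G (c + r + k * b) \<omega> y) \<in> borel_measurable (F (c - b + r + k * b) \<Otimes>\<^sub>M S)"
      using \<psi>[of "c + r + k * b"] unfolding e G_def by (cases "c + r + k * b < c + N") auto
    show "\<And>\<omega> y. \<omega> \<in> space M \<Longrightarrow> y \<in> space S \<Longrightarrow> \<bar>G (c + r + k * b) \<omega> y\<bar> \<le> 1"
      using bd[of "c + r + k * b"] by (auto simp: G_def)
  next
    have "real N * x\<^sup>2 / (4 * real b) = y\<^sup>2 / (2 * (2 * real N / real b))"
      using N0 b0 by (simp add: y_def power2_eq_square field_simps)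
    also have "\<dots> \<le> y\<^sup>2 / (2 * real L)"
      using Lle N0 b0 by (intro divide_left_mono mult_pos_pos divide_pos_pos) (auto simp: L_def)
    finally show "exp (- y\<^sup>2 / (2 * real L * 1\<^sup>2)) \<le> exp (- (real N * x\<^sup>2 / (4 * real b)))" by simp
  next
    fix \<omega>
    assume "(\<Sum>k<L. G (c + r + k * b) \<omega> (X (c - b + r + k * b + b) \<omega>) -
        Q b (G (c + r + k * b) \<omega>) (X (c - b + r + k * b) \<omega>)) < y"
    moreover have "c - b + r + k * b + b = c + r + k * b" "c - b + r + k * b = c + r + k * b - b" for k
      using b by auto
    ultimately show "(\<Sum>k<L. G (c + r + k * b) \<omega> (X (c + r + k * b) \<omega>)
        - Q b (G (c + r + k * b) \<omega>) (X (c + r + k * b - b) \<omega>)) < y" by simp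
  qed
  have "holds_except M (\<Sum>r\<in>{..<b}. exp (- (real N * x\<^sup>2 / (4 * real b))))
    (\<lambda>\<omega>. \<forall>r\<in>{..<b}. (\<Sum>k<L. G (c + r + k * b) \<omega> (X (c + r + k * b) \<omega>)
        - Q b (G (c + r + k * b) \<omega>) (X (c + r + k * b - b) \<omega>)) < y)"
    using step by (intro holds_except_ball[OF M_finite]) auto
  then show ?thesis
  proof (rule holds_except_mono)
    fix \<omega> assume *: "\<forall>r\<in>{..<b}. (\<Sum>k<L. G (c + r + k * b) \<omega> (X (c + r + k * b) \<omega>)
        - Q b (G (c + r + k * b) \<omega>) (X (c + r + k * b - b) \<omega>)) < y"
    let ?D = "\<lambda>t. G t \<omega> (X t \<omega>) - Q b (G t \<omega>) (X (t - b) \<omega>)"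
    have "N = N div b * b + N mod b" "N mod b < b" "L * b = N div b * b + b"
      using b by (simp_all add: L_def)
    then have "N \<le> L * b" by linarith
    then have sub: "{c..<c + N} \<subseteq> {c..<c + L * b}" by auto
    have "(\<Sum>t=c..<c + N. \<psi> t \<omega> (X t \<omega>) - Q b (\<psi> t \<omega>) (X (t - b) \<omega>)) = (\<Sum>t=c..<c + N. ?D t)"
      by (intro sum.cong) (auto simp: G_def)
    also have "\<dots> = (\<Sum>t=c..<c + L * b. ?D t)"
      by (intro sum.mono_neutral_left sub) (auto simp: G_def Q_def)
    also have "\<dots> = (\<Sum>i<L * b. ?D (c + i))"
      by (simp add: lessThan_atLeast0 sum.atLeastLessThan_shift_0[of _ c])
    also have "\<dots> = (\<Sum>k<L. \<Sum>i\<in>{k * b..<k * b + b}. ?D (c + i))"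
      by (simp add: sum.nat_group)
    also have "\<dots> = (\<Sum>k<L. \<Sum>r<b. ?D (c + r + k * b))"
    proof (rule sum.cong[OF refl])
      fix k
      show "(\<Sum>i\<in>{k * b..<k * b + b}. ?D (c + i)) = (\<Sum>r<b. ?D (c + r + k * b))"
        by (simp add: lessThan_atLeast0 sum.atLeastLessThan_shift_0[of _ "k * b"] add_ac)
    qed
    also have "\<dots> = (\<Sum>r<b. \<Sum>k<L. ?D (c + r + k * b))" by (rule sum.swap)
    also have "\<dots> < (\<Sum>r<b. y)"
    proof (rule sum_strict_mono)
      have "0 \<in> {..<b}" using b by simp
      then show "{..<b} \<noteq> {}" by blast
    qed (use * in auto)
    also have "\<dots> = real N * x" using b0 by (simp add: y_def)
    finally show "(\<Sum>t=c..<c + N. \<psi> t \<omega> (X t \<omega>) - Q b (\<psi> t \<omega>) (X (t - b) \<omega>)) < real N * x" .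
  qed simp
qed

end

section \<open>U-statistics of the chain\<close>

lemma sum_pairs_swap:
  fixes c :: "nat \<Rightarrow> nat \<Rightarrow> real"
  shows "(\<Sum>p<N. \<Sum>j=Suc p..<N. c p j) = (\<Sum>j<N. \<Sum>p<j. c p j)"
proof (induction N)
  case (Suc N)
  have "(\<Sum>p<Suc N. \<Sum>j=Suc p..<Suc N. c p j) = (\<Sum>p<N. (\<Sum>j=Suc p..<N. c p j) + c p N)"
    by simp
  also have "\<dots> = (\<Sum>j<N. \<Sum>p<j. c p j) + (\<Sum>p<N. c p N)" by (simp add: sum.distrib Suc)
  finally show ?case by simp
qed simp

text \<open>Abel summation by induction: from N to N + 1 each weight grows by one, which adds the
  plain telescoping sum \<open>w 0 - w N\<close>, of size at most 2K.\<close>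

lemma abs_weighted_telescope_le:
  fixes w :: "nat \<Rightarrow> real"
  assumes "\<And>p. p \<le> N \<Longrightarrow> \<bar>w p\<bar> \<le> K"
  shows "\<bar>\<Sum>p<N. real (N - 1 - p) * (w p - w (Suc p))\<bar> \<le> 2 * real N * K"
  using assms
proof (induction N)
  case (Suc N)
  have "(\<Sum>p<Suc N. real (Suc N - 1 - p) * (w p - w (Suc p))) = (\<Sum>p<N. real (N - p) * (w p - w (Suc p)))"
    by simp
  also have "\<dots> = (\<Sum>p<N. real (N - 1 - p) * (w p - w (Suc p)) + (w p - w (Suc p)))"
    by (intro sum.cong) (auto simp: of_nat_diff algebra_simps)
  also have "\<dots> = (\<Sum>p<N. real (N - 1 - p) * (w p - w (Suc p))) + (w 0 - w N)"
    by (simp add: sum.distrib sum_lessThan_telescope')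
  finally have eq: "(\<Sum>p<Suc N. real (Suc N - 1 - p) * (w p - w (Suc p))) =
      (\<Sum>p<N. real (N - 1 - p) * (w p - w (Suc p))) + (w 0 - w N)" .
  have "\<bar>\<Sum>p<N. real (N - 1 - p) * (w p - w (Suc p))\<bar> \<le> 2 * real N * K"
    using Suc by simp
  moreover have "\<bar>w 0\<bar> \<le> K" "\<bar>w N\<bar> \<le> K" using Suc.prems by auto
  ultimately show ?case unfolding eq by (simp add: algebra_simps)
qed simp

text \<open>The two Poisson equations turn the double sum into a martingale: \<open>v p j\<close> and \<open>qv p j\<close> stand for
  \<open>v(Y\<^sub>p, Y\<^sub>j)\<close> and \<open>P v(Y\<^sub>p, \<cdot>)(Y\<^sub>j)\<close>, and \<open>cb\<close> is the first-order projection of \<open>c\<close>.\<close>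

lemma ustat_le_martingale:
  fixes c v qv :: "nat \<Rightarrow> nat \<Rightarrow> real" and cb w qw :: "nat \<Rightarrow> real"
  assumes c: "\<And>p j. p < j \<Longrightarrow> j < N \<Longrightarrow> c p j - cb p \<le> v p j - qv p j + e"
    and cb: "\<And>p. p < N \<Longrightarrow> cb p - R \<le> w p - qw p + e"
    and v: "\<And>p j. p < N \<Longrightarrow> j \<le> N \<Longrightarrow> \<bar>v p j\<bar> \<le> K"
    and w: "\<And>p. p \<le> N \<Longrightarrow> \<bar>w p\<bar> \<le> K" and e: "e \<ge> 0"
  shows "(\<Sum>p<N. \<Sum>j=Suc p..<N. c p j - R) \<le>
     (\<Sum>r<N. ((\<Sum>p<r. v p (Suc r)) + real (N - 1 - r) * w (Suc r)) - ((\<Sum>p<r. qv p r) + real (N - 1 - r) * qw r))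
       + 4 * real N * K + 2 * real N * (real N * e)"
proof -
  \<comment> \<open>For fixed p the Poisson equation acts in the second variable. Passing from
    \<open>v p j\<close> to \<open>v p (Suc j)\<close> telescopes and costs at most 2K.\<close>
  have inner: "(\<Sum>j=Suc p..<N. c p j - cb p) \<le> (\<Sum>j=Suc p..<N. v p (Suc j) - qv p j) + 2 * K + real N * e"
    if p: "p < N" for p
  proof -
    have "(\<Sum>j=Suc p..<N. c p j - cb p) \<le> (\<Sum>j=Suc p..<N. v p j - qv p j + e)"
      by (intro sum_mono c) auto
    also have "\<dots> = (\<Sum>j=Suc p..<N. v p (Suc j) - qv p j) - (\<Sum>j=Suc p..<N. v p (Suc j) - v p j) + real (N - Suc p) * e"
      by (simp add: sum.distrib sum_subtractf)
    also have "(\<Sum>j=Suc p..<N. v p (Suc j) - v p j) = v p N - v p (Suc p)"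
      using p by (intro sum_Suc_diff') simp
    also have "real (N - Suc p) * e \<le> real N * e" using e by (intro mult_right_mono) auto
    finally show ?thesis using v[OF p, of N] v[OF p, of "Suc p"] p by simp
  qed
  \<comment> \<open>What remains depends on p alone and occurs once for each later j, that is N - 1
    - p times; the Poisson equation for the projection handles it.\<close>
  have outer: "(\<Sum>j=Suc p..<N. cb p - R) \<le> real (N - 1 - p) * (w (Suc p) - qw p)
      + real (N - 1 - p) * (w p - w (Suc p)) + real N * e" if p: "p < N" for p
  proof -
    have "(\<Sum>j=Suc p..<N. cb p - R) = real (N - 1 - p) * (cb p - R)" by simp
    also have "\<dots> \<le> real (N - 1 - p) * (w p - qw p + e)" by (intro mult_left_mono cb p) simp
    also have "\<dots> = real (N - 1 - p) * (w (Suc p) - qw p) + real (N - 1 - p) * (w p - w (Suc p)) + real (N - 1 - p) * e"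
      by (simp add: algebra_simps)
    also have "real (N - 1 - p) * e \<le> real N * e" using e by (intro mult_right_mono) auto
    finally show ?thesis by simp
  qed
  have "(\<Sum>p<N. \<Sum>j=Suc p..<N. c p j - R) = (\<Sum>p<N. (\<Sum>j=Suc p..<N. c p j - cb p) + (\<Sum>j=Suc p..<N. cb p - R))"
    unfolding sum.distrib[symmetric] by (simp del: sum_constant)
  also have "\<dots> \<le> (\<Sum>p<N. ((\<Sum>j=Suc p..<N. v p (Suc j) - qv p j) + 2 * K + real N * e)
     + (real (N - 1 - p) * (w (Suc p) - qw p) + real (N - 1 - p) * (w p - w (Suc p)) + real N * e))"
    by (intro sum_mono add_mono inner outer) auto
  also have "\<dots> = (\<Sum>p<N. \<Sum>j=Suc p..<N. v p (Suc j) - qv p j) + (\<Sum>p<N. real (N - 1 - p) * (w (Suc p) - qw p))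
     + (\<Sum>p<N. real (N - 1 - p) * (w p - w (Suc p))) + 2 * real N * K + 2 * real N * (real N * e)"
    by (simp add: sum.distrib mult_ac add_ac)
  \<comment> \<open>Grouping by the later index makes the increment at r a sum over the past p < r,
    as a martingale demands.\<close>
  also have "(\<Sum>p<N. \<Sum>j=Suc p..<N. v p (Suc j) - qv p j) = (\<Sum>r<N. \<Sum>p<r. v p (Suc r) - qv p r)"
    by (rule sum_pairs_swap)
  also have "(\<Sum>p<N. real (N - 1 - p) * (w p - w (Suc p))) \<le> 2 * real N * K"
    using abs_weighted_telescope_le[of N w K] w by simp
  also have "(\<Sum>r<N. \<Sum>p<r. v p (Suc r) - qv p r) + (\<Sum>p<N. real (N - 1 - p) * (w (Suc p) - qw p))
     = (\<Sum>r<N. ((\<Sum>p<r. v p (Suc r)) + real (N - 1 - r) * w (Suc r)) - ((\<Sum>p<r. qv p r) + real (N - 1 - r) * qw r))"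
    unfolding sum.distrib[symmetric] by (intro sum.cong refl) (simp add: sum_subtractf algebra_simps)
  finally show ?thesis by (simp add: mult_ac add_ac)
qed

context doeblin_kernel
begin

lemma Q_linear_combination:
  fixes g :: "'i \<Rightarrow> 'e \<Rightarrow> real" and h :: "'e \<Rightarrow> real"
  assumes x: "x \<in> space S" and g: "\<And>i. i \<in> I \<Longrightarrow> g i \<in> borel_measurable S" and h: "h \<in> borel_measurable S"
    and bg: "\<And>i y. i \<in> I \<Longrightarrow> y \<in> space S \<Longrightarrow> \<bar>g i y\<bar> \<le> B" and bh: "\<And>y. y \<in> space S \<Longrightarrow> \<bar>h y\<bar> \<le> B"
  shows "Q n (\<lambda>y. (\<Sum>i\<in>I. g i y) + c * h y) x = (\<Sum>i\<in>I. Q n (g i) x) + c * Q n h x"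
proof -
  have "integrable (kernel_pow S P n x) (g i)" if "i \<in> I" for i
    using Q_bounds(3)[OF x g[OF that], where a="-B" and b=B] bg[OF that] by (auto simp: abs_le_iff minus_le_iff)
  moreover have "integrable (kernel_pow S P n x) h"
    using Q_bounds(3)[OF x h, where a="-B" and b=B] bh by (auto simp: abs_le_iff minus_le_iff)
  ultimately show ?thesis by (simp add: Q_def)
qed

end

context doeblin_chain
begin

text \<open>The kernel is frozen at time t and only later points enter, so the increments are
  adapted. Each \<open>G r\<close> is bounded by N K: r terms of size K plus w with weight N - 1 -
  r. The correction 6NK consists of 4NK from telescoping and 2NK from truncation at level N.\<close>

lemma ustat:
  fixes a :: "'w \<Rightarrow> 'e \<Rightarrow> 'e \<Rightarrow> real"
  assumes a: "(\<lambda>(\<omega>, x, y). a \<omega> x y) \<in> borel_measurable (F t \<Otimes>\<^sub>M (S \<Otimes>\<^sub>M S))"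
    and bd: "\<And>\<omega> x y. \<omega> \<in> space M \<Longrightarrow> x \<in> space S \<Longrightarrow> y \<in> space S \<Longrightarrow> \<bar>a \<omega> x y\<bar> \<le> 1"
    and N: "N > 0" and z: "z > 0"
  shows "holds_except M (exp (- z\<^sup>2 / (2 * real N * (real N * K)\<^sup>2)))
    (\<lambda>\<omega>. (\<Sum>p<N. \<Sum>j=Suc p..<N. a \<omega> (X (t + 1 + p) \<omega>) (X (t + 1 + j) \<omega>) - (\<integral>x. \<integral>y. a \<omega> x y \<partial>\<pi> \<partial>\<pi>))
      < z + 6 * real N * K)"
proof -
  define ab where "ab = (\<lambda>\<omega> x. \<integral>y. a \<omega> x y \<partial>\<pi>)"
  define v where "v = (\<lambda>\<omega> x y. poisson N (a \<omega> x) y)"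
  define w where "w = (\<lambda>\<omega> y. poisson N (ab \<omega>) y)"
  define G where "G = (\<lambda>r \<omega> y. (\<Sum>p<r. v \<omega> (X (t + 1 + p) \<omega>) y) + real (N - 1 - r) * w \<omega> y)"
  have a': "(\<lambda>(z, y). (\<lambda>(\<omega>, x). a \<omega> x) z y) \<in> borel_measurable ((F t \<Otimes>\<^sub>M S) \<Otimes>\<^sub>M S)"
    using measurable_compose[OF _ a, of "\<lambda>((\<omega>, x), y). (\<omega>, x, y)" "(F t \<Otimes>\<^sub>M S) \<Otimes>\<^sub>M S"]
    by (simp add: split_beta')
  have ab_m: "(\<lambda>(\<omega>, x). ab \<omega> x) \<in> borel_measurable (F t \<Otimes>\<^sub>M S)"
    using integral_pi_measurable_param[OF a'] by (simp add: ab_def split_beta')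
  have v_m: "(\<lambda>((\<omega>, x), y). v \<omega> x y) \<in> borel_measurable ((F t \<Otimes>\<^sub>M S) \<Otimes>\<^sub>M S)"
    using poisson_measurable_param[OF a', of N] by (simp add: v_def split_beta')
  have w_m: "(\<lambda>(\<omega>, y). w \<omega> y) \<in> borel_measurable (F t \<Otimes>\<^sub>M S)"
    using poisson_measurable_param[OF ab_m, of N] by (simp add: w_def)
  have sec: "a \<omega> x \<in> borel_measurable S" if "\<omega> \<in> space M" "x \<in> space S" for \<omega> x
    using measurable_compose[OF measurable_Pair1'[of "(\<omega>, x)"] a'] that
    by (simp add: space_pair_measure process_sigma_def)
  have sec': "ab \<omega> \<in> borel_measurable S" if "\<omega> \<in> space M" for \<omega>
    using measurable_compose[OF measurable_Pair1'[of \<omega>] ab_m] that by (simp add: process_sigma_def)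
  have ab_bd: "\<bar>ab \<omega> x\<bar> \<le> 1" if "\<omega> \<in> space M" "x \<in> space S" for \<omega> x
    unfolding ab_def using pi_bounds(2,3)[OF sec[OF that], where a="-1" and b=1] bd[OF that]
    by (auto simp: abs_le_iff minus_le_iff)
  have v_bd: "\<bar>v \<omega> x y\<bar> \<le> K" if "\<omega> \<in> space M" "x \<in> space S" "y \<in> space S" for \<omega> x y
    unfolding v_def using that by (intro abs_poisson_le sec bd)
  have w_bd: "\<bar>w \<omega> y\<bar> \<le> K" if "\<omega> \<in> space M" "y \<in> space S" for \<omega> y
    unfolding w_def using that by (intro abs_poisson_le sec' ab_bd)
  have v_sec: "v \<omega> x \<in> borel_measurable S" if "\<omega> \<in> space M" "x \<in> space S" for \<omega> x
    unfolding v_def using that poisson_measurable[OF sec bd] by simp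
  have w_sec: "w \<omega> \<in> borel_measurable S" if "\<omega> \<in> space M" for \<omega>
    unfolding w_def using that poisson_measurable[OF sec' ab_bd] by simp
  have NK: "real N * K > 0" using N K_pos by simp
  show ?thesis
  proof (rule holds_except_mono[OF azuma_chain[where s="t + 1" and b=1 and N=N and G=G, OF _ _ N NK z]])
    fix r assume r: "r < N"
    have v_G: "(\<lambda>(\<omega>, y). v \<omega> (X (t + 1 + p) \<omega>) y) \<in> borel_measurable (F (t + 1 + r * 1) \<Otimes>\<^sub>M S)" if "p < r" for p
    proof -
      have i: "(\<lambda>\<omega>. \<omega>) \<in> F (t + 1 + r * 1) \<rightarrow>\<^sub>M F t"
        by (intro measurable_ident_subalgebra F_mono) simp
      have X: "X (t + 1 + p) \<in> F (t + 1 + r * 1) \<rightarrow>\<^sub>M S" using that by (intro X_F) auto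
      have "(\<lambda>z. ((fst z, X (t + 1 + p) (fst z)), snd z)) \<in> F (t + 1 + r * 1) \<Otimes>\<^sub>M S \<rightarrow>\<^sub>M (F t \<Otimes>\<^sub>M S) \<Otimes>\<^sub>M S"
        by (intro measurable_Pair measurable_compose[OF measurable_fst i] measurable_compose[OF measurable_fst X] measurable_snd)
      from measurable_compose[OF this v_m] show ?thesis by (simp add: split_beta')
    qed
    have w_G: "(\<lambda>(\<omega>, y). w \<omega> y) \<in> borel_measurable (F (t + 1 + r * 1) \<Otimes>\<^sub>M S)"
      by (rule measurable_F_mono[OF w_m]) simp
    show "(\<lambda>(\<omega>, y). G r \<omega> y) \<in> borel_measurable (F (t + 1 + r * 1) \<Otimes>\<^sub>M S)"
      unfolding G_def split_beta'
      by (intro borel_measurable_add borel_measurable_sum borel_measurable_times borel_measurable_const)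
         (use v_G w_G in \<open>auto simp: split_beta'\<close>)
    fix \<omega> y assume w: "\<omega> \<in> space M" and y: "y \<in> space S"
    have "\<bar>G r \<omega> y\<bar> \<le> (\<Sum>p<r. \<bar>v \<omega> (X (t + 1 + p) \<omega>) y\<bar>) + \<bar>real (N - 1 - r) * w \<omega> y\<bar>"
      unfolding G_def by (intro order.trans[OF abs_triangle_ineq] add_mono sum_abs order.refl)
    also have "\<dots> \<le> (\<Sum>p<r. K) + real (N - 1 - r) * K"
      using v_bd[OF w X_in[OF _ w] y] w_bd[OF w y]
      by (intro add_mono sum_mono) (auto simp: abs_mult intro!: mult_left_mono)
    also have "\<dots> = (real r + real (N - 1 - r)) * K" by (simp add: algebra_simps)
    also have "\<dots> \<le> real N * K" using r K_pos by (intro mult_right_mono) auto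
    finally show "\<bar>G r \<omega> y\<bar> \<le> real N * K" .
  next
    fix \<omega> assume w: "\<omega> \<in> space M"
      and *: "(\<Sum>k<N. G k \<omega> (X (t + 1 + k * 1 + 1) \<omega>) - Q 1 (G k \<omega>) (X (t + 1 + k * 1) \<omega>)) < z"
    let ?Y = "\<lambda>p. X (t + 1 + p) \<omega>"
    have Y: "?Y p \<in> space S" for p using w by (intro X_in) auto
    have "(\<Sum>p<N. \<Sum>j=Suc p..<N. a \<omega> (?Y p) (?Y j) - (\<integral>x. \<integral>y. a \<omega> x y \<partial>\<pi> \<partial>\<pi>))
      \<le> (\<Sum>r<N. ((\<Sum>p<r. v \<omega> (?Y p) (?Y (Suc r))) + real (N - 1 - r) * w \<omega> (?Y (Suc r)))
            - ((\<Sum>p<r. Q 1 (v \<omega> (?Y p)) (?Y r)) + real (N - 1 - r) * Q 1 (w \<omega>) (?Y r)))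
         + 4 * real N * K + 2 * real N * (real N * (2 * \<theta> N))"
    proof (rule ustat_le_martingale[where cb="\<lambda>p. ab \<omega> (?Y p)"])
      show "a \<omega> (?Y p) (?Y j) - ab \<omega> (?Y p) \<le> v \<omega> (?Y p) (?Y j) - Q 1 (v \<omega> (?Y p)) (?Y j) + 2 * \<theta> N" for p j
        using poisson_equation[OF sec[OF w Y] bd[OF w Y] Y, of p j N] unfolding v_def ab_def by linarith
      show "ab \<omega> (?Y p) - (\<integral>x. \<integral>y. a \<omega> x y \<partial>\<pi> \<partial>\<pi>) \<le> w \<omega> (?Y p) - Q 1 (w \<omega>) (?Y p) + 2 * \<theta> N" for p
        using poisson_equation[OF sec'[OF w] ab_bd[OF w] Y, of p N] unfolding w_def ab_def by linarith
    qed (use v_bd[OF w Y Y] w_bd[OF w Y] theta_nonneg in auto)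
    also have "(\<Sum>r<N. ((\<Sum>p<r. v \<omega> (?Y p) (?Y (Suc r))) + real (N - 1 - r) * w \<omega> (?Y (Suc r)))
            - ((\<Sum>p<r. Q 1 (v \<omega> (?Y p)) (?Y r)) + real (N - 1 - r) * Q 1 (w \<omega>) (?Y r)))
        = (\<Sum>k<N. G k \<omega> (X (t + 1 + k * 1 + 1) \<omega>) - Q 1 (G k \<omega>) (X (t + 1 + k * 1) \<omega>))"
    proof (intro sum.cong refl)
      fix r
      have "Q 1 (G r \<omega>) (?Y r) = (\<Sum>p<r. Q 1 (v \<omega> (?Y p)) (?Y r)) + real (N - 1 - r) * Q 1 (w \<omega>) (?Y r)"
        unfolding G_def
        by (rule Q_linear_combination[OF Y v_sec[OF w Y] w_sec[OF w] v_bd[OF w Y] w_bd[OF w]])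
      then show "((\<Sum>p<r. v \<omega> (?Y p) (?Y (Suc r))) + real (N - 1 - r) * w \<omega> (?Y (Suc r)))
            - ((\<Sum>p<r. Q 1 (v \<omega> (?Y p)) (?Y r)) + real (N - 1 - r) * Q 1 (w \<omega>) (?Y r))
        = G r \<omega> (X (t + 1 + r * 1 + 1) \<omega>) - Q 1 (G r \<omega>) (X (t + 1 + r * 1) \<omega>)"
        by (simp add: G_def)
    qed
    also have "2 * real N * (real N * (2 * \<theta> N)) \<le> 2 * real N * K"
      using theta_le[of N] by (intro mult_left_mono) (auto simp: K_def)
    finally show "(\<Sum>p<N. \<Sum>j=Suc p..<N. a \<omega> (?Y p) (?Y j) - (\<integral>x. \<integral>y. a \<omega> x y \<partial>\<pi> \<partial>\<pi>)) < z + 6 * real N * K"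
      using * by simp
  qed auto
qed

end

section \<open>Losses, risks and the average risk of the hypotheses\<close>

lemma prob_integral_diff_le:
  fixes u v :: "'a \<Rightarrow> real"
  assumes N: "prob_space N" and u: "integrable N u" and v: "integrable N v"
    and d: "\<And>y. y \<in> space N \<Longrightarrow> \<bar>u y - v y\<bar> \<le> e"
  shows "\<bar>(\<integral>y. u y \<partial>N) - (\<integral>y. v y \<partial>N)\<bar> \<le> e"
proof -
  have m: "(\<lambda>y. u y - v y) \<in> borel_measurable N" using u v by auto
  have "- e \<le> u y - v y \<and> u y - v y \<le> e" if "y \<in> space N" for y
    using d[OF that] by linarith
  from prob_integral_bounds(2,3)[OF N m this] have "\<bar>\<integral>y. u y - v y \<partial>N\<bar> \<le> e"
    by (simp add: abs_le_iff minus_le_iff)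
  then show ?thesis using u v by simp
qed

lemma real_choose_2: "real (N choose 2) = real N * (real N - 1) / 2"
proof (induction N)
  case (Suc N)
  have "real (Suc N choose 2) = real (N choose 2) + real N" by (simp add: numeral_2_eq_2)
  then show ?case using Suc by (simp add: field_simps)
qed simp

text \<open>Each term 1 / sqrt (n + 1) is at most 2 (sqrt (n + 1) - sqrt n), which telescopes. This
  is what averages the penalties.\<close>

lemma sum_inverse_sqrt_le: "(\<Sum>k=1..n. 1 / sqrt (real k)) \<le> 2 * sqrt (real n)"
proof (induction n)
  case (Suc n)
  let ?a = "sqrt (real n)" and ?b = "sqrt (real (Suc n))"
  have ab: "0 \<le> ?a" "?a \<le> ?b" "0 < ?b" by auto
  have "(?b - ?a) * (?b + ?a) = 1" by (simp add: algebra_simps)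
  moreover have "(?b - ?a) * (?b + ?a) \<le> (?b - ?a) * (2 * ?b)"
    using ab by (intro mult_left_mono) auto
  ultimately have "1 / ?b \<le> 2 * (?b - ?a)" using ab by (simp add: field_simps)
  then show ?case using Suc by simp
qed simp

locale online_learning = doeblin_chain S P \<pi> \<mu> m \<delta> M X
  for S :: "'e measure" and P :: "'e \<Rightarrow> 'e measure" and \<pi> \<mu> :: "'e measure" and m :: nat and \<delta> :: real
    and M :: "'w measure" and X :: "nat \<Rightarrow> 'w \<Rightarrow> 'e" +
  fixes H :: "('e \<Rightarrow> 'e \<Rightarrow> real) set" and f :: "'e \<Rightarrow> real" and \<phi> :: "real \<Rightarrow> real \<Rightarrow> real"
  assumes H_meas: "\<And>g. g \<in> H \<Longrightarrow> (\<lambda>(x, y). g x y) \<in> borel_measurable (S \<Otimes>\<^sub>M S)"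
    and f_meas: "f \<in> borel_measurable S"
    and phi_meas: "(\<lambda>(u, v). \<phi> u v) \<in> borel_measurable (borel \<Otimes>\<^sub>M borel)"
    and phi_range: "\<And>u v. \<phi> u v \<in> {0..1}"
begin

abbreviation l :: "('e \<Rightarrow> 'e \<Rightarrow> real) \<Rightarrow> 'e \<Rightarrow> 'e \<Rightarrow> real" where "l \<equiv> loss \<phi> f"

lemma l_range: "0 \<le> l g x y" "l g x y \<le> 1"
  using phi_range by (auto simp: loss_def)

lemma l_measurable_param:
  assumes g: "(\<lambda>(\<omega>, x, y). g \<omega> x y) \<in> borel_measurable (L \<Otimes>\<^sub>M (S \<Otimes>\<^sub>M S))"
  shows "(\<lambda>(\<omega>, x, y). l (g \<omega>) x y) \<in> borel_measurable (L \<Otimes>\<^sub>M (S \<Otimes>\<^sub>M S))"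
proof -
  note [measurable] = f_meas
  have "(\<lambda>z. (f (fst (snd z)) - f (snd (snd z)), (\<lambda>(\<omega>, x, y). g \<omega> x y) z)) \<in> L \<Otimes>\<^sub>M (S \<Otimes>\<^sub>M S) \<rightarrow>\<^sub>M borel \<Otimes>\<^sub>M borel"
    by (intro measurable_Pair g) measurable
  from measurable_compose[OF this phi_meas] show ?thesis by (simp add: loss_def split_beta')
qed

lemma l_measurable: "g \<in> H \<Longrightarrow> (\<lambda>(x, y). l g x y) \<in> borel_measurable (S \<Otimes>\<^sub>M S)"
proof -
  assume "g \<in> H"
  note [measurable] = f_meas
  have "(\<lambda>z. (f (fst z) - f (snd z), (\<lambda>(x, y). g x y) z)) \<in> S \<Otimes>\<^sub>M S \<rightarrow>\<^sub>M borel \<Otimes>\<^sub>M borel"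
    by (intro measurable_Pair H_meas \<open>g \<in> H\<close>) measurable
  from measurable_compose[OF this phi_meas] show ?thesis by (simp add: loss_def split_beta')
qed

lemma l_section: "g \<in> H \<Longrightarrow> x \<in> space S \<Longrightarrow> l g x \<in> borel_measurable S"
  using measurable_compose[OF measurable_Pair1' l_measurable] by simp

lemma l_section': "g \<in> H \<Longrightarrow> y \<in> space S \<Longrightarrow> (\<lambda>x. l g x y) \<in> borel_measurable S"
  using measurable_compose[OF measurable_Pair2' l_measurable] by simp

text \<open>The paired risk puts the fresh observation X_t in the first slot and the past X_i in the
  second; integrating out the first leaves a function of X_i.\<close>

definition proj :: "('e \<Rightarrow> 'e \<Rightarrow> real) \<Rightarrow> 'e \<Rightarrow> real" where
  "proj g y = (\<integral>x. l g x y \<partial>\<pi>)"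

lemma proj_measurable: "g \<in> H \<Longrightarrow> proj g \<in> borel_measurable S"
proof -
  assume g: "g \<in> H"
  have "(\<lambda>(y, x). l g x y) \<in> borel_measurable (S \<Otimes>\<^sub>M S)"
    using measurable_compose[OF measurable_pair_swap' l_measurable[OF g]] by (simp add: split_beta')
  from integral_pi_measurable_param[OF this] show ?thesis by (simp add: proj_def[abs_def])
qed

lemma proj_range: "g \<in> H \<Longrightarrow> y \<in> space S \<Longrightarrow> 0 \<le> proj g y \<and> proj g y \<le> 1"
  unfolding proj_def using pi_bounds(2,3)[OF l_section', where a=0 and b=1] l_range by simp

text \<open>Fubini in both orders: the paired risk needs the inner integral over the first variable,
  the U-statistic the one over the second.\<close>

lemma risk_integrals:
  assumes g: "g \<in> H"
  shows "risk l \<pi> g = (\<integral>y. proj g y \<partial>\<pi>)" "risk l \<pi> g = (\<integral>x. \<integral>y. l g x y \<partial>\<pi> \<partial>\<pi>)"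
    "0 \<le> risk l \<pi> g" "risk l \<pi> g \<le> 1"
proof -
  interpret pp: pair_prob_space \<pi> \<pi> using pi_prob by (simp add: pair_prob_space_def pair_sigma_finite_def prob_space_imp_sigma_finite)
  have "sets (\<pi> \<Otimes>\<^sub>M \<pi>) = sets (S \<Otimes>\<^sub>M S)" using sets_pi by (intro sets_pair_measure_cong)
  then have mm: "(\<lambda>(x, y). l g x y) \<in> borel_measurable (\<pi> \<Otimes>\<^sub>M \<pi>)"
    by (subst measurable_cong_sets[OF _ refl]) (use l_measurable[OF g] in auto)
  have ps: "prob_space (\<pi> \<Otimes>\<^sub>M \<pi>)" by unfold_locales
  note b = prob_integral_bounds[OF ps mm, where a=0 and b=1]
  have i: "integrable (\<pi> \<Otimes>\<^sub>M \<pi>) (\<lambda>(x, y). l g x y)" using b(1) l_range by (auto simp: split_beta')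
  show "risk l \<pi> g = (\<integral>y. proj g y \<partial>\<pi>)"
    unfolding risk_def proj_def using pp.integral_snd[OF i] by simp
  show "risk l \<pi> g = (\<integral>x. \<integral>y. l g x y \<partial>\<pi> \<partial>\<pi>)"
    unfolding risk_def using pp.integral_fst[OF i] by simp
  show "0 \<le> risk l \<pi> g" "risk l \<pi> g \<le> 1"
    unfolding risk_def using b(2,3) l_range by (auto simp: split_beta')
qed

lemma
  assumes g: "g \<in> H" "g' \<in> H" and d: "\<And>x y. x \<in> space S \<Longrightarrow> y \<in> space S \<Longrightarrow> \<bar>l g x y - l g' x y\<bar> \<le> e"
  shows proj_diff_le: "y \<in> space S \<Longrightarrow> \<bar>proj g y - proj g' y\<bar> \<le> e"
    and risk_diff_le: "\<bar>risk l \<pi> g - risk l \<pi> g'\<bar> \<le> e"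
proof -
  have i: "integrable \<pi> (\<lambda>x. l k x y)" if "k \<in> H" "y \<in> space S" for k y
    using pi_bounds(1)[OF l_section'[OF that], where a=0 and b=1] l_range by simp
  show *: "y \<in> space S \<Longrightarrow> \<bar>proj g y - proj g' y\<bar> \<le> e" for y
    unfolding proj_def using i g d space_pi by (intro prob_integral_diff_le pi_prob) auto
  have "integrable \<pi> (proj k)" if "k \<in> H" for k
    using pi_bounds(1)[OF proj_measurable[OF that] proj_range[OF that]] .
  then show "\<bar>risk l \<pi> g - risk l \<pi> g'\<bar> \<le> e"
    unfolding risk_integrals(1)[OF g(1)] risk_integrals(1)[OF g(2)]
    using * g space_pi by (intro prob_integral_diff_le pi_prob) auto
qed

text \<open>A hypothesis computed from X_1, ..., X_T may be inserted only into a bound that holds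
  for all of H at once. Replacing g by a net point costs e in the risk and e in the projection,
  hence 2e per summand.\<close>

lemma uniform_deviation:
  assumes G: "finite G" "G \<subseteq> H" and T: "T > 0" and z: "z > 0"
    and cover: "\<And>g. g \<in> H \<Longrightarrow> \<exists>g'\<in>G. \<forall>x\<in>space S. \<forall>y\<in>space S. \<bar>l g x y - l g' x y\<bar> \<le> e"
  shows "holds_except M (real (card G) * exp (- z\<^sup>2 / (2 * real T * K\<^sup>2)))
    (\<lambda>\<omega>. \<forall>g\<in>H. (\<Sum>i=1..T. risk l \<pi> g - proj g (X i \<omega>)) < z + 3 * K + real T * (2 * e))"
proof -
  have "holds_except M (\<Sum>g\<in>G. exp (- z\<^sup>2 / (2 * real T * K\<^sup>2)))
    (\<lambda>\<omega>. \<forall>g\<in>G. (\<Sum>i=1..T. risk l \<pi> g - proj g (X i \<omega>)) < z + 3 * K)"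
  proof (rule holds_except_ball[OF M_finite G(1)])
    fix g assume "g \<in> G"
    then have g: "g \<in> H" using G by auto
    have "holds_except M (exp (- z\<^sup>2 / (2 * real T * K\<^sup>2)))
      (\<lambda>\<omega>. (\<Sum>i=1..T. - proj g (X i \<omega>) - (\<integral>y. - proj g y \<partial>\<pi>)) < z + 3 * K)"
      using proj_measurable[OF g] proj_range[OF g] by (intro ergodic_mean T z) (auto simp: abs_le_iff intro: order.trans[of _ 0])
    then show "holds_except M (exp (- z\<^sup>2 / (2 * real T * K\<^sup>2)))
      (\<lambda>\<omega>. (\<Sum>i=1..T. risk l \<pi> g - proj g (X i \<omega>)) < z + 3 * K)"
      by (simp add: risk_integrals(1)[OF g])
  qed
  then show ?thesis
  proof (rule holds_except_mono)
    fix \<omega> assume w: "\<omega> \<in> space M"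
      and *: "\<forall>g\<in>G. (\<Sum>i=1..T. risk l \<pi> g - proj g (X i \<omega>)) < z + 3 * K"
    show "\<forall>g\<in>H. (\<Sum>i=1..T. risk l \<pi> g - proj g (X i \<omega>)) < z + 3 * K + real T * (2 * e)"
    proof
      fix g assume g: "g \<in> H"
      then obtain g' where g': "g' \<in> G" and d: "\<And>x y. x \<in> space S \<Longrightarrow> y \<in> space S \<Longrightarrow> \<bar>l g x y - l g' x y\<bar> \<le> e"
        using cover by meson
      then have g'H: "g' \<in> H" using G by auto
      have "(\<Sum>i=1..T. risk l \<pi> g - proj g (X i \<omega>)) \<le> (\<Sum>i=1..T. risk l \<pi> g' - proj g' (X i \<omega>) + 2 * e)"
      proof (rule sum_mono)
        fix i assume "i \<in> {1..T}"
        then have "X i \<omega> \<in> space S" using w by (intro X_in) auto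
        then show "risk l \<pi> g - proj g (X i \<omega>) \<le> risk l \<pi> g' - proj g' (X i \<omega>) + 2 * e"
          using proj_diff_le[OF g g'H d] risk_diff_le[OF g g'H d] by (smt (verit))
      qed
      also have "\<dots> = (\<Sum>i=1..T. risk l \<pi> g' - proj g' (X i \<omega>)) + real T * (2 * e)"
        by (simp add: sum.distrib)
      finally show "(\<Sum>i=1..T. risk l \<pi> g - proj g (X i \<omega>)) < z + 3 * K + real T * (2 * e)"
        using * g' by force
    qed
  qed simp
qed

context
  fixes h :: "nat \<Rightarrow> 'w \<Rightarrow> 'e \<Rightarrow> 'e \<Rightarrow> real" and n :: nat
  assumes alg: "online_algorithm M S X H n h"
begin

lemma h_in: "t \<le> n \<Longrightarrow> \<omega> \<in> space M \<Longrightarrow> h t \<omega> \<in> H"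
  using alg by (simp add: online_algorithm_def)

lemma l_h_measurable:
  "t \<le> n \<Longrightarrow> (\<lambda>(\<omega>, x, y). l (h t \<omega>) x y) \<in> borel_measurable (F t \<Otimes>\<^sub>M (S \<Otimes>\<^sub>M S))"
  using alg by (intro l_measurable_param) (simp add: online_algorithm_def)

text \<open>Error budget in units of \<epsilon>/16: 1 for the deviation of the means, 1 for their
  correction 3K, 2 for the net, 1 for the bias \<kappa> and 1 for the gap martingale; together 3/8
  of \<epsilon>.\<close>

lemma sum_risk_less_paired_risk:
  assumes b: "1 \<le> b" "b < c" "c < n" "b \<le> n - c" and \<epsilon>: "\<epsilon> > 0"
    and B: "B \<in> sets S" "measure \<pi> B = 0"
    and rate: "\<And>x A. x \<in> space S - B \<Longrightarrow> A \<in> sets S \<Longrightarrow>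
        \<bar>measure (kernel_pow S P b x) A - measure \<pi> A\<bar> \<le> \<kappa>" and \<kappa>: "\<kappa> \<le> \<epsilon> / 16"
    and large: "48 * K \<le> real (c - b) * \<epsilon>"
    and G: "finite G" "G \<subseteq> H"
    and cover: "\<And>g. g \<in> H \<Longrightarrow> \<exists>g'\<in>G. \<forall>x\<in>space S. \<forall>y\<in>space S. \<bar>l g x y - l g' x y\<bar> \<le> \<epsilon> / 16"
  shows "holds_except M
    (real (n - c) * (real (card G) * exp (- (real (c - b) * \<epsilon>\<^sup>2 / (512 * K\<^sup>2))))
      + (real b * exp (- (real (n - c) * \<epsilon>\<^sup>2 / (1024 * real b))) + real (n - c) * \<theta> (c - b - 1)))
    (\<lambda>\<omega>. (\<Sum>t=c..<n. risk l \<pi> (h (t - b) \<omega>))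
       < (\<Sum>t=c..<n. paired_risk l b (\<lambda>i. X i \<omega>) (\<lambda>t. h t \<omega>) t) + real (n - c) * (3 / 8 * \<epsilon>))"
proof -
  let ?N = "n - c"
  \<comment> \<open>The paired risk as a function of the fresh observation; everything else in it is
    known at time t - b.\<close>
  define \<psi> where "\<psi> = (\<lambda>t \<omega> y. (\<Sum>i=1..t - b. l (h (t - b) \<omega>) y (X i \<omega>)) / real (t - b))"
  have cN: "c + ?N = n" using b by simp
  have N0: "?N > 0" using b by simp
  have \<psi>_m: "(\<lambda>(\<omega>, y). \<psi> t \<omega> y) \<in> borel_measurable (F (t - b) \<Otimes>\<^sub>M S)" if t: "c \<le> t" "t < n" for t
  proof -
    have "(\<lambda>z. l (h (t - b) (fst z)) (snd z) (X i (fst z))) \<in> borel_measurable (F (t - b) \<Otimes>\<^sub>M S)"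
      if i: "i \<in> {1..t - b}" for i
    proof -
      have X: "X i \<in> F (t - b) \<rightarrow>\<^sub>M S" using i by (intro X_F) auto
      have "(\<lambda>z. (fst z, snd z, X i (fst z))) \<in> F (t - b) \<Otimes>\<^sub>M S \<rightarrow>\<^sub>M F (t - b) \<Otimes>\<^sub>M (S \<Otimes>\<^sub>M S)"
        by (intro measurable_Pair measurable_fst measurable_snd measurable_compose[OF measurable_fst X])
      from measurable_compose[OF this l_h_measurable] show ?thesis using t by (simp add: split_beta')
    qed
    then show ?thesis unfolding \<psi>_def split_beta' by (intro borel_measurable_divide borel_measurable_sum borel_measurable_const)
  qed
  have \<psi>_range: "0 \<le> \<psi> t \<omega> y \<and> \<psi> t \<omega> y \<le> 1" for t \<omega> y
  proof -
    have "(\<Sum>i=1..t - b. l (h (t - b) \<omega>) y (X i \<omega>)) \<le> (\<Sum>i=1..t - b. 1)" by (intro sum_mono l_range)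
    then show ?thesis unfolding \<psi>_def by (auto intro!: divide_nonneg_nonneg sum_nonneg l_range simp: divide_le_eq_1)
  qed
  have \<psi>_sec: "\<psi> t \<omega> \<in> borel_measurable S" if "c \<le> t" "t < n" "\<omega> \<in> space M" for t \<omega>
    using measurable_compose[OF measurable_Pair1' \<psi>_m] that by (simp add: process_sigma_def)
  have paired: "paired_risk l b (\<lambda>i. X i \<omega>) (\<lambda>t. h t \<omega>) t = \<psi> t \<omega> (X t \<omega>)" for t \<omega>
    by (simp add: paired_risk_def \<psi>_def)
  have H1: "holds_except M (\<Sum>t\<in>{c..<n}. real (card G) * exp (- (real (c - b) * \<epsilon>\<^sup>2 / (512 * K\<^sup>2))))
    (\<lambda>\<omega>. \<forall>t\<in>{c..<n}. (\<Sum>i=1..t - b. risk l \<pi> (h (t - b) \<omega>) - proj (h (t - b) \<omega>) (X i \<omega>)) \<le> real (t - b) * (\<epsilon> / 4))"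
  proof (rule holds_except_ball[OF M_finite])
    fix t assume t: "t \<in> {c..<n}"
    let ?T = "t - b"
    have T: "?T > 0" "real (c - b) \<le> real ?T" using t b by auto
    show "holds_except M (real (card G) * exp (- (real (c - b) * \<epsilon>\<^sup>2 / (512 * K\<^sup>2))))
      (\<lambda>\<omega>. (\<Sum>i=1..?T. risk l \<pi> (h ?T \<omega>) - proj (h ?T \<omega>) (X i \<omega>)) \<le> real ?T * (\<epsilon> / 4))"
    proof (rule holds_except_mono[OF uniform_deviation[OF G T(1) _ cover, of "real ?T * \<epsilon> / 16"]])
      show "real ?T * \<epsilon> / 16 > 0" using T \<epsilon> by simp
      have "real (c - b) * \<epsilon>\<^sup>2 / (512 * K\<^sup>2) \<le> real ?T * \<epsilon>\<^sup>2 / (512 * K\<^sup>2)"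
        using T by (intro divide_right_mono mult_right_mono) auto
      also have "\<dots> = (real ?T * \<epsilon> / 16)\<^sup>2 / (2 * real ?T * K\<^sup>2)"
        using T K_pos by (simp add: power2_eq_square field_simps)
      finally show "real (card G) * exp (- (real ?T * \<epsilon> / 16)\<^sup>2 / (2 * real ?T * K\<^sup>2))
          \<le> real (card G) * exp (- (real (c - b) * \<epsilon>\<^sup>2 / (512 * K\<^sup>2)))"
        by (intro mult_left_mono) auto
      fix \<omega> assume w: "\<omega> \<in> space M"
        and *: "\<forall>g\<in>H. (\<Sum>i=1..?T. risk l \<pi> g - proj g (X i \<omega>)) < real ?T * \<epsilon> / 16 + 3 * K + real ?T * (2 * (\<epsilon> / 16))"
      have "real (c - b) * \<epsilon> \<le> real ?T * \<epsilon>" using T \<epsilon> by (intro mult_right_mono) auto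
      with large have "3 * K \<le> real ?T * \<epsilon> / 16" by simp
      moreover have "h ?T \<omega> \<in> H" using t w by (intro h_in) auto
      with * have "(\<Sum>i=1..?T. risk l \<pi> (h ?T \<omega>) - proj (h ?T \<omega>) (X i \<omega>))
          < real ?T * \<epsilon> / 16 + 3 * K + real ?T * (2 * (\<epsilon> / 16))" by blast
      moreover have "real ?T * (\<epsilon> / 4) = real ?T * \<epsilon> / 16 + real ?T * \<epsilon> / 16 + real ?T * (2 * (\<epsilon> / 16))"
        by (simp add: algebra_simps)
      ultimately show "(\<Sum>i=1..?T. risk l \<pi> (h ?T \<omega>) - proj (h ?T \<omega>) (X i \<omega>)) \<le> real ?T * (\<epsilon> / 4)"
        by linarith
    qed
  qed simp
  \<comment> \<open>Applied to -\<psi>, because P^b \<psi>_t(X_(t-b)) - \<psi>_t(X_t) has to be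
    bounded from above.\<close>
  have H2: "holds_except M (real b * exp (- (real ?N * (\<epsilon> / 16)\<^sup>2 / (4 * real b))))
    (\<lambda>\<omega>. (\<Sum>t=c..<c + ?N. - \<psi> t \<omega> (X t \<omega>) - Q b (\<lambda>y. - \<psi> t \<omega> y) (X (t - b) \<omega>)) < real ?N * (\<epsilon> / 16))"
  proof (rule gap_martingale)
    fix t assume t: "c \<le> t" "t < c + ?N"
    show "(\<lambda>(\<omega>, y). - \<psi> t \<omega> y) \<in> borel_measurable (F (t - b) \<Otimes>\<^sub>M S)"
      using borel_measurable_uminus[OF \<psi>_m[of t]] t cN by (simp add: split_beta')
    show "\<bar>- \<psi> t \<omega> y\<bar> \<le> 1" for \<omega> y using \<psi>_range[of t \<omega> y] by simp
  qed (use b \<epsilon> in auto)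
  \<comment> \<open>The mixing rate is invoked at the states X_(t-b), so it is these that must stay
    outside \<open>B\<close>.\<close>
  have H3: "holds_except M (\<Sum>t\<in>(\<lambda>t. t - b) ` {c..<n}. \<theta> (t - 1)) (\<lambda>\<omega>. \<forall>t\<in>(\<lambda>t. t - b) ` {c..<n}. X t \<omega> \<notin> B)"
    using b by (intro avoids_null_set B) auto
  from holds_except_conj[OF M_finite H1 holds_except_conj[OF M_finite H2 H3]]
  show ?thesis
  proof (rule holds_except_mono)
    have "(\<Sum>t\<in>(\<lambda>t. t - b) ` {c..<n}. \<theta> (t - 1)) \<le> (\<Sum>t\<in>{c..<n}. \<theta> (t - b - 1))"
      using theta_nonneg by (rule sum_image_le[OF finite_atLeastLessThan, of c n "\<lambda>t. \<theta> (t - 1)" "\<lambda>t. t - b", unfolded o_def]) 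
    also have "\<dots> \<le> (\<Sum>t\<in>{c..<n}. \<theta> (c - b - 1))" by (intro sum_mono theta_antimono) auto
    finally have "(\<Sum>t\<in>(\<lambda>t. t - b) ` {c..<n}. \<theta> (t - 1)) \<le> real ?N * \<theta> (c - b - 1)" by simp
    then show "(\<Sum>t\<in>{c..<n}. real (card G) * exp (- (real (c - b) * \<epsilon>\<^sup>2 / (512 * K\<^sup>2)))) +
        (real b * exp (- (real ?N * (\<epsilon> / 16)\<^sup>2 / (4 * real b))) + (\<Sum>t\<in>(\<lambda>t. t - b) ` {c..<n}. \<theta> (t - 1)))
      \<le> real ?N * (real (card G) * exp (- (real (c - b) * \<epsilon>\<^sup>2 / (512 * K\<^sup>2)))) +
        (real b * exp (- (real ?N * \<epsilon>\<^sup>2 / (1024 * real b))) + real ?N * \<theta> (c - b - 1))"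
      by (simp add: power_divide mult.commute)
  next
    fix \<omega> assume w: "\<omega> \<in> space M"
      and *: "(\<forall>t\<in>{c..<n}. (\<Sum>i=1..t - b. risk l \<pi> (h (t - b) \<omega>) - proj (h (t - b) \<omega>) (X i \<omega>)) \<le> real (t - b) * (\<epsilon> / 4)) \<and>
       (\<Sum>t=c..<c + ?N. - \<psi> t \<omega> (X t \<omega>) - Q b (\<lambda>y. - \<psi> t \<omega> y) (X (t - b) \<omega>)) < real ?N * (\<epsilon> / 16) \<and>
       (\<forall>t\<in>(\<lambda>t. t - b) ` {c..<n}. X t \<omega> \<notin> B)"
    have each: "risk l \<pi> (h (t - b) \<omega>) \<le> Q b (\<psi> t \<omega>) (X (t - b) \<omega>) + 5 / 16 * \<epsilon>" if t: "t \<in> {c..<n}" for t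
    proof -
      let ?T = "t - b" and ?h = "h (t - b) \<omega>"
      have T: "?T > 0" using t b by auto
      have hH: "?h \<in> H" using t w by (intro h_in) auto
      have Xi: "X i \<omega> \<in> space S" if "i \<ge> 1" for i using that w by (rule X_in)
      have int: "integrable \<pi> (\<lambda>y. l ?h y (X i \<omega>))" if "i \<in> {1..?T}" for i
        using pi_bounds(1)[OF l_section'[OF hH Xi], where a=0 and b=1] l_range that by simp
      have pi\<psi>: "(\<integral>y. \<psi> t \<omega> y \<partial>\<pi>) = (\<Sum>i=1..?T. proj ?h (X i \<omega>)) / real ?T"
        unfolding \<psi>_def proj_def using int by simp
      have "(\<Sum>i=1..?T. risk l \<pi> ?h - proj ?h (X i \<omega>)) \<le> real ?T * (\<epsilon> / 4)" using * t by blast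
      then have "real ?T * risk l \<pi> ?h \<le> (\<Sum>i=1..?T. proj ?h (X i \<omega>)) + real ?T * (\<epsilon> / 4)"
        by (simp add: sum_subtractf)
      then have "risk l \<pi> ?h \<le> (\<integral>y. \<psi> t \<omega> y \<partial>\<pi>) + \<epsilon> / 4"
        unfolding pi\<psi> using T by (simp add: field_simps)
      moreover have "(\<integral>y. \<psi> t \<omega> y \<partial>\<pi>) \<le> Q b (\<psi> t \<omega>) (X ?T \<omega>) + \<kappa>"
        unfolding Q_def
      proof (rule integral_diff_le_of_measure_diff_le[OF pi_prob])
        have XT: "X ?T \<omega> \<in> space S - B" using * t T Xi by auto
        then show "prob_space (kernel_pow S P b (X ?T \<omega>))" "sets \<pi> = sets (kernel_pow S P b (X ?T \<omega>))"
          using kernel_pow_prob(1,2) sets_pi by auto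
        show "A \<in> sets \<pi> \<Longrightarrow> measure \<pi> A \<le> measure (kernel_pow S P b (X ?T \<omega>)) A + \<kappa>" for A
          using rate[OF XT, of A] sets_pi by auto
        show "\<psi> t \<omega> \<in> borel_measurable \<pi>" using \<psi>_sec[of t \<omega>] t w by (simp add: pi_measurable_iff)
      qed (rule \<psi>_range)
      ultimately show ?thesis using \<kappa> by simp
    qed
    have "(\<Sum>t=c..<n. risk l \<pi> (h (t - b) \<omega>)) \<le> (\<Sum>t=c..<n. Q b (\<psi> t \<omega>) (X (t - b) \<omega>) + 5 / 16 * \<epsilon>)"
      by (intro sum_mono each)
    also have "\<dots> = (\<Sum>t=c..<n. - \<psi> t \<omega> (X t \<omega>) - Q b (\<lambda>y. - \<psi> t \<omega> y) (X (t - b) \<omega>))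
        + (\<Sum>t=c..<n. \<psi> t \<omega> (X t \<omega>)) + real ?N * (5 / 16 * \<epsilon>)"
      by (simp add: sum.distrib sum_subtractf sum_negf Q_def)
    also have "\<dots> < real ?N * (\<epsilon> / 16) + (\<Sum>t=c..<n. \<psi> t \<omega> (X t \<omega>)) + real ?N * (5 / 16 * \<epsilon>)"
      using *[THEN conjunct2, THEN conjunct1] unfolding cN by (intro add_strict_right_mono)
    finally show "(\<Sum>t=c..<n. risk l \<pi> (h (t - b) \<omega>))
       < (\<Sum>t=c..<n. paired_risk l b (\<lambda>i. X i \<omega>) (\<lambda>t. h t \<omega>) t) + real ?N * (3 / 8 * \<epsilon>)"
      unfolding paired by (simp add: algebra_simps)
  qed
qed

end

end

section \<open>The selection rule\<close>

lemma sum_pairs_shift: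
  fixes g :: "nat \<Rightarrow> nat \<Rightarrow> real"
  assumes "t < n"
  shows "(\<Sum>i=t + 1..n. \<Sum>k=i + 1..n. g i k) = (\<Sum>p<n - t. \<Sum>j=Suc p..<n - t. g (t + 1 + p) (t + 1 + j))"
proof -
  have inner: "(\<Sum>k=t + 1 + p + 1..n. g (t + 1 + p) k) = (\<Sum>j=Suc p..<n - t. g (t + 1 + p) (t + 1 + j))" for p
    by (rule sum.reindex_bij_witness[where i="\<lambda>j. t + 1 + j" and j="\<lambda>k. k - (t + 1)"]) auto
  have "(\<Sum>i=t + 1..n. \<Sum>k=i + 1..n. g i k) = (\<Sum>p<n - t. \<Sum>k=t + 1 + p + 1..n. g (t + 1 + p) k)"
    by (rule sum.reindex_bij_witness[where i="\<lambda>p. t + 1 + p" and j="\<lambda>i. i - (t + 1)"]) auto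
  then show ?thesis unfolding inner .
qed

lemma card_pairs: "(\<Sum>p<N. \<Sum>j=Suc p..<N. (r::real)) = real (N choose 2) * r"
proof -
  have "(\<Sum>p<N. \<Sum>j=Suc p..<N. r) = (\<Sum>j<N. real j) * r"
    unfolding sum_pairs_swap by (simp add: sum_distrib_right)
  also have "(\<Sum>j<N. real j) = real (N choose 2)"
  proof (induction N)
    case (Suc N)
    have "real (Suc N choose 2) = real (N choose 2) + real N" by (simp add: numeral_2_eq_2)
    then show ?case using Suc by simp
  qed simp
  finally show ?thesis .
qed

lemma selected_risk_le:
  fixes R :: "('e \<Rightarrow> 'e \<Rightarrow> real) \<Rightarrow> real" and hs :: "nat \<Rightarrow> 'e \<Rightarrow> 'e \<Rightarrow> real"
  assumes sel: "selects l C (64 * real (n - c + 1) * exp (- (real (n - c) * \<epsilon>\<^sup>2 * C / 128))) b c x hs n t0"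
    and n: "c + 2 \<le> n" and C: "C > 0" and \<epsilon>: "\<epsilon> > 0"
    and V: "V = ln (real (n - c)) / C + real (n - c) * \<epsilon>\<^sup>2 / 128"
    and dev: "\<And>t. c \<le> t \<Longrightarrow> t + 2 \<le> n \<Longrightarrow>
       \<bar>emp_risk l x n (hs (t - b)) (t + 1) - R (hs (t - b))\<bar> < sqrt (V / real (n - t))"
    and R: "\<And>t. t \<le> n \<Longrightarrow> 0 \<le> R (hs t) \<and> R (hs t) \<le> 1"
    and large: "10 \<le> real (n - c) * \<epsilon>" "ln (real (n - c)) / C \<le> real (n - c) * \<epsilon>\<^sup>2 / 500"
  shows "real (n - c) * R (hs (t0 - b)) \<le> (\<Sum>t=c..<n. R (hs (t - b))) + real (n - c) * (\<epsilon> / 2)"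
proof -
  let ?N = "n - c" and ?\<gamma> = "64 * real (n - c + 1) * exp (- (real (n - c) * \<epsilon>\<^sup>2 * C / 128))"
  have N: "real ?N \<ge> 2" using n by simp
  have V0: "V \<ge> 0" unfolding V using C N by (intro add_nonneg_nonneg) auto
  have pen: "penalty C n c ?\<gamma> (real (n - t)) = sqrt (V / real (n - t))" for t
  proof -
    have "64 * real ?N * real (?N + 1) / ?\<gamma> = real ?N * exp (real ?N * \<epsilon>\<^sup>2 * C / 128)"
      by (simp add: exp_minus field_simps)
    then have "ln (64 * real ?N * real (?N + 1) / ?\<gamma>) = ln (real ?N) + real ?N * \<epsilon>\<^sup>2 * C / 128"
      using N by (simp add: ln_mult)
    also have "inverse C / real (n - t) * \<dots> = V / real (n - t)"
      unfolding V using C by (simp add: field_simps)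
    finally show ?thesis by (simp add: penalty_def)
  qed
  have t0: "c \<le> t0" "t0 + 2 \<le> n" using sel by (auto simp: selects_def is_arg_min_def)
  have le: "R (hs (t0 - b)) \<le> R (hs (t - b)) + 2 * sqrt V * (1 / sqrt (real (n - t)))" if t: "c \<le> t" "t + 2 \<le> n" for t
  proof -
    have "emp_risk l x n (hs (t0 - b)) (t0 + 1) + sqrt (V / real (n - t0))
        \<le> emp_risk l x n (hs (t - b)) (t + 1) + sqrt (V / real (n - t))"
      using sel t unfolding selects_def is_arg_min_def pen by force
    with dev[OF t] dev[OF t0] have "R (hs (t0 - b)) \<le> R (hs (t - b)) + 2 * sqrt (V / real (n - t))" by linarith
    then show ?thesis by (simp add: real_sqrt_divide)
  qed
  \<comment> \<open>The index t = n - 1 leaves no pair of later observations, so the rule compares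
    only N - 1 values of t.\<close>
  have "(\<Sum>t=c..<n - 1. 1 / sqrt (real (n - t))) \<le> (\<Sum>t=c..<n. 1 / sqrt (real (n - t)))"
    by (intro sum_mono2) auto
  also have "\<dots> = (\<Sum>k=1..?N. 1 / sqrt (real k))"
    by (rule sum.reindex_bij_witness[where i="\<lambda>k. n - k" and j="\<lambda>t. n - t"]) (use n in auto)
  also have "\<dots> \<le> 2 * sqrt (real ?N)" by (rule sum_inverse_sqrt_le)
  finally have s1: "2 * sqrt V * (\<Sum>t=c..<n - 1. 1 / sqrt (real (n - t))) \<le> 2 * sqrt V * (2 * sqrt (real ?N))"
    using V0 by (intro mult_left_mono) auto
  have s2: "(\<Sum>t=c..<n - 1. R (hs (t - b))) \<le> (\<Sum>t=c..<n. R (hs (t - b)))"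
    using R by (intro sum_mono2) auto
  have "real (?N - 1) * R (hs (t0 - b)) = (\<Sum>t=c..<n - 1. R (hs (t0 - b)))" using n by simp
  also have "\<dots> \<le> (\<Sum>t=c..<n - 1. R (hs (t - b)) + 2 * sqrt V * (1 / sqrt (real (n - t))))"
    by (intro sum_mono le) auto
  also have "\<dots> = (\<Sum>t=c..<n - 1. R (hs (t - b))) + 2 * sqrt V * (\<Sum>t=c..<n - 1. 1 / sqrt (real (n - t)))"
    by (simp add: sum.distrib sum_distrib_left)
  finally have "real (?N - 1) * R (hs (t0 - b)) \<le> (\<Sum>t=c..<n. R (hs (t - b))) + 4 * (sqrt V * sqrt (real ?N))"
    using s1 s2 by linarith
  \<comment> \<open>Here 1/500 + 1/128 < 1/100.\<close>
  moreover have "sqrt V * sqrt (real ?N) \<le> real ?N * \<epsilon> / 10"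
  proof -
    have "0 \<le> real ?N * \<epsilon>\<^sup>2" by simp
    then have "V \<le> real ?N * \<epsilon>\<^sup>2 / 100" using large(2) unfolding V by linarith
    then have "V * real ?N \<le> real ?N * \<epsilon>\<^sup>2 / 100 * real ?N" by (rule mult_right_mono) simp
    also have "\<dots> = (real ?N * \<epsilon> / 10)\<^sup>2" by (simp add: power2_eq_square)
    finally show ?thesis unfolding real_sqrt_mult[symmetric] using \<epsilon> by (intro real_le_lsqrt) auto
  qed
  \<comment> \<open>The missing summand is at most 1 \<le> N \<epsilon> / 10; with the 4 N
    \<epsilon> / 10 of the penalties this makes N \<epsilon> / 2.\<close>
  moreover have "real ?N * R (hs (t0 - b)) \<le> real (?N - 1) * R (hs (t0 - b)) + 1"
    using R[of "t0 - b"] t0 n by (simp add: of_nat_diff algebra_simps)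
  ultimately show ?thesis using large(1) by linarith
qed

context online_learning
begin

context
  fixes h :: "nat \<Rightarrow> 'w \<Rightarrow> 'e \<Rightarrow> 'e \<Rightarrow> real" and n :: nat
  assumes alg: "online_algorithm M S X H n h"
begin

text \<open>With N = n - t points and y = sqrt (V / N), the double sum is allowed to deviate by y
  N^2 / 8; Azuma's exponent is then y^2 N / (128 K^2) = V / (128 K^2), independent of t.\<close>

lemma emp_risk_deviation:
  assumes t: "t + 2 \<le> n" and s: "s \<le> t" and V: "V > 0" "2304 * K\<^sup>2 \<le> V"
  shows "holds_except M (2 * exp (- (V / (128 * K\<^sup>2))))
    (\<lambda>\<omega>. \<bar>emp_risk l (\<lambda>i. X i \<omega>) n (h s \<omega>) (t + 1) - risk l \<pi> (h s \<omega>)\<bar> < sqrt (V / real (n - t)))"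
proof -
  define N where "N = n - t"
  define y where "y = sqrt (V / real N)"
  have N: "real N \<ge> 2" "N > 0" using t by (auto simp: N_def)
  have y: "y > 0" using V N by (simp add: y_def)
  have y2: "y\<^sup>2 = V / real N" using V N by (simp add: y_def)
  \<comment> \<open>As 2304 = 48^2, one has 48 K \<le> y N, and the correction 6NK fits into a
    second y N^2 / 8.\<close>
  have Kle: "6 * real N * K \<le> y * (real N)\<^sup>2 / 8"
  proof -
    have "(48 * K)\<^sup>2 \<le> V" using V by (simp add: power_mult_distrib)
    also have "\<dots> \<le> V * real N" using V N mult_left_mono[of 1 "real N" V] by simp
    also have "V * real N = V / real N * (real N)\<^sup>2" using N by (simp add: power2_eq_square)
    also have "\<dots> = (y * real N)\<^sup>2" by (simp only: power_mult_distrib y2)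
    finally have "48 * K \<le> y * real N" by (rule power2_le_imp_le) (use y in simp)
    then have "48 * K * real N \<le> y * real N * real N" using N by (intro mult_right_mono) auto
    then show ?thesis by (simp add: power2_eq_square mult_ac)
  qed
  \<comment> \<open>Both eighths together are y N^2 / 4, which is at most y times the number of
    pairs because N \<ge> 2.\<close>
  have ch: "(real N)\<^sup>2 / 4 \<le> real (N choose 2)"
  proof -
    have "real N * 2 \<le> real N * real N" using N by (intro mult_left_mono) auto
    then show ?thesis by (simp add: real_choose_2 power2_eq_square algebra_simps)
  qed
  have ch0: "real (N choose 2) > 0" using ch N by (smt (verit) zero_less_power divide_pos_pos)
  have ps: "- (y * (real N)\<^sup>2 / 8)\<^sup>2 / (2 * real N * (real N * K)\<^sup>2) = - (V / (128 * K\<^sup>2))"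
  proof -
    have "(y * (real N)\<^sup>2 / 8)\<^sup>2 = V / real N * ((real N)\<^sup>2)\<^sup>2 / 64"
      by (simp add: power_mult_distrib power_divide y2)
    then show ?thesis using N K_pos by (simp add: field_simps power2_eq_square)
  qed
  \<comment> \<open>The sign \<sigma> yields both tails from the one-sided bound.\<close>
  have side: "holds_except M (exp (- (V / (128 * K\<^sup>2))))
    (\<lambda>\<omega>. \<sigma> * (emp_risk l (\<lambda>i. X i \<omega>) n (h s \<omega>) (t + 1) - risk l \<pi> (h s \<omega>)) < y)" if \<sigma>: "\<bar>\<sigma>\<bar> = 1" for \<sigma> :: real
  proof (rule holds_except_mono[OF ustat[where a="\<lambda>\<omega> x y. \<sigma> * l (h s \<omega>) x y" and t=t and N=N and z="y * (real N)\<^sup>2 / 8"]])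
    show "(\<lambda>(\<omega>, x, y). \<sigma> * l (h s \<omega>) x y) \<in> borel_measurable (F t \<Otimes>\<^sub>M (S \<Otimes>\<^sub>M S))"
      using borel_measurable_times[OF borel_measurable_const measurable_F_mono[OF l_h_measurable[OF alg, of s] s], of \<sigma>] s t
      by (simp add: split_beta')
    show "\<bar>\<sigma> * l (h s \<omega>) x y\<bar> \<le> 1" for \<omega> x y using \<sigma> l_range[of "h s \<omega>" x y] by (simp add: abs_mult)
    show "exp (- (y * (real N)\<^sup>2 / 8)\<^sup>2 / (2 * real N * (real N * K)\<^sup>2)) \<le> exp (- (V / (128 * K\<^sup>2)))"
      by (simp only: ps order.refl)
    fix \<omega> assume w: "\<omega> \<in> space M"
      and *: "(\<Sum>p<N. \<Sum>j=Suc p..<N. \<sigma> * l (h s \<omega>) (X (t + 1 + p) \<omega>) (X (t + 1 + j) \<omega>)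
          - (\<integral>x. \<integral>y. \<sigma> * l (h s \<omega>) x y \<partial>\<pi> \<partial>\<pi>)) < y * (real N)\<^sup>2 / 8 + 6 * real N * K"
    let ?R = "risk l \<pi> (h s \<omega>)"
    let ?E = "\<Sum>p<N. \<Sum>j=Suc p..<N. l (h s \<omega>) (X (t + 1 + p) \<omega>) (X (t + 1 + j) \<omega>)"
    have "h s \<omega> \<in> H" using s t w by (intro h_in[OF alg]) auto
    then have R: "(\<integral>x. \<integral>y. \<sigma> * l (h s \<omega>) x y \<partial>\<pi> \<partial>\<pi>) = \<sigma> * ?R"
      by (simp add: risk_integrals(2))
    have "\<sigma> * (?E - real (N choose 2) * ?R) < y * (real N)\<^sup>2 / 4"
    proof -
      have "\<sigma> * (?E - real (N choose 2) * ?R) = (\<Sum>p<N. \<Sum>j=Suc p..<N. \<sigma> * l (h s \<omega>) (X (t + 1 + p) \<omega>) (X (t + 1 + j) \<omega>) - \<sigma> * ?R)"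
        unfolding card_pairs[symmetric] sum_subtractf[symmetric] sum_distrib_left by (simp only: right_diff_distrib)
      then show ?thesis using * Kle unfolding R by simp
    qed
    also have "\<dots> \<le> y * real (N choose 2)" using mult_left_mono[OF ch, of y] y by simp
    finally have "\<sigma> * (?E - real (N choose 2) * ?R) < y * real (N choose 2)" .
    moreover have "emp_risk l (\<lambda>i. X i \<omega>) n (h s \<omega>) (t + 1) = ?E / real (N choose 2)"
      unfolding emp_risk_def using sum_pairs_shift[of t n "\<lambda>i k. l (h s \<omega>) (X i \<omega>) (X k \<omega>)"] t by (simp add: N_def)
    moreover have "\<sigma> * (?E / real (N choose 2) - ?R) = \<sigma> * (?E - real (N choose 2) * ?R) / real (N choose 2)"
      using ch0 by (simp add: field_simps)
    ultimately show "\<sigma> * (emp_risk l (\<lambda>i. X i \<omega>) n (h s \<omega>) (t + 1) - ?R) < y"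
      using ch0 by (simp add: divide_less_eq)
  qed (use N y in auto)
  have "holds_except M (exp (- (V / (128 * K\<^sup>2))) + exp (- (V / (128 * K\<^sup>2))))
    (\<lambda>\<omega>. 1 * (emp_risk l (\<lambda>i. X i \<omega>) n (h s \<omega>) (t + 1) - risk l \<pi> (h s \<omega>)) < y \<and>
         - 1 * (emp_risk l (\<lambda>i. X i \<omega>) n (h s \<omega>) (t + 1) - risk l \<pi> (h s \<omega>)) < y)"
    by (intro holds_except_conj[OF M_finite] side) auto
  then show ?thesis
    by (rule holds_except_mono) (auto simp: y_def N_def)
qed

text \<open>Outside the exceptional sets, 3/8 \<epsilon> is lost between average risk and paired
  risk and 1/2 \<epsilon> in the selection, together less than \<epsilon>.\<close>

lemma selected_hypothesis_bound:
  assumes b: "1 \<le> b" "b < c" "c + 2 \<le> n" "b \<le> n - c" and \<epsilon>: "\<epsilon> > 0" and C: "C > 0"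
    and B: "B \<in> sets S" "measure \<pi> B = 0"
    and rate: "\<And>x A. x \<in> space S - B \<Longrightarrow> A \<in> sets S \<Longrightarrow>
        \<bar>measure (kernel_pow S P b x) A - measure \<pi> A\<bar> \<le> \<kappa>" and \<kappa>: "\<kappa> \<le> \<epsilon> / 16"
    and large: "48 * K \<le> real (c - b) * \<epsilon>" "10 \<le> real (n - c) * \<epsilon>"
      "ln (real (n - c)) / C \<le> real (n - c) * \<epsilon>\<^sup>2 / 500" "2304 * K\<^sup>2 \<le> real (n - c) * \<epsilon>\<^sup>2 / 128"
    and G: "finite G" "G \<subseteq> H"
    and cover: "\<And>g. g \<in> H \<Longrightarrow> \<exists>g'\<in>G. \<forall>x\<in>space S. \<forall>y\<in>space S. \<bar>l g x y - l g' x y\<bar> \<le> \<epsilon> / 16"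
    and sel: "\<And>\<omega>. \<omega> \<in> space M \<Longrightarrow>
        selects l C (64 * real (n - c + 1) * exp (- (real (n - c) * \<epsilon>\<^sup>2 * C / 128))) b c (\<lambda>i. X i \<omega>) (\<lambda>t. h t \<omega>) n (t_hat \<omega>)"
  shows "emeasure M {\<omega> \<in> space M. risk l \<pi> (h (t_hat \<omega> - b) \<omega>)
        \<ge> avg_paired_risk l b c (\<lambda>i. X i \<omega>) (\<lambda>t. h t \<omega>) n + \<epsilon>}
    \<le> ennreal (real (n - c) * (real (card G) * exp (- (real (c - b) * \<epsilon>\<^sup>2 / (512 * K\<^sup>2))))
      + (real b * exp (- (real (n - c) * \<epsilon>\<^sup>2 / (1024 * real b))) + real (n - c) * \<theta> (c - b - 1))
      + real (n - c) * (2 * exp (- (real (n - c) * \<epsilon>\<^sup>2 / (16384 * K\<^sup>2)))))"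
proof -
  let ?N = "n - c"
  define V where "V = ln (real ?N) / C + real ?N * \<epsilon>\<^sup>2 / 128"
  have N: "real ?N \<ge> 2" using b by simp
  have V: "real ?N * \<epsilon>\<^sup>2 / 128 \<le> V" unfolding V_def using C N by simp
  have V0: "V > 0" using N \<epsilon> V by (smt (verit) divide_pos_pos mult_pos_pos zero_less_power)
  have H1: "holds_except M (\<Sum>t\<in>{c..n - 2}. 2 * exp (- (V / (128 * K\<^sup>2))))
     (\<lambda>\<omega>. \<forall>t\<in>{c..n - 2}. \<bar>emp_risk l (\<lambda>i. X i \<omega>) n (h (t - b) \<omega>) (t + 1) - risk l \<pi> (h (t - b) \<omega>)\<bar> < sqrt (V / real (n - t)))"
    using b V V0 large(4) by (intro holds_except_ball[OF M_finite] emp_risk_deviation) auto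
  have "c < n" using b by simp
  note H2 = sum_risk_less_paired_risk[OF alg b(1,2) this b(4) \<epsilon> B rate \<kappa> large(1) G cover]
  from holds_except_conj[OF M_finite H2 H1]
  have H3: "holds_except M (real ?N * (real (card G) * exp (- (real (c - b) * \<epsilon>\<^sup>2 / (512 * K\<^sup>2))))
      + (real b * exp (- (real ?N * \<epsilon>\<^sup>2 / (1024 * real b))) + real ?N * \<theta> (c - b - 1))
      + real ?N * (2 * exp (- (real ?N * \<epsilon>\<^sup>2 / (16384 * K\<^sup>2)))))
    (\<lambda>\<omega>. risk l \<pi> (h (t_hat \<omega> - b) \<omega>) < avg_paired_risk l b c (\<lambda>i. X i \<omega>) (\<lambda>t. h t \<omega>) n + \<epsilon>)"
  proof (rule holds_except_mono)
    \<comment> \<open>The logarithmic part of V is dropped; 16384 = 128^2.\<close>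
    have "real ?N * \<epsilon>\<^sup>2 / (16384 * K\<^sup>2) = real ?N * \<epsilon>\<^sup>2 / 128 / (128 * K\<^sup>2)" by simp
    also have "\<dots> \<le> V / (128 * K\<^sup>2)" by (intro divide_right_mono V) simp
    finally have e: "exp (- (V / (128 * K\<^sup>2))) \<le> exp (- (real ?N * \<epsilon>\<^sup>2 / (16384 * K\<^sup>2)))" by simp
    have "(\<Sum>t\<in>{c..n - 2}. 2 * exp (- (V / (128 * K\<^sup>2)))) = real (n - 2 + 1 - c) * (2 * exp (- (V / (128 * K\<^sup>2))))" by simp
    also have "\<dots> \<le> real ?N * (2 * exp (- (real ?N * \<epsilon>\<^sup>2 / (16384 * K\<^sup>2))))"
      using e b by (intro mult_mono) auto
    finally show "real ?N * (real (card G) * exp (- (real (c - b) * \<epsilon>\<^sup>2 / (512 * K\<^sup>2))))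
      + (real b * exp (- (real ?N * \<epsilon>\<^sup>2 / (1024 * real b))) + real ?N * \<theta> (c - b - 1))
      + (\<Sum>t\<in>{c..n - 2}. 2 * exp (- (V / (128 * K\<^sup>2))))
      \<le> real ?N * (real (card G) * exp (- (real (c - b) * \<epsilon>\<^sup>2 / (512 * K\<^sup>2))))
      + (real b * exp (- (real ?N * \<epsilon>\<^sup>2 / (1024 * real b))) + real ?N * \<theta> (c - b - 1))
      + real ?N * (2 * exp (- (real ?N * \<epsilon>\<^sup>2 / (16384 * K\<^sup>2))))" by simp
  next
    fix \<omega> assume w: "\<omega> \<in> space M"
      and *: "(\<Sum>t=c..<n. risk l \<pi> (h (t - b) \<omega>))
         < (\<Sum>t=c..<n. paired_risk l b (\<lambda>i. X i \<omega>) (\<lambda>t. h t \<omega>) t) + real ?N * (3 / 8 * \<epsilon>) \<and>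
        (\<forall>t\<in>{c..n - 2}. \<bar>emp_risk l (\<lambda>i. X i \<omega>) n (h (t - b) \<omega>) (t + 1) - risk l \<pi> (h (t - b) \<omega>)\<bar> < sqrt (V / real (n - t)))"
    have "real ?N * risk l \<pi> (h (t_hat \<omega> - b) \<omega>) \<le> (\<Sum>t=c..<n. risk l \<pi> (h (t - b) \<omega>)) + real ?N * (\<epsilon> / 2)"
    proof (rule selected_risk_le[where R="risk l \<pi>", OF sel[OF w] b(3) C \<epsilon> V_def])
      show "0 \<le> risk l \<pi> (h t \<omega>) \<and> risk l \<pi> (h t \<omega>) \<le> 1" if "t \<le> n" for t
        using risk_integrals(3,4)[OF h_in[OF alg that w]] by simp
      show "\<bar>emp_risk l (\<lambda>i. X i \<omega>) n (h (t - b) \<omega>) (t + 1) - risk l \<pi> (h (t - b) \<omega>)\<bar> < sqrt (V / real (n - t))"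
        if "c \<le> t" "t + 2 \<le> n" for t
        using that by (intro *[THEN conjunct2, rule_format]) simp
    qed (rule large)+
    also have "\<dots> < (\<Sum>t=c..<n. paired_risk l b (\<lambda>i. X i \<omega>) (\<lambda>t. h t \<omega>) t) + real ?N * (3 / 8 * \<epsilon>) + real ?N * (\<epsilon> / 2)"
      using *[THEN conjunct1] by (rule add_strict_right_mono)
    also have "\<dots> \<le> (\<Sum>t=c..<n. paired_risk l b (\<lambda>i. X i \<omega>) (\<lambda>t. h t \<omega>) t) + real ?N * \<epsilon>"
      using N \<epsilon> by simp
    also have "\<dots> = real ?N * (avg_paired_risk l b c (\<lambda>i. X i \<omega>) (\<lambda>t. h t \<omega>) n + \<epsilon>)"
      using N by (simp add: avg_paired_risk_def field_simps)
    finally show "risk l \<pi> (h (t_hat \<omega> - b) \<omega>) < avg_paired_risk l b c (\<lambda>i. X i \<omega>) (\<lambda>t. h t \<omega>) n + \<epsilon>"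
      using N by (simp add: mult_less_cancel_left_pos)
  qed
  then show ?thesis by (rule holds_except_emeasure[OF M_finite]) auto
qed

end

end

section \<open>Comparison of the exponents for large n\<close>

lemma frac_leI:
  fixes a b c d :: real
  shows "0 < b \<Longrightarrow> 0 < d \<Longrightarrow> a * d \<le> c * b \<Longrightarrow> a / b \<le> c / d"
  by (simp add: pos_divide_le_eq le_divide_eq)

lemma (in doeblin_kernel) theta_le_exp: "\<theta> j \<le> exp (- (\<delta> * real (j div m)))"
proof -
  have "(1 - \<delta>) ^ (j div m) \<le> exp (- \<delta>) ^ (j div m)"
    using exp_ge_add_one_self[of "- \<delta>"] delta_le_1 by (intro power_mono) auto
  then show ?thesis by (simp add: \<theta>_def exp_of_nat_mult[symmetric] mult.commute)
qed

context online_learning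
begin

text \<open>Assumption \<open>big\<close> means D C > 512 b^2 ln n for D = (c - b) \<epsilon>^2. One
  of the two factors b already yields every smallness condition. Since E = D C / (256 b^2), the
  lower bounds \<open>blarge\<close> on b let all four error terms decay at least like exp (- E),
  constants of the chain included.\<close>

lemma selected_hypothesis_bound_large:
  fixes h :: "nat \<Rightarrow> 'w \<Rightarrow> 'e \<Rightarrow> 'e \<Rightarrow> real" and n b c :: nat and \<epsilon> C \<kappa> \<kappa>0 L0 :: real
  assumes alg: "online_algorithm M S X H n h"
    and b: "1 \<le> b" "b < c" "c + 2 \<le> n" "b \<le> n - c" and T: "4 * m \<le> c - b"
    and \<epsilon>: "0 < \<epsilon>" "\<epsilon> \<le> 1" and C: "C > 0"
    and \<kappa>0: "\<kappa>0 > 0" "\<kappa>0 / 2 * real n \<le> real (n - c)" and lnn: "1 \<le> ln (real n)"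
    and big: "2 * ln (real n) < (real c - real b) * C * \<epsilon>\<^sup>2 / (16 * real b)\<^sup>2"
    and blarge: "K * C \<le> real b" "L0 * C \<le> real b" "1152 * K\<^sup>2 * C \<le> \<kappa>0 * real b" "2 \<le> \<kappa>0 * real b"
      "8 * C \<le> \<kappa>0 * real b" "2 * K\<^sup>2 * C \<le> real b" "C * real m \<le> \<delta> * real b"
    and B: "B \<in> sets S" "measure \<pi> B = 0"
    and rate: "\<And>x A. x \<in> space S - B \<Longrightarrow> A \<in> sets S \<Longrightarrow>
        \<bar>measure (kernel_pow S P b x) A - measure \<pi> A\<bar> \<le> L0 / real n"
    and G: "finite G" "G \<subseteq> H"
    and cover: "\<And>g. g \<in> H \<Longrightarrow> \<exists>g'\<in>G. \<forall>x\<in>space S. \<forall>y\<in>space S. \<bar>l g x y - l g' x y\<bar> \<le> \<epsilon> / 16"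
    and sel: "\<And>\<omega>. \<omega> \<in> space M \<Longrightarrow>
        selects l C (64 * real (n - c + 1) * exp (- (real (n - c) * \<epsilon>\<^sup>2 * C / 128))) b c (\<lambda>i. X i \<omega>) (\<lambda>t. h t \<omega>) n (t_hat \<omega>)"
  shows "emeasure M {\<omega> \<in> space M. risk l \<pi> (h (t_hat \<omega> - b) \<omega>)
        \<ge> avg_paired_risk l b c (\<lambda>i. X i \<omega>) (\<lambda>t. h t \<omega>) n + \<epsilon>}
    \<le> ennreal (32 * (real (card G) + 1) *
        exp (- ((real c - real b) * C * \<epsilon>\<^sup>2 / (16 * real b)\<^sup>2) + 2 * ln (real n)))"
proof -
  define \<beta> where "\<beta> = real b"
  define T where "T = real (c - b)"
  define N where "N = real (n - c)"
  define D where "D = T * \<epsilon>\<^sup>2"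
  define E where "E = (real c - real b) * C * \<epsilon>\<^sup>2 / (16 * real b)\<^sup>2"
  have \<beta>: "\<beta> \<ge> 1" using b by (simp add: \<beta>_def)
  have \<beta>2: "\<beta> \<le> \<beta>\<^sup>2" using mult_left_mono[of 1 \<beta> \<beta>] \<beta> by (simp add: power2_eq_square)
  have T0: "T > 0" "T \<le> real n" using b by (auto simp: T_def)
  have n0: "real n > 0" using b by simp
  have N0: "N \<ge> 2" "N \<le> real n" using b by (auto simp: N_def)
  have \<epsilon>2: "0 < \<epsilon>\<^sup>2" "\<epsilon>\<^sup>2 \<le> \<epsilon>" "\<epsilon>\<^sup>2 \<le> 1"
    using \<epsilon> mult_left_mono[of \<epsilon> 1 \<epsilon>] by (auto simp: power2_eq_square mult_le_one)
  have D0: "D > 0" using T0 \<epsilon>2 by (simp add: D_def)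
  have ED: "E = D * C / (256 * \<beta>\<^sup>2)"
    using b by (simp add: E_def D_def T_def \<beta>_def of_nat_diff power_mult_distrib mult_ac)
  have "2 * ln (real n) < D * C / (256 * \<beta>\<^sup>2)" using big unfolding ED[symmetric] E_def .
  then have "512 * \<beta>\<^sup>2 * ln (real n) < D * C" using \<beta> by (simp add: pos_less_divide_eq mult_ac)
  moreover have "512 * \<beta> * ln (real n) \<le> 512 * \<beta>\<^sup>2 * ln (real n)"
    using \<beta>2 lnn by (intro mult_right_mono) auto
  ultimately have DC: "512 * \<beta> * ln (real n) \<le> D * C" by linarith
  moreover have "512 * \<beta> * 1 \<le> 512 * \<beta> * ln (real n)" using lnn \<beta> by (intro mult_left_mono) auto
  ultimately have DC1: "512 * \<beta> \<le> D * C" by linarith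
  \<comment> \<open>As n - c is at least a fixed fraction of n and T \<le> n, lower bounds on D
    carry over to N \<epsilon>^2.\<close>
  have ND: "\<kappa>0 / 2 * D \<le> N * \<epsilon>\<^sup>2"
  proof -
    have "\<kappa>0 / 2 * D \<le> (\<kappa>0 / 2 * real n) * \<epsilon>\<^sup>2"
      using T0 \<kappa>0 \<epsilon>2 by (simp add: D_def mult_left_mono mult_right_mono)
    also have "\<dots> \<le> N * \<epsilon>\<^sup>2" using \<kappa>0 \<epsilon>2 by (intro mult_right_mono) (auto simp: N_def)
    finally show ?thesis .
  qed
  have NC: "256 * \<kappa>0 * \<beta> * ln (real n) \<le> N * \<epsilon>\<^sup>2 * C"
  proof -
    have "256 * \<kappa>0 * \<beta> * ln (real n) = \<kappa>0 / 2 * (512 * \<beta> * ln (real n))" by simp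
    also have "\<dots> \<le> \<kappa>0 / 2 * (D * C)" using \<kappa>0 by (intro mult_left_mono DC) auto
    also have "\<dots> \<le> N * \<epsilon>\<^sup>2 * C" using mult_right_mono[OF ND, of C] C by (simp add: mult_ac)
    finally show ?thesis .
  qed
  have NC1: "256 * \<kappa>0 * \<beta> \<le> N * \<epsilon>\<^sup>2 * C"
  proof -
    have "256 * \<kappa>0 * \<beta> * 1 \<le> 256 * \<kappa>0 * \<beta> * ln (real n)" using lnn \<beta> \<kappa>0 by (intro mult_left_mono) auto
    then show ?thesis using NC by linarith
  qed
  have l1: "48 * K \<le> T * \<epsilon>"
  proof -
    have "48 * K * C \<le> D * C" using blarge(1) DC1 \<beta> unfolding \<beta>_def[symmetric] by linarith
    then have "48 * K \<le> D" using C by simp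
    also have "D \<le> T * \<epsilon>" unfolding D_def using \<epsilon>2 T0 by (intro mult_left_mono) auto
    finally show ?thesis .
  qed
  have l2: "10 \<le> N * \<epsilon>"
  proof -
    have "10 * C \<le> N * \<epsilon>\<^sup>2 * C" using blarge(5) C NC1 unfolding \<beta>_def[symmetric] by linarith
    then have "10 \<le> N * \<epsilon>\<^sup>2" using C by simp
    also have "\<dots> \<le> N * \<epsilon>" using \<epsilon>2 N0 by (intro mult_left_mono) auto
    finally show ?thesis .
  qed
  \<comment> \<open>The assumption \<kappa>0 \<beta> \<ge> 2 gives 256 \<kappa>0 \<beta> \<ge> 512
    \<ge> 500.\<close>
  have l3: "ln N / C \<le> N * \<epsilon>\<^sup>2 / 500"
  proof (rule frac_leI)
    have "ln N \<le> ln (real n)" using N0 by simp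
    then have "ln N * 500 \<le> 256 * 2 * ln (real n)" using lnn by linarith
    also have "\<dots> \<le> 256 * (\<kappa>0 * \<beta>) * ln (real n)"
      using blarge(4) lnn unfolding \<beta>_def[symmetric] by (intro mult_right_mono mult_left_mono) auto
    also have "\<dots> \<le> N * \<epsilon>\<^sup>2 * C" using NC by (simp add: mult_ac)
    finally show "ln N * 500 \<le> N * \<epsilon>\<^sup>2 * C" .
  qed (use C in auto)
  have l4: "2304 * K\<^sup>2 \<le> N * \<epsilon>\<^sup>2 / 128"
  proof -
    have "2304 * 128 * K\<^sup>2 * C \<le> N * \<epsilon>\<^sup>2 * C" using blarge(3) NC1 unfolding \<beta>_def[symmetric] by linarith
    then show ?thesis using C by simp
  qed
  have l5: "L0 / real n \<le> \<epsilon> / 16"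
  proof (rule frac_leI)
    have "L0 * 16 * C \<le> D * C" using blarge(2) DC1 \<beta> unfolding \<beta>_def[symmetric] by linarith
    then have "L0 * 16 \<le> D" using C by simp
    also have "\<dots> \<le> real n * \<epsilon>" unfolding D_def using T0 \<epsilon>2 by (intro mult_mono) auto
    finally show "L0 * 16 \<le> \<epsilon> * real n" by (simp add: mult.commute)
  qed (use n0 in auto)
  \<comment> \<open>From here on, E is compared with the decay of the four error terms: net, gap
    martingale, U-statistics and null set.\<close>
  have e1: "E \<le> T * \<epsilon>\<^sup>2 / (512 * K\<^sup>2)"
    unfolding ED D_def[symmetric]
  proof (rule frac_leI)
    have "C * (512 * K\<^sup>2) = 256 * (2 * K\<^sup>2 * C)" by simp
    then have "C * (512 * K\<^sup>2) \<le> 256 * \<beta>\<^sup>2" using blarge(6) \<beta>2 unfolding \<beta>_def[symmetric] by linarith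
    from mult_left_mono[OF this, of D] D0 show "D * C * (512 * K\<^sup>2) \<le> D * (256 * \<beta>\<^sup>2)" by (simp add: mult_ac)
  qed (use \<beta> K_pos in auto)
  have e2: "E \<le> N * \<epsilon>\<^sup>2 / (1024 * \<beta>)"
  proof -
    have "E \<le> (\<kappa>0 / 2 * D) / (1024 * \<beta>)"
      unfolding ED
    proof (rule frac_leI)
      have "C * 1024 \<le> \<kappa>0 / 2 * 256 * \<beta>" using blarge(5) unfolding \<beta>_def[symmetric] by linarith
      from mult_right_mono[OF this, of "D * \<beta>"] D0 \<beta>
      show "D * C * (1024 * \<beta>) \<le> \<kappa>0 / 2 * D * (256 * \<beta>\<^sup>2)" by (simp add: power2_eq_square mult_ac)
    qed (use \<beta> in auto)
    also have "\<dots> \<le> N * \<epsilon>\<^sup>2 / (1024 * \<beta>)" using ND \<beta> by (intro divide_right_mono) auto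
    finally show ?thesis .
  qed
  have e4: "E \<le> N * \<epsilon>\<^sup>2 / (16384 * K\<^sup>2)"
  proof -
    have "E \<le> (\<kappa>0 / 2 * D) / (16384 * K\<^sup>2)"
      unfolding ED
    proof (rule frac_leI)
      have "\<kappa>0 * \<beta> \<le> \<kappa>0 * \<beta>\<^sup>2" using \<beta>2 \<kappa>0 by (intro mult_left_mono) auto
      moreover have "K\<^sup>2 * C \<ge> 0" using C by simp
      ultimately have "C * (16384 * K\<^sup>2) \<le> \<kappa>0 / 2 * (256 * \<beta>\<^sup>2)"
        using blarge(3) unfolding \<beta>_def[symmetric] by (simp add: mult_ac)
      from mult_left_mono[OF this, of D] D0
      show "D * C * (16384 * K\<^sup>2) \<le> \<kappa>0 / 2 * D * (256 * \<beta>\<^sup>2)" by (simp add: mult_ac)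
    qed (use \<beta> K_pos in auto)
    also have "\<dots> \<le> N * \<epsilon>\<^sup>2 / (16384 * K\<^sup>2)" using ND by (intro divide_right_mono) auto
    finally show ?thesis .
  qed
  \<comment> \<open>The shift by one and the rounding in \<open>div\<close> lose at most m \<le> T /
    4, so more than T / (2 m) complete blocks remain.\<close>
  have e3: "\<theta> (c - b - 1) \<le> exp (- E)"
  proof -
    let ?j = "c - b - 1"
    have mr: "real m > 0" using m_pos by simp
    have "?j < m * (?j div m + 1)" using m_pos dividend_less_times_div[of m ?j] by simp
    then have "c - b \<le> m * (?j div m + 1)" by linarith
    then have "T \<le> real m * (real (?j div m) + 1)" unfolding T_def
      by (metis of_nat_1 of_nat_add of_nat_le_iff of_nat_mult)
    moreover have "4 * real m \<le> T" using T unfolding T_def by (metis of_nat_le_iff of_nat_mult of_nat_numeral)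
    ultimately have "T / 2 \<le> real m * real (?j div m)" using mr by (simp add: algebra_simps)
    then have j: "T / (2 * real m) \<le> real (?j div m)" using mr by (simp add: field_simps)
    have "E \<le> \<delta> * T / (2 * real m)"
      unfolding ED
    proof (rule frac_leI)
      have "C * real m \<le> \<delta> * \<beta>\<^sup>2"
        using blarge(7) \<beta>2 \<delta>_pos mult_left_mono[of \<beta> "\<beta>\<^sup>2" \<delta>] unfolding \<beta>_def[symmetric] by linarith
      from mult_mono[OF mult_left_mono[OF \<epsilon>2(3), of T] this] T0 C mr
      have "D * (C * real m) \<le> T * (\<delta> * \<beta>\<^sup>2)" by (simp add: D_def)
      moreover have "0 \<le> T * (\<delta> * \<beta>\<^sup>2)" using T0 \<delta>_pos by simp
      ultimately show "D * C * (2 * real m) \<le> \<delta> * T * (256 * \<beta>\<^sup>2)" by (simp add: mult_ac)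
    qed (use \<beta> mr in auto)
    also have "\<dots> = \<delta> * (T / (2 * real m))" by simp
    also have "\<dots> \<le> \<delta> * real (?j div m)" using \<delta>_pos by (intro mult_left_mono j) auto
    finally have "exp (- (\<delta> * real (?j div m))) \<le> exp (- E)" by simp
    then show ?thesis using theta_le_exp[of ?j] by linarith
  qed
  let ?X = "exp (- E)" and ?g = "real (card G)"
  have "emeasure M {\<omega> \<in> space M. risk l \<pi> (h (t_hat \<omega> - b) \<omega>)
        \<ge> avg_paired_risk l b c (\<lambda>i. X i \<omega>) (\<lambda>t. h t \<omega>) n + \<epsilon>}
    \<le> ennreal (N * (?g * exp (- (T * \<epsilon>\<^sup>2 / (512 * K\<^sup>2))))
      + (\<beta> * exp (- (N * \<epsilon>\<^sup>2 / (1024 * \<beta>))) + N * \<theta> (c - b - 1))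
      + N * (2 * exp (- (N * \<epsilon>\<^sup>2 / (16384 * K\<^sup>2)))))"
    unfolding N_def T_def \<beta>_def
    by (rule selected_hypothesis_bound[OF alg b \<epsilon>(1) C B rate l5 _ _ _ _ G cover sel])
       (use l1 l2 l3 l4 in \<open>simp_all only: N_def T_def\<close>)
  also have "\<dots> \<le> ennreal (32 * (?g + 1) * exp (- E + 2 * ln (real n)))"
  proof (rule ennreal_leI)
    have "N * (?g * exp (- (T * \<epsilon>\<^sup>2 / (512 * K\<^sup>2)))) \<le> real n * (?g * ?X)"
      using e1 N0 by (intro mult_mono) auto
    moreover have "\<beta> * exp (- (N * \<epsilon>\<^sup>2 / (1024 * \<beta>))) \<le> real n * ?X"
      using e2 b \<beta> by (intro mult_mono) (auto simp: \<beta>_def)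
    moreover have "N * \<theta> (c - b - 1) \<le> real n * ?X"
      using e3 N0 theta_nonneg by (intro mult_mono) auto
    moreover have "N * (2 * exp (- (N * \<epsilon>\<^sup>2 / (16384 * K\<^sup>2)))) \<le> real n * (2 * ?X)"
      using e4 N0 by (intro mult_mono) auto
    \<comment> \<open>In g + 4, the 4 is 1 + 1 + 2 from the gap martingale, the null set and the
      U-statistics.\<close>
    ultimately have "N * (?g * exp (- (T * \<epsilon>\<^sup>2 / (512 * K\<^sup>2))))
      + (\<beta> * exp (- (N * \<epsilon>\<^sup>2 / (1024 * \<beta>))) + N * \<theta> (c - b - 1))
      + N * (2 * exp (- (N * \<epsilon>\<^sup>2 / (16384 * K\<^sup>2)))) \<le> (?g + 4) * (real n * ?X)"
      by (simp add: algebra_simps)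
    also have "\<dots> \<le> (32 * (?g + 1)) * (real n * real n * ?X)"
      using b by (intro mult_mono) auto
    also have "real n * real n * ?X = exp (- E + 2 * ln (real n))"
    proof -
      have "exp (- E + 2 * ln (real n)) = exp (- E) * exp (2 * ln (real n))" by (rule exp_add)
      also have "exp (2 * ln (real n)) = exp (ln (real n)) * exp (ln (real n))"
        unfolding exp_add[symmetric] by simp
      also have "exp (ln (real n)) = real n" by (rule exp_ln[OF n0])
      finally show ?thesis by (simp add: mult_ac)
    qed
    finally show "N * (?g * exp (- (T * \<epsilon>\<^sup>2 / (512 * K\<^sup>2))))
      + (\<beta> * exp (- (N * \<epsilon>\<^sup>2 / (1024 * \<beta>))) + N * \<theta> (c - b - 1))
      + N * (2 * exp (- (N * \<epsilon>\<^sup>2 / (16384 * K\<^sup>2)))) \<le> 32 * (?g + 1) * exp (- E + 2 * ln (real n))" .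
  qed
  finally show ?thesis unfolding E_def .
qed

end

section \<open>Lipschitz constant, covering number and the induced net of losses\<close>

text \<open>For v \<noteq> v' the difference quotient lies below every Lipschitz constant, hence
  below their infimum, so the infimum is itself a Lipschitz constant. The existence of one constant
  keeps the infimum of reals meaningful.\<close>

lemma
  assumes "\<exists>L. \<forall>u. L-lipschitz_on UNIV (\<phi> u)"
  shows Lip_nonneg: "0 \<le> Lip \<phi>"
    and abs_diff_le_Lip: "\<bar>\<phi> u v - \<phi> u v'\<bar> \<le> Lip \<phi> * \<bar>v - v'\<bar>"
proof -
  let ?A = "{L. \<forall>u. L-lipschitz_on UNIV (\<phi> u)}"
  have ne: "?A \<noteq> {}" using assms by auto
  show "0 \<le> Lip \<phi>"
    unfolding Lip_def using ne by (rule cInf_greatest) (auto dest: lipschitz_on_nonneg)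
  show "\<bar>\<phi> u v - \<phi> u v'\<bar> \<le> Lip \<phi> * \<bar>v - v'\<bar>"
  proof (cases "v = v'")
    case False
    have "\<bar>\<phi> u v - \<phi> u v'\<bar> / \<bar>v - v'\<bar> \<le> Lip \<phi>"
      unfolding Lip_def using ne
    proof (rule cInf_greatest)
      fix L assume "L \<in> ?A"
      then have "dist (\<phi> u v) (\<phi> u v') \<le> L * dist v v'" by (auto intro: lipschitz_onD)
      then show "\<bar>\<phi> u v - \<phi> u v'\<bar> / \<bar>v - v'\<bar> \<le> L"
        using False by (simp add: dist_real_def pos_divide_le_eq)
    qed
    then show ?thesis using False by (simp add: pos_divide_le_eq)
  qed simp
qed

lemma loss_diff_le_of_sup_dist:
  assumes lip: "\<exists>L. \<forall>u. L-lipschitz_on UNIV (\<phi> u)" and \<epsilon>: "\<epsilon> > 0"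
    and d: "sup_dist S g h \<le> ennreal \<epsilon> / ennreal (16 * Lip \<phi>)"
    and x: "x \<in> space S" and y: "y \<in> space S"
  shows "\<bar>loss \<phi> f h x y - loss \<phi> f g x y\<bar> \<le> \<epsilon> / 16"
proof -
  have le: "\<bar>loss \<phi> f h x y - loss \<phi> f g x y\<bar> \<le> Lip \<phi> * \<bar>h x y - g x y\<bar>"
    unfolding loss_def by (rule abs_diff_le_Lip[OF lip])
  show ?thesis
  proof (cases "Lip \<phi> = 0")
    \<comment> \<open>The radius is infinite here, so the distance carries no information, but
      \<phi> is then constant in its second variable.\<close>
    case True
    then show ?thesis using le \<epsilon> by simp
  next
    case False
    then have L: "Lip \<phi> > 0" using Lip_nonneg[OF lip] by simp
    have "ennreal \<bar>g x y - h x y\<bar> \<le> sup_dist S g h"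
      unfolding sup_dist_def by (rule SUP_upper2[of "(x, y)"]) (use x y in auto)
    also have "\<dots> \<le> ennreal (\<epsilon> / (16 * Lip \<phi>))"
      using d L \<epsilon> by (simp add: divide_ennreal)
    finally have "\<bar>h x y - g x y\<bar> \<le> \<epsilon> / (16 * Lip \<phi>)"
      using L \<epsilon> by (simp add: ennreal_le_iff abs_minus_commute)
    from mult_left_mono[OF this, of "Lip \<phi>"] L
    have "Lip \<phi> * \<bar>h x y - g x y\<bar> \<le> \<epsilon> / 16" by simp
    then show ?thesis using le by linarith
  qed
qed

text \<open>Cardinalities are natural numbers, so the infimum over a nonempty family is attained and
  supplies a net of exactly that size.\<close>

lemma covering_number_cases:
  obtains "covering_number S H \<eta> = \<top>"
  | G where "finite G" "G \<subseteq> H" "\<And>h. h \<in> H \<Longrightarrow> \<exists>g\<in>G. sup_dist S g h \<le> \<eta>"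
      "covering_number S H \<eta> = of_nat (card G)"
proof -
  let ?C = "{G. finite G \<and> G \<subseteq> H \<and> (\<forall>h\<in>H. \<exists>g\<in>G. sup_dist S g h \<le> \<eta>)}"
  show thesis
  proof (cases "?C = {}")
    case True
    then have "covering_number S H \<eta> = \<top>" unfolding covering_number_def True by simp
    then show thesis by (rule that(1))
  next
    case False
    then obtain G0 where "G0 \<in> ?C" by blast
    from ex_has_least_nat[of "\<lambda>G. G \<in> ?C", OF this, of card]
    obtain G where "G \<in> ?C \<and> (\<forall>G'. G' \<in> ?C \<longrightarrow> card G \<le> card G')" by (rule exE)
    then have G: "G \<in> ?C" and min: "\<And>G'. G' \<in> ?C \<Longrightarrow> card G \<le> card G'" by (rule conjunct1, blast)
    have "covering_number S H \<eta> = of_nat (card G)"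
      unfolding covering_number_def
      by (intro antisym INF_lower[OF G] INF_greatest) (use min in auto)
    then show thesis using G by (intro that(2)[of G]) auto
  qed
qed

section \<open>Large n and the regimes of \<epsilon>\<close>

theorem theorem5:
  fixes M :: "'w measure" and S :: "'e measure" and P :: "'e \<Rightarrow> 'e measure"
    and X :: "nat \<Rightarrow> 'w \<Rightarrow> 'e" and \<pi> \<mu> :: "'e measure" and m :: nat and \<delta> \<rho> \<tau> :: real
    and N :: "'v measure" and Y :: "nat \<Rightarrow> 'v \<Rightarrow> 'e" and R :: "nat \<Rightarrow> 'v \<Rightarrow> bool"
    and H :: "('e \<Rightarrow> 'e \<Rightarrow> real) set" and f :: "'e \<Rightarrow> real" and \<phi> :: "real \<Rightarrow> real \<Rightarrow> real"
    and \<xi> c :: real and \<epsilon> :: "nat \<Rightarrow> real"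
    and h :: "nat \<Rightarrow> nat \<Rightarrow> 'w \<Rightarrow> 'e \<Rightarrow> 'e \<Rightarrow> real" and t_hat :: "nat \<Rightarrow> 'w \<Rightarrow> nat"
  defines "l \<equiv> loss \<phi> f"
    and "q \<equiv> (\<xi> + 1) / ln (1 / \<rho>)"
  defines "b \<equiv> \<lambda>n::nat. nat \<lfloor>q * ln (real n)\<rfloor>"
    and "cn \<equiv> \<lambda>n::nat. nat \<lceil>c * real n\<rceil>"
    and "C \<equiv> conc_const m \<tau>"
  defines "\<gamma> \<equiv> \<lambda>n::nat. 64 * real (n - cn n + 1) * exp (- (real (n - cn n) * (\<epsilon> n)\<^sup>2 * C / 128))"
  assumes chain: "markov_chain M S P X"
    and stat: "stationary S P \<pi>"
    and rev: "reversible S P \<pi>"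
    and unif: "uniformly_ergodic S P m \<delta> \<mu>"
    and rate: "ergodicity_rate S P \<pi> \<rho>"
    and revD: "reverse_Doeblin S P"
    and split: "split_chain M S P X m \<delta> \<mu> N Y R"
    and tau_pos: "\<tau> > 0"
    and tau: "max (psi1_norm N (\<lambda>\<omega>. real (regen_time (\<lambda>k. R k \<omega>) 1)))
                  (psi1_norm N (\<lambda>\<omega>. real (regen_time (\<lambda>k. R k \<omega>) 2))) \<le> ennreal \<tau>"
    and H_meas: "\<And>g. g \<in> H \<Longrightarrow> (\<lambda>(x, y). g x y) \<in> borel_measurable (S \<Otimes>\<^sub>M S)"
    and f_meas: "f \<in> borel_measurable S"
    and phi_meas: "(\<lambda>(u, v). \<phi> u v) \<in> borel_measurable (borel \<Otimes>\<^sub>M borel)"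
    and phi_range: "\<And>u v. \<phi> u v \<in> {0..1}"
    and phi_Lip: "\<exists>L. \<forall>u. L-lipschitz_on UNIV (\<phi> u)"
    and alg: "\<And>n. online_algorithm M S X H n (h n)"
    and xi: "\<xi> > 0"
    and c: "0 < c" "c < 1"
    and eps_pos: "\<And>n. \<epsilon> n > 0"
    and eps_o: "\<epsilon> \<in> o(\<lambda>n. real n powr \<xi>)"
    and t_hat_meas: "\<And>n. t_hat n \<in> M \<rightarrow>\<^sub>M count_space UNIV"
    and t_hat_select: "\<And>n \<omega>. cn n + 2 \<le> n \<Longrightarrow> \<omega> \<in> space M \<Longrightarrow>
        selects l C (\<gamma> n) (b n) (cn n) (\<lambda>i. X i \<omega>) (\<lambda>t. h n t \<omega>) n (t_hat n \<omega>)"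
  shows "\<forall>\<^sub>F n in sequentially.
      emeasure M {\<omega> \<in> space M.
          risk l \<pi> (h n (t_hat n \<omega> - b n) \<omega>)
            \<ge> avg_paired_risk l (b n) (cn n) (\<lambda>i. X i \<omega>) (\<lambda>t. h n t \<omega>) n + \<epsilon> n}
        \<le> 32 * (covering_number S H (ennreal (\<epsilon> n) / ennreal (16 * Lip \<phi>)) + 1)
             * ennreal (exp (- ((real (cn n) - real (b n)) * C * (\<epsilon> n)\<^sup>2 / (16 * real (b n))\<^sup>2)
                             + 2 * ln (real n)))"
proof -
  define \<kappa>0 where "\<kappa>0 = 1 - c"
  have \<kappa>0: "\<kappa>0 > 0" using c by (simp add: \<kappa>0_def)
  have \<rho>: "0 < \<rho>" "\<rho> < 1" using rate by (auto simp: ergodicity_rate_def)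
  have un: "m \<ge> 1" "\<delta> > 0" "prob_space \<mu>" "sets \<mu> = sets S"
    "\<And>x A. x \<in> space S \<Longrightarrow> A \<in> sets S \<Longrightarrow> \<delta> * measure \<mu> A \<le> measure (kernel_pow S P m x) A"
    using unif by (auto simp: uniformly_ergodic_def)
  have P_meas: "P \<in> S \<rightarrow>\<^sub>M prob_algebra S" using chain by (simp add: markov_chain_def)
  interpret ol: online_learning S P \<pi> \<mu> m \<delta> M X H f \<phi>
    by (intro online_learning.intro doeblin_chain.intro doeblin_kernel.intro markov_kernel.intro
        doeblin_kernel_axioms.intro doeblin_chain_axioms.intro online_learning_axioms.intro)
      (assumption | rule P_meas stat un chain H_meas f_meas phi_meas phi_range)+
  interpret prob_space M by (rule ol.M_prob)
  let ?K = "ol.K"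
  have C: "C > 0" using un(1) tau_pos by (simp add: C_def conc_const_def)
  obtain L where L: "L > 0" and ae: "AE x in \<pi>. \<forall>n. \<forall>A\<in>sets S.
        \<bar>measure (kernel_pow S P n x) A - measure \<pi> A\<bar> \<le> L * \<rho> ^ n"
    using rate by (auto simp: ergodicity_rate_def)
  \<comment> \<open>\<open>B\<close> contains each state at which the rate fails for some n and A,
    so a single null set serves all b_n.\<close>
  from AE_E[OF ae] obtain B where B: "{x \<in> space \<pi>. \<not> (\<forall>n. \<forall>A\<in>sets S.
        \<bar>measure (kernel_pow S P n x) A - measure \<pi> A\<bar> \<le> L * \<rho> ^ n)} \<subseteq> B"
    "emeasure \<pi> B = 0" "B \<in> sets \<pi>" by blast
  have BS: "B \<in> sets S" "measure \<pi> B = 0" using B ol.sets_pi by (auto simp: measure_def)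
  have ratex: "\<bar>measure (kernel_pow S P n x) A - measure \<pi> A\<bar> \<le> L * \<rho> ^ n"
    if "x \<in> space S - B" "A \<in> sets S" for n x A
    using B(1) that ol.space_pi by blast
  have lnr: "ln (1 / \<rho>) > 0" using \<rho> by simp
  have q: "q > 0" using lnr xi by (simp add: q_def)
  have blow: "q * ln (real n) - 1 < real (b n)" for n unfolding b_def by linarith
  have bup: "real (b n) \<le> q * ln (real n)" if "n \<ge> 1" for n
  proof -
    have "0 \<le> q * ln (real n)" using q that by simp
    then show ?thesis unfolding b_def by (simp add: of_nat_nat)
  qed
  \<comment> \<open>The floor costs less than one step, hence the factor 1 / \<rho>; the main part
    \<rho>^(q ln n) = n^(-(\<xi> + 1)) is weakened to 1/n.\<close>
  have rb: "\<rho> ^ b n \<le> 1 / \<rho> / real n" if n: "n \<ge> 1" for n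
  proof -
    have lr: "ln \<rho> < 0" using \<rho> by simp
    have "\<rho> ^ b n = exp (real (b n) * ln \<rho>)" using \<rho> by (simp add: exp_of_nat_mult)
    also have "\<dots> \<le> exp ((q * ln (real n) - 1) * ln \<rho>)"
      using blow[of n] lr by (simp add: mult_right_mono_neg)
    also have "(q * ln (real n) - 1) * ln \<rho> = - (\<xi> + 1) * ln (real n) - ln \<rho>"
      using \<rho> lr by (simp add: q_def ln_div field_simps)
    also have "\<dots> \<le> - ln (real n) - ln \<rho>"
    proof -
      have "0 \<le> \<xi> * ln (real n)" using n xi by simp
      then show ?thesis by (simp add: algebra_simps)
    qed
    also have "exp (- ln (real n) - ln \<rho>) = 1 / \<rho> / real n"
      using \<rho> n by (simp add: exp_diff exp_minus field_simps)
    finally show ?thesis by simp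
  qed
  have evb: "\<forall>\<^sub>F n in sequentially. y \<le> real (b n)" for y
  proof -
    have "\<forall>\<^sub>F n in sequentially. y + 1 \<le> q * ln (real n)" using q by real_asymp
    then show ?thesis by eventually_elim (use blow in \<open>smt (verit)\<close>)
  qed
  \<comment> \<open>In this order: b_n + 4m \<le> c_n, b_n \<le> n - c_n, room for the rounding of
    c_n, and ln n \<ge> 1.\<close>
  have evs: "\<forall>\<^sub>F n in sequentially. q * ln (real n) + 4 * real m \<le> c * real n"
    "\<forall>\<^sub>F n in sequentially. q * ln (real n) \<le> \<kappa>0 / 2 * real n"
    "\<forall>\<^sub>F n in sequentially. 2 \<le> \<kappa>0 / 2 * real n"
    "\<forall>\<^sub>F n in sequentially. 1 \<le> ln (real n)"
    using q \<kappa>0 c by real_asymp+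
  show ?thesis
    \<comment> \<open>Apart from b_n \<ge> 1, the thresholds are the conditions
      \<open>blarge\<close> solved for b_n.\<close>
    using evs evb[of 1] evb[of "?K * C"] evb[of "L / \<rho> * C"] evb[of "1152 * ?K\<^sup>2 * C / \<kappa>0"] evb[of "2 / \<kappa>0"]
      evb[of "8 * C / \<kappa>0"] evb[of "2 * ?K\<^sup>2 * C"] evb[of "C * real m / \<delta>"] eventually_ge_at_top[of 1]
  proof eventually_elim
    case (elim n)
    let ?\<epsilon> = "\<epsilon> n"
    let ?E = "(real (cn n) - real (b n)) * C * ?\<epsilon>\<^sup>2 / (16 * real (b n))\<^sup>2"
    let ?A = "{\<omega> \<in> space M. risk l \<pi> (h n (t_hat n \<omega> - b n) \<omega>)
            \<ge> avg_paired_risk l (b n) (cn n) (\<lambda>i. X i \<omega>) (\<lambda>t. h n t \<omega>) n + ?\<epsilon>}"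
    let ?cov = "covering_number S H (ennreal ?\<epsilon> / ennreal (16 * Lip \<phi>))"
    have cn1: "c * real n \<le> real (cn n)" "real (cn n) \<le> c * real n + 1"
      unfolding cn_def using c by (auto simp: of_nat_nat)
    have bn: "real (b n) \<le> q * ln (real n)" using bup elim by simp
    have b1: "1 \<le> b n" using elim by simp
    have bT: "b n + 4 * m \<le> cn n"
    proof -
      have "real (b n) + 4 * real m \<le> real (cn n)" using bn elim cn1 by linarith
      then show ?thesis by (simp flip: of_nat_le_iff[where 'a=real])
    qed
    \<comment> \<open>The ceiling in c_n costs at most 1, paid by one half of \<kappa>0 n.\<close>
    have Nn: "\<kappa>0 / 2 * real n \<le> real n - real (cn n)"
    proof -
      have "\<kappa>0 / 2 * real n + \<kappa>0 / 2 * real n = real n - c * real n" by (simp add: \<kappa>0_def algebra_simps)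
      then show ?thesis using cn1 elim(3) by linarith
    qed
    have c2: "cn n + 2 \<le> n"
    proof -
      have "real (cn n) + 2 \<le> real n" using Nn elim(3) by linarith
      then show ?thesis by (simp flip: of_nat_le_iff[where 'a=real])
    qed
    have Nn': "\<kappa>0 / 2 * real n \<le> real (n - cn n)" using Nn c2 by (simp add: of_nat_diff)
    have bN: "b n \<le> n - cn n"
    proof -
      have "real (b n) \<le> real (n - cn n)" using bn elim(2) Nn' by linarith
      then show ?thesis by simp
    qed
    show ?case
    proof (cases rule: covering_number_cases[of S H "ennreal ?\<epsilon> / ennreal (16 * Lip \<phi>)"])
      case 1
      \<comment> \<open>The exponential factor is positive, so the right-hand side is
        infinite.\<close>
      then show ?thesis by (simp add: ennreal_mult_top ennreal_top_mult)
    next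
      case (2 G)
      have rhs: "32 * (?cov + 1) * ennreal (exp (- ?E + 2 * ln (real n)))
          = ennreal (32 * (real (card G) + 1) * exp (- ?E + 2 * ln (real n)))"
      proof -
        have "?cov + 1 = ennreal (real (card G) + 1)" unfolding 2(4) by (simp add: ennreal_of_nat_eq_real_of_nat)
        moreover have "(32 :: ennreal) = ennreal 32" by simp
        ultimately show ?thesis by (simp only: ennreal_mult[symmetric]) (simp add: ennreal_mult)
      qed
      have tn: "t_hat n \<omega> \<le> n" if "\<omega> \<in> space M" for \<omega>
        using t_hat_select[OF c2 that] by (auto simp: selects_def is_arg_min_def)
      consider "?\<epsilon> > 1" | "?E \<le> 2 * ln (real n)" | "?\<epsilon> \<le> 1" "2 * ln (real n) < ?E" by linarith
      then show ?thesis
      proof cases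
        case 1
        have "?A = {}"
        proof -
          have "risk l \<pi> (h n (t_hat n \<omega> - b n) \<omega>) \<le> 1" if "\<omega> \<in> space M" for \<omega>
            unfolding l_def using tn[OF that] by (intro ol.risk_integrals(4) ol.h_in[OF alg _ that]) simp
          moreover have "0 \<le> avg_paired_risk l (b n) (cn n) (\<lambda>i. X i \<omega>) (\<lambda>t. h n t \<omega>) n" for \<omega>
            unfolding avg_paired_risk_def paired_risk_def l_def
            by (intro divide_nonneg_nonneg sum_nonneg ol.l_range) auto
          ultimately show ?thesis using 1 by (smt (verit) empty_Collect_eq)
        qed
        then show ?thesis by (simp only: emeasure_empty zero_le)
      next
        case 2
        have "emeasure M ?A \<le> 1" by (rule emeasure_le_1)
        also have "1 \<le> ennreal (32 * (real (card G) + 1) * exp (- ?E + 2 * ln (real n)))"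
        proof -
          have "1 \<le> exp (- ?E + 2 * ln (real n))" using 2 by simp
          then have "1 * 1 \<le> 32 * (real (card G) + 1) * exp (- ?E + 2 * ln (real n))"
            by (intro mult_mono) auto
          then show ?thesis by (simp add: ennreal_ge_1)
        qed
        finally show ?thesis unfolding rhs .
      next
        case 3
        show ?thesis
          unfolding rhs l_def
        proof (rule ol.selected_hypothesis_bound_large[where B=B and ?\<kappa>0.0=\<kappa>0 and ?L0.0="L / \<rho>"])
          show "\<bar>measure (kernel_pow S P (b n) x) A - measure \<pi> A\<bar> \<le> L / \<rho> / real n"
            if "x \<in> space S - B" "A \<in> sets S" for x A
          proof -
            have "L * \<rho> ^ b n \<le> L * (1 / \<rho> / real n)" using rb[of n] elim L by (intro mult_left_mono) auto
            then show ?thesis using ratex[OF that, of "b n"] by simp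
          qed
          show "\<exists>g'\<in>G. \<forall>x\<in>space S. \<forall>y\<in>space S. \<bar>loss \<phi> f g x y - loss \<phi> f g' x y\<bar> \<le> ?\<epsilon> / 16"
            if "g \<in> H" for g
            using 2(3)[OF that] loss_diff_le_of_sup_dist[OF phi_Lip eps_pos] by meson
          show "selects (loss \<phi> f) C (64 * real (n - cn n + 1) * exp (- (real (n - cn n) * ?\<epsilon>\<^sup>2 * C / 128)))
              (b n) (cn n) (\<lambda>i. X i \<omega>) (\<lambda>t. h n t \<omega>) n (t_hat n \<omega>)" if "\<omega> \<in> space M" for \<omega>
            using t_hat_select[OF c2 that] by (simp add: l_def \<gamma>_def)
        qed (use alg b1 bT c2 bN un(1,2) eps_pos 3 C \<kappa>0 Nn' elim BS 2(1,2) in \<open>auto simp: pos_divide_le_eq mult.commute\<close>)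
      qed
    qed
  qed
qed

end
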